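(* Let $n$ be a positive integer, let $\Omega\subseteq\mathbb{R}^n$ be a bounded extension domain, let $u_0\in L^2(\Omega)$, and let $\{u_{0\varepsilon}\}_{\varepsilon\in(0,1)}\subseteq L^2(\Omega)$ be a family of functions such that $$\lim_{\varepsilon\to0^+}u_{0\varepsilon}=u_0\qquad\text{in }L^2(\Omega).$$ For every $\varepsilon\in(0,1)$, let $u_\varepsilon:[0,+\infty)\to L^2(\Omega)$ be the solution of the rescaled approximating problem with initial condition $u_{0\varepsilon}$, that is, the $L^2(\Omega)$-gradient-flow of the convex functional $E_\varepsilon^{**}$ with $u_\varepsilon(0)=u_{0\varepsilon}$. Let $u:[0,+\infty)\to L^2(\Omega)$ be the solution of the total variation flow with Neumann boundary conditions and initial datum $u_0$, that is, the $L^2(\Omega)$-gradient-flow of the functional $TV$ with $u(0)=u_0$. Then $$\lim_{\varepsilon\to0^+}\ \sup_{t\ge0}\ \|u_\varepsilon(t)-u(t)\|_{L^2(\Omega)}=0.$$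
   Context: Extension domain: an open set $\Omega\subseteq\mathbb{R}^n$ is an extension domain if $\partial\Omega$ is bounded and, for every open set $A\supseteq\overline{\Omega}$ and every integer $m\ge1$, there is a linear continuous extension operator $T$ from the ($L^1$-based) space $[BV(\Omega)]^m$ to $[BV(\mathbb{R}^n)]^m$ such that (a) $Tu=0$ a.e. in $\mathbb{R}^n\setminus A$ for every $u\in[BV(\Omega)]^m$; (b) $|D(Tu)|(\partial\Omega)=0$ for every $u\in[BV(\Omega)]^m$; (c) for every $p\in[1,+\infty]$ the restriction of $T$ to $[W^{1,p}(\Omega)]^m$ is a linear continuous map into $[W^{1,p}(\mathbb{R}^n)]^m$. Every bounded open set with Lipschitz boundary is an extension domain. Approximating functionals: for $\varepsilon\in(0,1)$ let $$\varphi_\varepsilon(\sigma):=\frac{1}{2\varepsilon|\log\varepsilon|}\log(1+\sigma^2)+\frac{\varepsilon}{4}\sigma^2,\qquad\sigma\in\mathbb{R},$$ and let $\varphi_\varepsilon^{**}$ be its convexification (the largest convex function on $\mathbb{R}$ that is $\le\varphi_\varepsilon$). Define $E_\varepsilon^{**}:L^2(\Omega)\to[0,+\infty]$ by $E_\varepsilon^{**}(u):=\int_\Omega\varphi_\varepsilon^{**}(|\nabla u(x)|)\,dx$ if $u\in H^1(\Omega)$ and $E_\varepsilon^{**}(u):=+\infty$ otherwise. Total variation: $TV(u)=\sup\{\int_\Omega u\,\mathrm{div}\,\phi\,dx:\ \phi\in C^1_c(\Omega;\mathbb{R}^n),\ |\phi|\le1\}\in[0,+\infty]$ for every $u\in L^2(\Omega)$.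 Gradient-flow: for a convex, lower semicontinuous functional $F:L^2(\Omega)\to[0,+\infty]$ with dense domain and $w_0\in L^2(\Omega)$, the gradient-flow of $F$ with initial datum $w_0$ is the unique $w\in C^0([0,+\infty);L^2(\Omega))$, locally absolutely continuous in $(0,+\infty)$, with $w(0)=w_0$ and $-w'(t)\in\partial F(w(t))$ for a.e. $t>0$, where $\partial F$ is the subdifferential of $F$ in $L^2(\Omega)$. It is also characterized by $w(0)=w_0$ and the integral inequality $F(w(s))-F(w(t))\ge\frac12\int_s^t\|w'(\tau)\|_{L^2(\Omega)}^2\,d\tau+\frac12\int_s^t\|\nabla F(w(\tau))\|_{L^2(\Omega)}^2\,d\tau$ for every $0\le s\le t$, where $\|\nabla F(w)\|_{L^2(\Omega)}$ denotes the minimal norm of an element of $\partial F(w)$. The gradient-flow of $E_\varepsilon^{**}$ is the solution of $u_t=\mathrm{div}\left[(\varphi_\varepsilon^{**})'(|\nabla u|)\frac{\nabla u}{|\nabla u|}\right]$ with homogeneous Neumann boundary conditions, and the gradient-flow of $TV$ is the solution of $u_t=\mathrm{div}\left(\frac{\nabla u}{|\nabla u|}\right)$ with Neumann boundary conditions. *)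

theory Defs
  imports "HOL-Probability.Essential_Supremum"
begin

text \<open>
  Elements of function spaces over an open set \<open>\<Omega>\<close> are represented by functions on the whole of
  \<open>real ^ 'n\<close>, whose values outside \<open>\<Omega>\<close> are irrelevant; equality of elements is equality almost
  everywhere with respect to \<open>lebesgue_on \<Omega>\<close>.
\<close>

section \<open>Lebesgue spaces\<close>

definition eLp_norm :: "ennreal \<Rightarrow> (real ^ 'n) set \<Rightarrow> (real ^ 'n \<Rightarrow> 'b::real_normed_vector) \<Rightarrow> ennreal" where
  "eLp_norm p \<Omega> f =
    (if p = \<infinity> then esssup (lebesgue_on \<Omega>) (\<lambda>x. ennreal (norm (f x)))
     else let I = (\<integral>\<^sup>+x. ennreal (norm (f x) powr enn2real p) \<partial>lebesgue_on \<Omega>)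
          in if I = \<infinity> then \<infinity> else ennreal (enn2real I powr (1 / enn2real p)))"

definition Lp :: "ennreal \<Rightarrow> (real ^ 'n) set \<Rightarrow> (real ^ 'n \<Rightarrow> 'b::real_normed_vector) set" where
  "Lp p \<Omega> = {f. f \<in> borel_measurable (lebesgue_on \<Omega>) \<and> eLp_norm p \<Omega> f < \<infinity>}"

abbreviation L2 :: "(real ^ 'n) set \<Rightarrow> (real ^ 'n \<Rightarrow> real) set" where
  "L2 \<equiv> Lp 2"

definition L2_inner :: "(real ^ 'n) set \<Rightarrow> (real ^ 'n \<Rightarrow> real) \<Rightarrow> (real ^ 'n \<Rightarrow> real) \<Rightarrow> real" where
  "L2_inner \<Omega> f g = (LINT x|lebesgue_on \<Omega>. f x * g x)"

definition L2_edist :: "(real ^ 'n) set \<Rightarrow> (real ^ 'n \<Rightarrow> real) \<Rightarrow> (real ^ 'n \<Rightarrow> real) \<Rightarrow> ennreal" where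
  "L2_edist \<Omega> f g = eLp_norm 2 \<Omega> (\<lambda>x. f x - g x)"

section \<open>Test fields, weak gradients and Sobolev spaces\<close>

text \<open>\<open>C\<^sup>1\<^sub>c(\<Omega>; real ^ 'n)\<close>, each field being extended by zero to the whole space.\<close>

definition C1c :: "(real ^ 'n) set \<Rightarrow> (real ^ 'n \<Rightarrow> real ^ 'n) set" where
  "C1c \<Omega> = {\<phi>. (\<exists>\<phi>'. (\<forall>x. (\<phi> has_derivative blinfun_apply (\<phi>' x)) (at x)) \<and> continuous_on UNIV \<phi>')
    \<and> compact (closure {x. \<phi> x \<noteq> 0}) \<and> closure {x. \<phi> x \<noteq> 0} \<subseteq> \<Omega>}"

definition divergence :: "(real ^ 'n \<Rightarrow> real ^ 'n) \<Rightarrow> real ^ 'n \<Rightarrow> real" where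
  "divergence \<phi> x = (\<Sum>i\<in>UNIV. frechet_derivative \<phi> (at x) (axis i 1) $ i)"

text \<open>Testing against fields and their divergence is testing each partial derivative separately.\<close>

definition weak_gradient :: "(real ^ 'n) set \<Rightarrow> (real ^ 'n \<Rightarrow> real) \<Rightarrow> (real ^ 'n \<Rightarrow> real ^ 'n) \<Rightarrow> bool" where
  "weak_gradient \<Omega> u g \<longleftrightarrow>
    (\<forall>K\<subseteq>\<Omega>. compact K \<longrightarrow> integrable (lebesgue_on K) u \<and> integrable (lebesgue_on K) g) \<and>
    (\<forall>\<phi>\<in>C1c \<Omega>. (LINT x|lebesgue_on \<Omega>. u x * divergence \<phi> x) = - (LINT x|lebesgue_on \<Omega>. g x \<bullet> \<phi> x))"

text \<open>A representative of the weak gradient, which is unique almost everywhere when it exists.\<close>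

definition wgrad :: "(real ^ 'n) set \<Rightarrow> (real ^ 'n \<Rightarrow> real) \<Rightarrow> real ^ 'n \<Rightarrow> real ^ 'n" where
  "wgrad \<Omega> u = (SOME g. weak_gradient \<Omega> u g)"

definition W1p :: "ennreal \<Rightarrow> (real ^ 'n) set \<Rightarrow> (real ^ 'n \<Rightarrow> real) set" where
  "W1p p \<Omega> = {u \<in> Lp p \<Omega>. \<exists>g\<in>Lp p \<Omega>. weak_gradient \<Omega> u g}"

abbreviation H1 :: "(real ^ 'n) set \<Rightarrow> (real ^ 'n \<Rightarrow> real) set" where
  "H1 \<equiv> W1p 2"

definition W1p_norm :: "ennreal \<Rightarrow> (real ^ 'n) set \<Rightarrow> (real ^ 'n \<Rightarrow> real) \<Rightarrow> ennreal" where
  "W1p_norm p \<Omega> u = eLp_norm p \<Omega> u + eLp_norm p \<Omega> (wgrad \<Omega> u)"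

section \<open>Total variation and functions of bounded variation\<close>

text \<open>
  The coercion \<open>ennreal\<close> replaces negative integrals by \<open>0\<close>; this does not change the supremum,
  since the zero field is admissible.
\<close>

definition TV :: "(real ^ 'n) set \<Rightarrow> (real ^ 'n \<Rightarrow> real) \<Rightarrow> ennreal" where
  "TV \<Omega> u = (SUP \<phi>\<in>{\<phi> \<in> C1c \<Omega>. \<forall>x. norm (\<phi> x) \<le> 1}.
      ennreal (LINT x|lebesgue_on \<Omega>. u x * divergence \<phi> x))"

definition BV :: "(real ^ 'n) set \<Rightarrow> (real ^ 'n \<Rightarrow> real) set" where
  "BV \<Omega> = {u \<in> Lp 1 \<Omega>. TV \<Omega> u < \<infinity>}"

definition BV_norm :: "(real ^ 'n) set \<Rightarrow> (real ^ 'n \<Rightarrow> real) \<Rightarrow> ennreal" where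
  "BV_norm \<Omega> u = eLp_norm 1 \<Omega> u + TV \<Omega> u"

text \<open>
  Functions with values in the \<open>m\<close>-dimensional space are families \<open>u\<close> of scalar components
  \<open>u i\<close>, \<open>i < m\<close>; the components with \<open>i \<ge> m\<close> are irrelevant. Product spaces carry the sum of the
  norms of the components.
\<close>

definition vec_space :: "nat \<Rightarrow> (real ^ 'n \<Rightarrow> real) set \<Rightarrow> (nat \<Rightarrow> real ^ 'n \<Rightarrow> real) set" where
  "vec_space m X = {u. \<forall>i<m. u i \<in> X}"

definition vec_norm :: "nat \<Rightarrow> ((real ^ 'n \<Rightarrow> real) \<Rightarrow> ennreal) \<Rightarrow> (nat \<Rightarrow> real ^ 'n \<Rightarrow> real) \<Rightarrow> ennreal" where
  "vec_norm m N u = (\<Sum>i<m. N (u i))"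

text \<open>
  The total variation measure \<open>\<bar>Du\<bar>\<close> of a vector-valued \<open>u\<close>: on open sets it is the variation of
  \<open>u\<close>, computed with \<open>m \<times> n\<close> matrix-valued test fields of Frobenius norm at most \<open>1\<close>, and it is
  extended to arbitrary sets by outer regularity.
\<close>

definition variation :: "nat \<Rightarrow> (real ^ 'n) set \<Rightarrow> (nat \<Rightarrow> real ^ 'n \<Rightarrow> real) \<Rightarrow> ennreal" where
  "variation m A u =
    (SUP \<phi>\<in>{\<phi>. (\<forall>i<m. \<phi> i \<in> C1c A) \<and> (\<forall>x. (\<Sum>i<m. (norm (\<phi> i x))\<^sup>2) \<le> 1)}.
      ennreal (\<Sum>i<m. LINT x|lebesgue_on A. u i x * divergence (\<phi> i) x))"

definition variation_measure :: "nat \<Rightarrow> (nat \<Rightarrow> real ^ 'n \<Rightarrow> real) \<Rightarrow> (real ^ 'n) set \<Rightarrow> ennreal" where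
  "variation_measure m u B = (INF A\<in>{A. open A \<and> B \<subseteq> A}. variation m A u)"

section \<open>Extension domains\<close>

text \<open>
  Since \<open>T\<close> acts on \<open>[BV(\<Omega>)]\<^sup>m\<close>, its restriction to \<open>[W\<^sup>1\<^sup>,\<^sup>p(\<Omega>)]\<^sup>m\<close> concerns the functions lying in
  both spaces; for bounded \<open>\<Omega>\<close> these are all of \<open>[W\<^sup>1\<^sup>,\<^sup>p(\<Omega>)]\<^sup>m\<close>. Continuity of a linear operator is
  boundedness. Together with linearity almost everywhere it makes \<open>T\<close> well defined on classes of
  functions that agree almost everywhere.
\<close>

definition extension_operator ::
  "nat \<Rightarrow> (real ^ 'n) set \<Rightarrow> (real ^ 'n) set \<Rightarrow>
   ((nat \<Rightarrow> real ^ 'n \<Rightarrow> real) \<Rightarrow> (nat \<Rightarrow> real ^ 'n \<Rightarrow> real)) \<Rightarrow> bool" where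
  "extension_operator m \<Omega> A T \<longleftrightarrow>
    (\<forall>u\<in>vec_space m (BV \<Omega>). T u \<in> vec_space m (BV UNIV)) \<and>
    (\<forall>u\<in>vec_space m (BV \<Omega>). \<forall>i<m. AE x in lebesgue_on \<Omega>. T u i x = u i x) \<and>
    (\<forall>u\<in>vec_space m (BV \<Omega>). \<forall>v\<in>vec_space m (BV \<Omega>). \<forall>i<m.
        AE x in lebesgue. T (\<lambda>j y. u j y + v j y) i x = T u i x + T v i x) \<and>
    (\<forall>u\<in>vec_space m (BV \<Omega>). \<forall>c::real. \<forall>i<m.
        AE x in lebesgue. T (\<lambda>j y. c * u j y) i x = c * T u i x) \<and>
    (\<exists>C::real. \<forall>u\<in>vec_space m (BV \<Omega>).
        vec_norm m (BV_norm UNIV) (T u) \<le> ennreal C * vec_norm m (BV_norm \<Omega>) u) \<and>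
    (\<forall>u\<in>vec_space m (BV \<Omega>). \<forall>i<m. AE x in lebesgue. x \<notin> A \<longrightarrow> T u i x = 0) \<and>
    (\<forall>u\<in>vec_space m (BV \<Omega>). variation_measure m (T u) (frontier \<Omega>) = 0) \<and>
    (\<forall>p\<ge>1.
        (\<forall>u\<in>vec_space m (BV \<Omega>) \<inter> vec_space m (W1p p \<Omega>). T u \<in> vec_space m (W1p p UNIV)) \<and>
        (\<exists>C::real. \<forall>u\<in>vec_space m (BV \<Omega>) \<inter> vec_space m (W1p p \<Omega>).
            vec_norm m (W1p_norm p UNIV) (T u) \<le> ennreal C * vec_norm m (W1p_norm p \<Omega>) u))"

definition extension_domain :: "(real ^ 'n) set \<Rightarrow> bool" where
  "extension_domain \<Omega> \<longleftrightarrow> open \<Omega> \<and> bounded (frontier \<Omega>) \<and>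
    (\<forall>A m. open A \<and> closure \<Omega> \<subseteq> A \<and> 1 \<le> m \<longrightarrow> (\<exists>T. extension_operator m \<Omega> A T))"

section \<open>The approximating functionals\<close>

definition phi_eps :: "real \<Rightarrow> real \<Rightarrow> real" where
  "phi_eps \<epsilon> \<sigma> = 1 / (2 * \<epsilon> * \<bar>ln \<epsilon>\<bar>) * ln (1 + \<sigma>\<^sup>2) + \<epsilon> / 4 * \<sigma>\<^sup>2"

text \<open>The largest convex minorant; meaningful for functions that have at least one convex minorant.\<close>

definition convexification :: "(real \<Rightarrow> real) \<Rightarrow> real \<Rightarrow> real" where
  "convexification f \<sigma> = (SUP g\<in>{g. convex_on UNIV g \<and> (\<forall>s. g s \<le> f s)}. g \<sigma>)"

definition E_eps :: "(real ^ 'n) set \<Rightarrow> real \<Rightarrow> (real ^ 'n \<Rightarrow> real) \<Rightarrow> ennreal" where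
  "E_eps \<Omega> \<epsilon> u =
    (if u \<in> H1 \<Omega>
     then \<integral>\<^sup>+x. ennreal (convexification (phi_eps \<epsilon>) (norm (wgrad \<Omega> u x))) \<partial>lebesgue_on \<Omega>
     else \<infinity>)"

section \<open>Gradient flows\<close>

definition subdifferential ::
  "(real ^ 'n) set \<Rightarrow> ((real ^ 'n \<Rightarrow> real) \<Rightarrow> ennreal) \<Rightarrow> (real ^ 'n \<Rightarrow> real) \<Rightarrow> (real ^ 'n \<Rightarrow> real) set" where
  "subdifferential \<Omega> F w =
    {\<xi> \<in> L2 \<Omega>. w \<in> L2 \<Omega> \<and> F w < \<infinity> \<and>
      (\<forall>v\<in>L2 \<Omega>. enn2ereal (F w) + ereal (L2_inner \<Omega> \<xi> (\<lambda>x. v x - w x)) \<le> enn2ereal (F v))}"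

definition L2_continuous_on :: "(real ^ 'n) set \<Rightarrow> real set \<Rightarrow> (real \<Rightarrow> real ^ 'n \<Rightarrow> real) \<Rightarrow> bool" where
  "L2_continuous_on \<Omega> I w \<longleftrightarrow>
    (\<forall>t\<in>I. ((\<lambda>s. L2_edist \<Omega> (w s) (w t)) \<longlongrightarrow> 0) (at t within I))"

definition L2_absolutely_continuous_on ::
  "(real ^ 'n) set \<Rightarrow> real \<Rightarrow> real \<Rightarrow> (real \<Rightarrow> real ^ 'n \<Rightarrow> real) \<Rightarrow> bool" where
  "L2_absolutely_continuous_on \<Omega> a b w \<longleftrightarrow>
    (\<forall>e>0. \<exists>d>0. \<forall>(N::nat) l r.
      (\<forall>k<N. a \<le> l k \<and> l k \<le> r k \<and> r k \<le> b) \<and> disjoint_family_on (\<lambda>k. {l k<..<r k}) {..<N} \<and>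
      (\<Sum>k<N. r k - l k) < d \<longrightarrow>
      (\<Sum>k<N. L2_edist \<Omega> (w (r k)) (w (l k))) < ennreal e)"

definition has_L2_derivative ::
  "(real ^ 'n) set \<Rightarrow> (real \<Rightarrow> real ^ 'n \<Rightarrow> real) \<Rightarrow> (real ^ 'n \<Rightarrow> real) \<Rightarrow> real \<Rightarrow> bool" where
  "has_L2_derivative \<Omega> w w' t \<longleftrightarrow>
    w' \<in> L2 \<Omega> \<and> ((\<lambda>h. L2_edist \<Omega> (\<lambda>x. (w (t + h) x - w t x) / h) w') \<longlongrightarrow> 0) (at 0)"

definition gradient_flow ::
  "(real ^ 'n) set \<Rightarrow> ((real ^ 'n \<Rightarrow> real) \<Rightarrow> ennreal) \<Rightarrow> (real ^ 'n \<Rightarrow> real) \<Rightarrow>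
   (real \<Rightarrow> real ^ 'n \<Rightarrow> real) \<Rightarrow> bool" where
  "gradient_flow \<Omega> F w\<^sub>0 w \<longleftrightarrow>
    (\<forall>t\<ge>0. w t \<in> L2 \<Omega>) \<and>
    L2_continuous_on \<Omega> {0..} w \<and>
    (\<forall>a b. 0 < a \<and> a \<le> b \<longrightarrow> L2_absolutely_continuous_on \<Omega> a b w) \<and>
    (AE x in lebesgue_on \<Omega>. w 0 x = w\<^sub>0 x) \<and>
    (AE t in lborel. 0 < t \<longrightarrow>
      (\<exists>w'. has_L2_derivative \<Omega> w w' t \<and> (\<lambda>x. - w' x) \<in> subdifferential \<Omega> F (w t)))"

end

theory Submission
  imports Defs
begin

text \<open>
  The flows are compared in the Hilbert space of square integrable functions. If \<open>u\<close> is the flow of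
  \<open>TV\<close>, \<open>x\<close> the flow of the approximating energy \<open>E\<close>, and \<open>v\<close> any competitor, the subdifferential
  inequalities give almost everywhere
  \<open>(1/2) d/dt \<parallel>x - u\<parallel>\<^sup>2 \<le> (E(v) - E(x)) + (TV(x) - TV(u)) + \<parallel>x'\<parallel> \<parallel>v - u\<parallel>\<close>.
  On an interval \<open>[p, q]\<close> one takes for \<open>v\<close> a recovery element of \<open>u(q)\<close>: since \<open>TV\<close> decreases along its
  flow, \<open>E(v)\<close> is at most \<open>TV(u(t))\<close> up to a small error, \<open>TV(x) - E(x)\<close> is small because the
  convexified integrand dominates \<open>(1 - \<eta>)\<sigma> - \<eta>\<close>, and \<open>\<parallel>x'\<parallel>\<close> is bounded away from \<open>t = 0\<close> by the
  regularizing effect. For small times both flows stay near a fixed competitor. For large times, \<open>TV\<close>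
  being even, \<open>u\<close> converges strongly to a limit of total variation zero (Bruck); this is an equilibrium
  of every approximating flow, so the distance to it cannot increase.

  Recovery elements are truncated mollifications of the extension of a function to the whole space, whose
  variation does not charge the boundary.
\<close>

section \<open>Absolutely continuous curves\<close>

text \<open>The inequality comes from splitting \<open>x' - u'\<close> against \<open>x - u\<close>
  into \<open>x'\<close> against \<open>x - v\<close>, \<open>x'\<close> against
  \<open>v - u\<close> and \<open>u'\<close> against \<open>u - x\<close>; the outer two are
  subdifferential inequalities. The obstacle is the middle term. Recovery elements are found for one
  state at a time, so \<open>v\<close> is frozen on each of finitely many short intervals;
  \<open>v - u\<close> is then small by continuity only and has to be multiplied by a speed bounded
  independently of \<epsilon>. That bound must be extracted from the almost everywhere inclusion
  alone: nothing is assumed about measurability or continuity of the energy along a flow. Hence no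
  energy is ever integrated; only growth estimates for squared distances are, with pointwise bounds
  on the energy at good times, and the monotonicity of speed and energy goes back to the contraction
  of translates of a flow. The error on an interval is proportional to its length, so the number of
  intervals is free, but the total grows with the final time. This is why a strong limit at infinity
  is required to cut time off.\<close>

definition ac_on :: "real \<Rightarrow> real \<Rightarrow> (real \<Rightarrow> 'a::real_normed_vector) \<Rightarrow> bool" where
  "ac_on a b w \<longleftrightarrow>
    (\<forall>e>0. \<exists>d>0. \<forall>(N::nat) l r.
      (\<forall>k<N. a \<le> l k \<and> l k \<le> r k \<and> r k \<le> b) \<and> disjoint_family_on (\<lambda>k. {l k<..<r k}) {..<N} \<and>
      (\<Sum>k<N. r k - l k) < d \<longrightarrow> (\<Sum>k<N. norm (w (r k) - w (l k))) < e)"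

text \<open>Covers both uses of absolute continuity: differences of two curves, and the squared norm
  of a curve on a compact interval, where \<open>C\<close> is a bound for the norm.\<close>

lemma ac_on_dominated:
  assumes "ac_on a b w\<^sub>1" "ac_on a b w\<^sub>2"
    and le: "\<And>s t. \<lbrakk>a \<le> s; s \<le> t; t \<le> b\<rbrakk> \<Longrightarrow>
      norm (f t - f s) \<le> C * (norm (w\<^sub>1 t - w\<^sub>1 s) + norm (w\<^sub>2 t - w\<^sub>2 s))"
  shows "ac_on a b f"
  unfolding ac_on_def
proof (intro allI impI)
  fix e :: real assume "e > 0"
  define e' where "e' = e / (2 * (\<bar>C\<bar> + 1))"
  have "e' > 0" using \<open>e > 0\<close> by (simp add: e'_def add_pos_nonneg)
  obtain d1 where d1: "d1 > 0" "\<And>(N::nat) l r. (\<forall>k<N. a \<le> l k \<and> l k \<le> r k \<and> r k \<le> b) \<Longrightarrow>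
      disjoint_family_on (\<lambda>k. {l k<..<r k}) {..<N} \<Longrightarrow> (\<Sum>k<N. r k - l k) < d1 \<Longrightarrow>
      (\<Sum>k<N. norm (w\<^sub>1 (r k) - w\<^sub>1 (l k))) < e'"
    using assms(1) \<open>e' > 0\<close> unfolding ac_on_def by meson
  obtain d2 where d2: "d2 > 0" "\<And>(N::nat) l r. (\<forall>k<N. a \<le> l k \<and> l k \<le> r k \<and> r k \<le> b) \<Longrightarrow>
      disjoint_family_on (\<lambda>k. {l k<..<r k}) {..<N} \<Longrightarrow> (\<Sum>k<N. r k - l k) < d2 \<Longrightarrow>
      (\<Sum>k<N. norm (w\<^sub>2 (r k) - w\<^sub>2 (l k))) < e'"
    using assms(2) \<open>e' > 0\<close> unfolding ac_on_def by meson
  show "\<exists>d>0. \<forall>(N::nat) l r.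
      (\<forall>k<N. a \<le> l k \<and> l k \<le> r k \<and> r k \<le> b) \<and> disjoint_family_on (\<lambda>k. {l k<..<r k}) {..<N} \<and>
      (\<Sum>k<N. r k - l k) < d \<longrightarrow> (\<Sum>k<N. norm (f (r k) - f (l k))) < e"
  proof (intro exI[of _ "min d1 d2"] conjI allI impI)
    fix N :: nat and l r :: "nat \<Rightarrow> real"
    assume H: "(\<forall>k<N. a \<le> l k \<and> l k \<le> r k \<and> r k \<le> b) \<and> disjoint_family_on (\<lambda>k. {l k<..<r k}) {..<N} \<and>
      (\<Sum>k<N. r k - l k) < min d1 d2"
    have "(\<Sum>k<N. norm (f (r k) - f (l k)))
        \<le> (\<Sum>k<N. C * (norm (w\<^sub>1 (r k) - w\<^sub>1 (l k)) + norm (w\<^sub>2 (r k) - w\<^sub>2 (l k))))"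
      using H by (intro sum_mono le) auto
    also have "\<dots> = C * ((\<Sum>k<N. norm (w\<^sub>1 (r k) - w\<^sub>1 (l k))) + (\<Sum>k<N. norm (w\<^sub>2 (r k) - w\<^sub>2 (l k))))"
      by (simp add: sum_distrib_left[symmetric] sum.distrib)
    also have "\<dots> \<le> (\<bar>C\<bar> + 1) * ((\<Sum>k<N. norm (w\<^sub>1 (r k) - w\<^sub>1 (l k))) + (\<Sum>k<N. norm (w\<^sub>2 (r k) - w\<^sub>2 (l k))))"
      by (intro mult_right_mono add_nonneg_nonneg sum_nonneg) auto
    also have "\<dots> < (\<bar>C\<bar> + 1) * (e' + e')"
      using d1(2)[of N l r] d2(2)[of N l r] H by (intro mult_strict_left_mono add_strict_mono) auto
    also have "\<dots> = e"
      unfolding e'_def using abs_ge_zero[of C] by (simp add: divide_simps del: abs_ge_zero)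
    finally show "(\<Sum>k<N. norm (f (r k) - f (l k))) < e" .
  qed (use d1 d2 in auto)
qed

lemma ac_on_diff: "\<lbrakk>ac_on a b v; ac_on a b w\<rbrakk> \<Longrightarrow> ac_on a b (\<lambda>t. v t - w t)"
proof (erule ac_on_dominated[where C=1], assumption)
  fix s t :: real
  show "norm (v t - w t - (v s - w s)) \<le> 1 * (norm (v t - v s) + norm (w t - w s))"
    using norm_triangle_ineq4[of "v t - v s" "w t - w s"] by (simp add: algebra_simps)
qed

lemma ac_on_const: "ac_on a b (\<lambda>t. c)"
  unfolding ac_on_def by (auto intro: exI[of _ 1])

lemma ac_on_shift: "ac_on (a + h) (b + h) w \<Longrightarrow> ac_on a b (\<lambda>t. w (t + h))"
  unfolding ac_on_def
proof (intro allI impI)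
  fix e :: real
  assume H: "\<forall>e>0. \<exists>d>0. \<forall>(N::nat) l r.
      (\<forall>k<N. a + h \<le> l k \<and> l k \<le> r k \<and> r k \<le> b + h) \<and> disjoint_family_on (\<lambda>k. {l k<..<r k}) {..<N} \<and>
      (\<Sum>k<N. r k - l k) < d \<longrightarrow> (\<Sum>k<N. norm (w (r k) - w (l k))) < e" "e > 0"
  then obtain d where d: "d > 0" "\<And>(N::nat) l r.
      (\<forall>k<N. a + h \<le> l k \<and> l k \<le> r k \<and> r k \<le> b + h) \<Longrightarrow> disjoint_family_on (\<lambda>k. {l k<..<r k}) {..<N} \<Longrightarrow>
      (\<Sum>k<N. r k - l k) < d \<Longrightarrow> (\<Sum>k<N. norm (w (r k) - w (l k))) < e" by meson
  have disj: "disjoint_family_on (\<lambda>k. {l k + h<..<r k + h}) {..<N}"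
    if "disjoint_family_on (\<lambda>k. {l k<..<r k}) {..<N}" for l r :: "nat \<Rightarrow> real" and N
    unfolding disjoint_family_on_def
  proof (intro ballI impI)
    fix m n assume "m \<in> {..<N}" "n \<in> {..<N}" "m \<noteq> n"
    then have "{l m<..<r m} \<inter> {l n<..<r n} = {}" using that by (auto simp: disjoint_family_on_def)
    \<comment> \<open>Disjointness is turned into an inequality between end points, the form in
      which it survives a translation.\<close>
    then have "max (l m) (l n) \<ge> min (r m) (r n)" by simp
    then show "{l m + h<..<r m + h} \<inter> {l n + h<..<r n + h} = {}" by (auto simp: max_def min_def split: if_splits)
  qed
  show "\<exists>d>0. \<forall>(N::nat) l r.
      (\<forall>k<N. a \<le> l k \<and> l k \<le> r k \<and> r k \<le> b) \<and> disjoint_family_on (\<lambda>k. {l k<..<r k}) {..<N} \<and>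
      (\<Sum>k<N. r k - l k) < d \<longrightarrow> (\<Sum>k<N. norm (w (r k + h) - w (l k + h))) < e"
  proof (intro exI[of _ d] conjI allI impI)
    fix N :: nat and l r :: "nat \<Rightarrow> real"
    assume "(\<forall>k<N. a \<le> l k \<and> l k \<le> r k \<and> r k \<le> b) \<and> disjoint_family_on (\<lambda>k. {l k<..<r k}) {..<N} \<and>
      (\<Sum>k<N. r k - l k) < d"
    then show "(\<Sum>k<N. norm (w (r k + h) - w (l k + h))) < e"
      by (intro d(2) disj) auto
  qed (use d in auto)
qed

text \<open>
  In a fine tagged division, the intervals with tags in the exceptional null set have small total length.
\<close>

lemma ac_on_derivative_le:
  fixes f :: "real \<Rightarrow> real"
  assumes "a \<le> b" and ac: "ac_on a b f" and N: "negligible N"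
    and D: "\<And>t. t \<in> {a<..<b} - N \<Longrightarrow> \<exists>f'\<le>c. (f has_real_derivative f') (at t)"
  shows "f b - f a \<le> c * (b - a)"
proof (rule field_le_epsilon)
  fix e0 :: real assume "e0 > 0"
  define e where "e = e0 / (b - a + 2)"
  have "e > 0" using \<open>e0 > 0\<close> \<open>a \<le> b\<close> by (simp add: e_def)
  obtain d0 where d0: "d0 > 0" "\<And>(N::nat) l r. (\<forall>k<N. a \<le> l k \<and> l k \<le> r k \<and> r k \<le> b) \<Longrightarrow>
      disjoint_family_on (\<lambda>k. {l k<..<r k}) {..<N} \<Longrightarrow> (\<Sum>k<N. r k - l k) < d0 \<Longrightarrow>
      (\<Sum>k<N. norm (f (r k) - f (l k))) < e"
    using ac \<open>e > 0\<close> unfolding ac_on_def by meson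
  \<comment> \<open>The second bound makes the total length of the exceptional intervals negligible
    even after multiplication by \<open>c + e\<close>, whose sign is unknown.\<close>
  define d where "d = min d0 (e / (\<bar>c\<bar> + e + 1))"
  have "d > 0" using d0 \<open>e > 0\<close> by (auto simp: d_def)
  \<comment> \<open>A tag may be an end point of \<open>{a..b}\<close>, where no derivative is
    given; there, as on \<open>N\<close>, absolute continuity takes over.\<close>
  define N' where "N' = N \<union> {a, b}"
  have N': "N' \<in> null_sets lebesgue"
    using N by (simp add: N'_def negligible_iff_null_sets[symmetric])
  obtain T where T: "open T" "N' \<subseteq> T" "T - N' \<in> lmeasurable" "emeasure lebesgue (T - N') < ennreal d"
    using sets_lebesgue_outer_open[of N' d] N' \<open>d > 0\<close> by (metis null_setsD2)
  have Tm: "emeasure lebesgue T < ennreal d"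
  proof -
    have "emeasure lebesgue T = emeasure lebesgue (N' \<union> (T - N'))"
      using T(2) by (simp add: Un_absorb1)
    also have "\<dots> = emeasure lebesgue (T - N')"
      unfolding Un_commute[of N'] by (rule emeasure_Un_null_set) (use N' T(3) in \<open>auto simp: fmeasurableD\<close>)
    finally show ?thesis using T(4) by simp
  qed
  have "\<exists>\<delta>>0. \<forall>y. \<bar>y - t\<bar> < \<delta> \<longrightarrow> (\<exists>f'\<le>c. \<bar>f y - f t - f' * (y - t)\<bar> \<le> e * \<bar>y - t\<bar>)" if t: "t \<in> {a<..<b} - N" for t
  proof -
    obtain f' where f': "f' \<le> c" "(f has_real_derivative f') (at t)" using D[OF t] by blast
    then obtain \<delta> where "\<delta> > 0" "\<And>y. norm (y - t) < \<delta> \<Longrightarrow> norm (f y - f t - f' * (y - t)) \<le> e * norm (y - t)"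
      using \<open>e > 0\<close> unfolding has_field_derivative_def has_derivative_at_alt by meson
    then have "\<forall>y. \<bar>y - t\<bar> < \<delta> \<longrightarrow> (\<exists>f'\<le>c. \<bar>f y - f t - f' * (y - t)\<bar> \<le> e * \<bar>y - t\<bar>)"
      using f'(1) by (auto intro!: exI[of _ f'])
    then show ?thesis using \<open>\<delta> > 0\<close> by blast
  qed
  then obtain \<delta> where \<delta>: "\<And>t. t \<in> {a<..<b} - N \<Longrightarrow> \<delta> t > 0"
    "\<And>t y. t \<in> {a<..<b} - N \<Longrightarrow> \<bar>y - t\<bar> < \<delta> t \<Longrightarrow> \<exists>f'\<le>c. \<bar>f y - f t - f' * (y - t)\<bar> \<le> e * \<bar>y - t\<bar>"
    by metis
  \<comment> \<open>At a good tag the derivative controls the increment; at an exceptional one the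
    interval is confined to the open set \<open>T\<close> of small measure. The last case concerns
    points outside \<open>{a..b}\<close> only.\<close>
  define \<gamma> where "\<gamma> t = (if t \<in> {a<..<b} - N then ball t (\<delta> t) else if t \<in> N' then T else ball t 1)" for t
  have "gauge \<gamma>" unfolding gauge_def \<gamma>_def using \<delta> T by auto
  then obtain p where p: "p tagged_division_of {a..b}" "\<gamma> fine p"
    using fine_division_exists_real by blast
  note pd = tagged_division_ofD[OF p(1)]
  define q where "q = {(x, K) \<in> p. x \<in> N'}"
  have "finite q" "q \<subseteq> p" using pd(1) by (auto simp: q_def intro: finite_subset)
  have K: "\<exists>u v. K = {u..v} \<and> u \<le> v \<and> a \<le> u \<and> v \<le> b \<and> x \<in> {u..v}" if xK: "(x, K) \<in> p" for x K
  proof -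
    obtain u v where uv: "K = {u..v}" using pd(4)[OF xK] by (metis cbox_interval)
    show ?thesis using pd(2,3)[OF xK] uv by (intro exI[of _ u] exI[of _ v]) auto
  qed
  define g where "g = (\<lambda>(x::real, K::real set). f (Sup K) - f (Inf K))"
  define h where "h = (\<lambda>(x::real, K::real set). Sup K - Inf K)"
  have sg: "sum g p = f b - f a" and sh: "sum h p = b - a"
    using additive_tagged_division_1[OF \<open>a \<le> b\<close> p(1), of f]
      additive_tagged_division_1[OF \<open>a \<le> b\<close> p(1), of "\<lambda>x. x"] by (simp_all add: g_def h_def)
  have 1: "sum g (p - q) \<le> (c + e) * sum h (p - q)"
    unfolding sum_distrib_left
  proof (rule sum_mono, clarify)
    fix x K assume xK: "(x, K) \<in> p" "(x, K) \<notin> q"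
    then have "x \<notin> N'" by (auto simp: q_def)
    obtain u v where uv: "K = {u..v}" "u \<le> v" "a \<le> u" "v \<le> b" "x \<in> {u..v}" using K[OF xK(1)] by blast
    then have x: "x \<in> {a<..<b} - N" using \<open>x \<notin> N'\<close> by (auto simp: N'_def less_le)
    have "\<gamma> x = ball x (\<delta> x)" unfolding \<gamma>_def using x by (rule if_P)
    then have "K \<subseteq> ball x (\<delta> x)" using fineD[OF p(2) xK(1)] by simp
    moreover have "u \<in> K" "v \<in> K" using uv by auto
    ultimately have "u \<in> ball x (\<delta> x)" "v \<in> ball x (\<delta> x)" by blast+
    then have "\<bar>u - x\<bar> < \<delta> x" "\<bar>v - x\<bar> < \<delta> x" by (auto simp: dist_real_def abs_minus_commute)
    \<comment> \<open>The slope estimate is applied on the two sides of the tag, each with its own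
      witness below \<open>c\<close>.\<close>
    then obtain f1 f2 where f12: "f1 \<le> c" "f2 \<le> c" "\<bar>f u - f x - f1 * (u - x)\<bar> \<le> e * \<bar>u - x\<bar>"
       "\<bar>f v - f x - f2 * (v - x)\<bar> \<le> e * \<bar>v - x\<bar>" using \<delta>(2)[OF x] by metis
    have "f1 * (x - u) \<le> c * (x - u)" "f2 * (v - x) \<le> c * (v - x)"
      using f12 uv by (auto intro: mult_right_mono)
    then have "f v - f u \<le> (c + e) * (v - u)"
      using f12(3,4) uv(5) by (auto simp: algebra_simps abs_le_iff)
    then show "g (x, K) \<le> (c + e) * h (x, K)" using uv by (simp add: g_def h_def)
  qed
  obtain en where en: "bij_betw en {..<card q} q"
    using \<open>finite q\<close> by (metis ex_bij_betw_nat_finite lessThan_atLeast0)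
  define l where "l k = Inf (snd (en k))" for k
  define r where "r k = Sup (snd (en k))" for k
  have enq: "en k \<in> q" if "k < card q" for k using bij_betwE[OF en] that by blast
  have lr: "snd (en k) = {l k..r k} \<and> a \<le> l k \<and> l k \<le> r k \<and> r k \<le> b" if k: "k < card q" for k
  proof -
    have "(fst (en k), snd (en k)) \<in> p" using enq[OF k] \<open>q \<subseteq> p\<close> by auto
    then obtain u v where uv: "snd (en k) = {u..v}" "u \<le> v" "a \<le> u" "v \<le> b" using K by blast
    moreover have "l k = u" "r k = v" using uv(2) by (simp_all add: l_def r_def uv(1))
    ultimately show ?thesis by simp
  qed
  have disj: "disjoint_family_on (\<lambda>k. {l k<..<r k}) {..<card q}"
    unfolding disjoint_family_on_def
  proof (intro ballI impI)
    fix m n assume mn: "m \<in> {..<card q}" "n \<in> {..<card q}" "m \<noteq> n"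
    have "en m \<noteq> en n"
    proof
      assume "en m = en n"
      then have "m = n" using bij_betw_imp_inj_on[OF en] mn(1,2) by (simp only: inj_on_eq_iff)
      then show False using mn(3) by simp
    qed
    moreover have "en m \<in> p" "en n \<in> p" using enq[of m] enq[of n] mn \<open>q \<subseteq> p\<close> by auto
    ultimately have "interior (snd (en m)) \<inter> interior (snd (en n)) = {}"
      using pd(5)[of "fst (en m)" "snd (en m)" "fst (en n)" "snd (en n)"] by (auto simp: prod_eq_iff)
    then show "{l m<..<r m} \<inter> {l n<..<r n} = {}" using lr mn by simp
  qed
  have sub: "{l k<..<r k} \<subseteq> T" if k: "k < card q" for k
  proof -
    have "(fst (en k), snd (en k)) \<in> p" "fst (en k) \<in> N'" using enq[OF k] by (auto simp: q_def)
    moreover have "\<gamma> t = T" if "t \<in> N'" for t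
      using that by (simp add: \<gamma>_def) (auto simp: N'_def)
    ultimately have "snd (en k) \<subseteq> T" using fineD[OF p(2)] by metis
    then show ?thesis using lr[OF k] by auto
  qed
  have shq: "sum h q = (\<Sum>k<card q. r k - l k)"
    by (subst sum.reindex_bij_betw[OF en, symmetric]) (simp add: h_def l_def r_def case_prod_beta)
  have "(\<Sum>k<card q. r k - l k) = (\<Sum>k<card q. measure lebesgue {l k<..<r k})"
    using lr by (intro sum.cong) auto
  also have "\<dots> = measure lebesgue (\<Union>k<card q. {l k<..<r k})"
    by (rule measure_finite_Union[symmetric]) (use disj lr in \<open>auto simp: less_top[symmetric]\<close>)
  also have "\<dots> \<le> measure lebesgue T"
    using sub T(1) Tm by (intro measure_mono_fmeasurable) (auto simp: fmeasurable_def intro: less_trans)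
  also have "\<dots> < d"
  proof -
    have "emeasure lebesgue T \<noteq> top" using Tm by auto
    then show ?thesis using Tm by (simp add: emeasure_eq_ennreal_measure ennreal_less_iff)
  qed
  finally have small: "(\<Sum>k<card q. r k - l k) < d" .
  have "sum g q = (\<Sum>k<card q. f (r k) - f (l k))"
    by (subst sum.reindex_bij_betw[OF en, symmetric]) (simp add: g_def l_def r_def case_prod_beta)
  also have "\<dots> \<le> (\<Sum>k<card q. norm (f (r k) - f (l k)))" by (intro sum_mono) simp
  also have "\<dots> < e" using lr disj small by (intro d0(2)) (auto simp: d_def)
  finally have 2: "sum g q \<le> e" by simp
  have 3: "sum h q \<ge> 0" "sum h q < e / (\<bar>c\<bar> + e + 1)"
    unfolding shq using lr small by (auto intro!: sum_nonneg simp: d_def)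
  have "- (c + e) * sum h q \<le> (\<bar>c\<bar> + e + 1) * sum h q" using 3(1) \<open>e > 0\<close> by (intro mult_right_mono) auto
  also have "\<dots> \<le> e" using 3(2) \<open>e > 0\<close> by (simp add: field_simps)
  finally have 4: "- (c + e) * sum h q \<le> e" .
  have "f b - f a = sum g (p - q) + sum g q"
    unfolding sg[symmetric] using sum.subset_diff[OF \<open>q \<subseteq> p\<close> pd(1), of g] by simp
  also have "\<dots> \<le> (c + e) * sum h (p - q) + e" using 1 2 by simp
  also have "sum h (p - q) = (b - a) - sum h q"
    unfolding sh[symmetric] using sum.subset_diff[OF \<open>q \<subseteq> p\<close> pd(1), of h] by simp
  finally have "f b - f a \<le> c * (b - a) + e * (b - a + 2)" using 4 by (simp add: algebra_simps)
  then show "f b - f a \<le> c * (b - a) + e0" using \<open>a \<le> b\<close> by (simp add: e_def)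
qed

text \<open>On a compact interval \<open>W\<close> is bounded, so its squared norm inherits absolute
  continuity, and its derivative is twice the inner product of \<open>D\<close> and
  \<open>W\<close>. Absolute continuity is asked only away from \<open>s\<close>, because a flow has
  it only in positive time; continuity at \<open>s\<close> closes the gap.\<close>

lemma norm_sq_growth:
  fixes W :: "real \<Rightarrow> 'a::real_inner"
  assumes "s \<le> t" and cont: "continuous_on {s..t} W"
    and ac: "\<And>a. \<lbrakk>s < a; a \<le> t\<rbrakk> \<Longrightarrow> ac_on a t W" and N: "negligible N"
    and D: "\<And>r. \<lbrakk>s < r; r < t; r \<notin> N\<rbrakk> \<Longrightarrow> (W has_vector_derivative D r) (at r) \<and> D r \<bullet> W r \<le> m"
  shows "(norm (W t))\<^sup>2 \<le> (norm (W s))\<^sup>2 + 2 * m * (t - s)"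
proof (cases "s = t")
  case False
  then have "s < t" using \<open>s \<le> t\<close> by simp
  have "bounded (W ` {s..t})" using compact_continuous_image[OF cont] compact_imp_bounded by blast
  then obtain B where B: "\<And>r. r \<in> {s..t} \<Longrightarrow> norm (W r) \<le> B" unfolding bounded_iff by blast
  have *: "(norm (W t))\<^sup>2 - (norm (W a))\<^sup>2 \<le> (2 * m) * (t - a)" if a: "s < a" "a \<le> t" for a
  proof (rule ac_on_derivative_le[OF a(2) _ N])
    show "ac_on a t (\<lambda>r. (norm (W r))\<^sup>2)"
    proof (rule ac_on_dominated[OF ac[OF a] ac[OF a], where C = B])
      fix r r' assume r: "a \<le> r" "r \<le> r'" "r' \<le> t"
      have "norm ((norm (W r'))\<^sup>2 - (norm (W r))\<^sup>2) = \<bar>norm (W r') - norm (W r)\<bar> * (norm (W r') + norm (W r))"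
        by (simp add: power2_eq_square square_diff_square_factored abs_mult mult.commute)
      also have "\<dots> \<le> norm (W r' - W r) * (B + B)"
        using B[of r] B[of r'] r a by (intro mult_mono norm_triangle_ineq3 add_mono) auto
      finally show "norm ((norm (W r'))\<^sup>2 - (norm (W r))\<^sup>2) \<le> B * (norm (W r' - W r) + norm (W r' - W r))"
        by (simp add: algebra_simps)
    qed
    fix r assume r: "r \<in> {a<..<t} - N"
    then have d: "(W has_vector_derivative D r) (at r)" "D r \<bullet> W r \<le> m" using D[of r] a by auto
    have "((\<lambda>r. W r \<bullet> W r) has_derivative (\<lambda>h. W r \<bullet> (h *\<^sub>R D r) + (h *\<^sub>R D r) \<bullet> W r)) (at r)"
      using d(1) unfolding has_vector_derivative_def by (intro has_derivative_inner)
    then have "((\<lambda>r. (norm (W r))\<^sup>2) has_real_derivative 2 * (D r \<bullet> W r)) (at r)"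
      unfolding has_field_derivative_def
      by (simp add: power2_norm_eq_inner inner_commute algebra_simps mult_commute_abs)
    then show "\<exists>f'\<le>2 * m. ((\<lambda>r. (norm (W r))\<^sup>2) has_real_derivative f') (at r)" using d(2)
      by (intro exI[of _ "2 * (D r \<bullet> W r)"]) simp
  qed
  have "(W \<longlongrightarrow> W s) (at_right s)" by (rule continuous_on_Icc_at_rightD[OF cont \<open>s < t\<close>])
  then have "((\<lambda>a. (norm (W t))\<^sup>2 - (norm (W a))\<^sup>2 - 2 * m * (t - a)) \<longlongrightarrow>
      (norm (W t))\<^sup>2 - (norm (W s))\<^sup>2 - 2 * m * (t - s)) (at_right s)"
    by (intro tendsto_intros)
  moreover have "\<forall>\<^sub>F a in at_right s. (norm (W t))\<^sup>2 - (norm (W a))\<^sup>2 - 2 * m * (t - a) \<le> 0"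
    using eventually_at_right_real[OF \<open>s < t\<close>] by eventually_elim (use * in auto)
  ultimately have "(norm (W t))\<^sup>2 - (norm (W s))\<^sup>2 - 2 * m * (t - s) \<le> 0"
    by (intro tendsto_upperbound) auto
  then show ?thesis by simp
qed simp

lemma has_vector_derivative_iff_quotient:
  "(f has_vector_derivative D) (at t) \<longleftrightarrow> ((\<lambda>h. (f (t + h) - f t) /\<^sub>R h) \<longlongrightarrow> D) (at 0)"
proof -
  have "(f has_vector_derivative D) (at t) \<longleftrightarrow>
      ((\<lambda>h. norm (f (t + h) - f t - h *\<^sub>R D) / norm h) \<longlongrightarrow> 0) (at 0)"
    by (simp add: has_vector_derivative_def has_derivative_at bounded_linear_scaleR_left)
  also have "\<dots> \<longleftrightarrow> ((\<lambda>h. norm ((f (t + h) - f t) /\<^sub>R h - D)) \<longlongrightarrow> 0) (at 0)"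
  proof (rule filterlim_cong[OF refl refl])
    have "norm (f (t + h) - f t - h *\<^sub>R D) / norm h = norm ((f (t + h) - f t) /\<^sub>R h - D)" if "h \<noteq> 0" for h
    proof -
      have "(f (t + h) - f t) /\<^sub>R h - D = (f (t + h) - f t - h *\<^sub>R D) /\<^sub>R h"
        using that by (simp add: scaleR_diff_right)
      then show ?thesis by (simp add: divide_inverse_commute)
    qed
    then show "\<forall>\<^sub>F h in at 0. norm (f (t + h) - f t - h *\<^sub>R D) / norm h = norm ((f (t + h) - f t) /\<^sub>R h - D)"
      by (simp add: eventually_at_filter)
  qed
  also have "\<dots> \<longleftrightarrow> ((\<lambda>h. (f (t + h) - f t) /\<^sub>R h) \<longlongrightarrow> D) (at 0)"
    by (simp add: tendsto_norm_zero_iff Lim_null[symmetric])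
  finally show ?thesis .
qed

section \<open>Gradient flows in inner product spaces\<close>

text \<open>
  \<open>G\<close> consists of the pairs (point, energy) on the effective domain of the functional; it is not required
  to be single-valued. \<open>D\<close> is the derivative of the flow \<open>w\<close>, and \<open>\<psi>\<close> its energy, off the null set \<open>N\<close>.
\<close>

locale grad_flow =
  fixes G :: "('a::real_inner \<times> real) set" and w D :: "real \<Rightarrow> 'a" and \<psi> :: "real \<Rightarrow> real" and N :: "real set"
  assumes cont: "continuous_on {0..} w"
    and ac: "\<lbrakk>0 < a; a \<le> b\<rbrakk> \<Longrightarrow> ac_on a b w"
    and null: "negligible N"
    and deriv: "\<lbrakk>0 < t; t \<notin> N\<rbrakk> \<Longrightarrow> (w has_vector_derivative D t) (at t)"
    and mem: "\<lbrakk>0 < t; t \<notin> N\<rbrakk> \<Longrightarrow> (w t, \<psi> t) \<in> G"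
    and sub: "\<lbrakk>0 < t; t \<notin> N; (y, b) \<in> G\<rbrakk> \<Longrightarrow> D t \<bullet> (w t - y) \<le> b - \<psi> t"
    and nonneg: "(y, b) \<in> G \<Longrightarrow> 0 \<le> b"
    and zero: "(0, 0) \<in> G"
begin

lemma good_between: "s < t \<Longrightarrow> \<exists>r. s < r \<and> r < t \<and> r \<notin> N"
proof -
  assume "s < t"
  then have "\<not> negligible {s<..<t}"
    using open_not_negligible[of "{s<..<t}"] by auto
  then show ?thesis using negligible_subset[OF null, of "{s<..<t}"] by (auto simp: subset_iff)
qed

text \<open>The integrated evolution variational inequality, obtained by pairing the flow with
  \<open>w - y\<close>. A pointwise bound \<open>m\<close> on good times takes the place of an
  integral of \<open>\<psi>\<close>, whose measurability is not assumed.\<close>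

lemma evi:
  assumes "0 \<le> s" "s \<le> t" "(y, b) \<in> G"
    and m: "\<And>r. \<lbrakk>s < r; r < t; r \<notin> N\<rbrakk> \<Longrightarrow> b - \<psi> r \<le> m"
  shows "(norm (w t - y))\<^sup>2 \<le> (norm (w s - y))\<^sup>2 + 2 * m * (t - s)"
proof (rule norm_sq_growth[OF \<open>s \<le> t\<close> _ _ null, where W = "\<lambda>t. w t - y" and D = D])
  show "continuous_on {s..t} (\<lambda>t. w t - y)"
    using assms by (intro continuous_intros continuous_on_subset[OF cont]) auto
next
  fix a assume "s < a" "a \<le> t"
  then show "ac_on a t (\<lambda>t. w t - y)" using assms by (intro ac_on_diff ac ac_on_const) auto
next
  fix r assume r: "s < r" "r < t" "r \<notin> N"
  have "((\<lambda>t. w t - y) has_vector_derivative D r - 0) (at r)"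
    using deriv[of r] r assms by (intro has_vector_derivative_diff has_vector_derivative_const) auto
  moreover have "D r \<bullet> (w r - y) \<le> m"
    by (rule order_trans[OF sub[OF _ r(3) assms(3)] m[OF r]]) (use r assms in auto)
  ultimately show "((\<lambda>t. w t - y) has_vector_derivative D r) (at r) \<and> D r \<bullet> (w r - y) \<le> m" by simp
qed

text \<open>For \<open>b = 0\<close> the distance to an equilibrium does not increase; for
  \<open>b > 0\<close> this bounds how far the flow can move away from \<open>y\<close> in a short
  time.\<close>

lemma evi_le:
  assumes "0 \<le> s" "s \<le> t" "(y, b) \<in> G"
  shows "(norm (w t - y))\<^sup>2 \<le> (norm (w s - y))\<^sup>2 + 2 * b * (t - s)"
proof (rule evi[OF assms])
  fix r assume "s < r" "r < t" "r \<notin> N"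
  then show "b - \<psi> r \<le> b" using nonneg[OF mem[of r]] assms by simp
qed

text \<open>Monotonicity of the subdifferential: in the inequalities at \<open>r\<close> and
  \<open>r + h\<close>, each tested with the other state, the energies cancel. Both times have to be
  good, hence the union with a translate of \<open>N\<close>.\<close>

lemma shift_contraction:
  assumes "0 \<le> h" "0 < s" "s \<le> t"
  shows "norm (w (t + h) - w t) \<le> norm (w (s + h) - w s)"
proof -
  define N' where "N' = N \<union> (\<lambda>x. -h + x) ` N"
  have "negligible N'" using null negligible_translation[OF null, of "-h"] by (auto simp: N'_def)
  then have "(norm (w (t + h) - w t))\<^sup>2 \<le> (norm (w (s + h) - w s))\<^sup>2 + 2 * 0 * (t - s)"
  proof (rule norm_sq_growth[OF \<open>s \<le> t\<close>, where W = "\<lambda>r. w (r + h) - w r" and D = "\<lambda>r. D (r + h) - D r", rotated 2])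
    show "continuous_on {s..t} (\<lambda>r. w (r + h) - w r)"
      using assms by (intro continuous_intros continuous_on_compose2[OF cont] continuous_on_subset[OF cont]) auto
  next
    fix a assume "s < a" "a \<le> t"
    then show "ac_on a t (\<lambda>r. w (r + h) - w r)"
      using assms by (intro ac_on_diff ac_on_shift ac) auto
  next
    fix r assume r: "s < r" "r < t" "r \<notin> N'"
    have 1: "0 < r" "r \<notin> N" using r assms by (auto simp: N'_def)
    have 2: "0 < r + h" "r + h \<notin> N" using r assms by (force simp: N'_def image_iff)+
    note d = deriv[OF 2] deriv[OF 1]
    note sub[OF 1 mem[OF 2]] sub[OF 2 mem[OF 1]]
    then have "(D (r + h) - D r) \<bullet> (w (r + h) - w r) \<le> 0" by (simp add: inner_diff algebra_simps)
    moreover have "((\<lambda>r. w (r + h) - w r) has_vector_derivative D (r + h) - D r) (at r)"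
      using d(1) by (intro has_vector_derivative_diff d(2)) (simp add: has_vector_derivative_iff_quotient add_ac)
    ultimately show "((\<lambda>r. w (r + h) - w r) has_vector_derivative D (r + h) - D r) (at r) \<and>
       (D (r + h) - D r) \<bullet> (w (r + h) - w r) \<le> 0" by blast
  qed
  then show ?thesis using power2_le_imp_le by force
qed

lemma deriv_quotient:
  assumes "0 < t" "t \<notin> N"
  shows "((\<lambda>h. norm (w (t + h) - w t) / h) \<longlongrightarrow> norm (D t)) (at_right 0)"
proof -
  have "((\<lambda>h. (w (t + h) - w t) /\<^sub>R h) \<longlongrightarrow> D t) (at 0)"
    using deriv[OF assms] by (simp add: has_vector_derivative_iff_quotient)
  then have "((\<lambda>h. (w (t + h) - w t) /\<^sub>R h) \<longlongrightarrow> D t) (at_right 0)"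
    by (rule filterlim_mono) (auto simp: at_le)
  then have "((\<lambda>h. norm ((w (t + h) - w t) /\<^sub>R h)) \<longlongrightarrow> norm (D t)) (at_right 0)" by (rule tendsto_norm)
  moreover have "\<forall>\<^sub>F h in at_right 0. norm ((w (t + h) - w t) /\<^sub>R h) = norm (w (t + h) - w t) / h"
    using eventually_at_right_less[of "0::real"] by eventually_elim (simp add: divide_inverse_commute)
  ultimately show ?thesis by (rule Lim_transform_eventually)
qed

text \<open>The contraction of translates, divided by the step \<open>h\<close> and passed to the
  limit.\<close>

lemma speed_antimono:
  assumes "0 < s" "s \<le> t" "s \<notin> N" "t \<notin> N"
  shows "norm (D t) \<le> norm (D s)"
proof (rule tendsto_le[OF _ deriv_quotient deriv_quotient])
  show "\<forall>\<^sub>F h in at_right 0. norm (w (t + h) - w t) / h \<le> norm (w (s + h) - w s) / h"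
    using eventually_at_right_less[of "0::real"]
    by eventually_elim (use shift_contraction assms in \<open>auto intro!: divide_right_mono\<close>)
qed (use assms in auto)

text \<open>A single good time makes the flow Lipschitz ever after: the contraction carries an
  increment at \<open>t\<close> back to \<open>s\<close>, where the difference quotient is close to
  \<open>norm (D s)\<close>. So \<open>d\<close> does not depend on \<open>t\<close>.\<close>

lemma step_upper:
  assumes "0 < s" "s \<notin> N"
  shows "\<exists>d>0. \<forall>t\<ge>s. \<forall>h. 0 \<le> h \<and> h < d \<longrightarrow> norm (w (t + h) - w t) \<le> (norm (D s) + 1) * h"
proof -
  have "\<forall>\<^sub>F h in at_right 0. norm (w (s + h) - w s) / h < norm (D s) + 1"
    by (rule order_tendstoD[OF deriv_quotient[OF assms]]) simp
  then obtain d where d: "d > 0" "\<And>h. 0 < h \<Longrightarrow> h < d \<Longrightarrow> norm (w (s + h) - w s) / h < norm (D s) + 1"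
    unfolding eventually_at_right_field by auto
  have "norm (w (t + h) - w t) \<le> (norm (D s) + 1) * h" if "s \<le> t" "0 \<le> h" "h < d" for t h
  proof (cases "h = 0")
    case False
    have "norm (w (t + h) - w t) \<le> norm (w (s + h) - w s)" using shift_contraction[of h s t] that assms by auto
    also have "\<dots> \<le> (norm (D s) + 1) * h" using d(2)[of h] that False by (simp add: divide_simps split: if_splits)
    finally show ?thesis .
  qed simp
  then show ?thesis using d(1) by blast
qed

text \<open>The subdifferential inequality at \<open>t\<close>, tested with the state at
  \<open>r\<close>, bounds the energy difference by speed times distance. The statement is symmetric
  in \<open>t\<close> and \<open>r\<close>, hence a local Lipschitz bound among good times.\<close>

lemma energy_lipschitz:
  assumes "0 < s" "s \<notin> N"
  shows "\<exists>d>0. \<exists>K\<ge>0. \<forall>t r. s \<le> t \<and> s \<le> r \<and> t \<notin> N \<and> r \<notin> N \<and> \<bar>t - r\<bar> < d \<longrightarrow> \<psi> t - \<psi> r \<le> K * \<bar>t - r\<bar>"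
proof -
  obtain d where d: "d > 0" "\<And>t h. s \<le> t \<Longrightarrow> 0 \<le> h \<Longrightarrow> h < d \<Longrightarrow> norm (w (t + h) - w t) \<le> (norm (D s) + 1) * h"
    using step_upper[OF assms] by blast
  have "\<psi> t - \<psi> r \<le> norm (D s) * (norm (D s) + 1) * \<bar>t - r\<bar>"
    if tr: "s \<le> t" "s \<le> r" "t \<notin> N" "r \<notin> N" "\<bar>t - r\<bar> < d" for t r
  proof -
    have le: "norm (w r - w t) \<le> (norm (D s) + 1) * \<bar>t - r\<bar>"
    proof (cases "t \<le> r")
      case True
      then show ?thesis using d(2)[of t "r - t"] tr by simp
    next
      case False
      then show ?thesis using d(2)[of r "t - r"] tr by (simp add: norm_minus_commute)
    qed
    have "\<psi> t - \<psi> r \<le> D t \<bullet> (w r - w t)"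
      using sub[OF _ tr(3) mem[OF _ tr(4)]] tr assms by (simp add: inner_diff)
    also have "\<dots> \<le> norm (D t) * norm (w r - w t)" by (rule norm_cauchy_schwarz)
    also have "\<dots> \<le> norm (D s) * ((norm (D s) + 1) * \<bar>t - r\<bar>)"
      using speed_antimono[of s t] tr assms le by (intro mult_mono) auto
    finally show ?thesis by (simp add: algebra_simps)
  qed
  then show ?thesis using d(1)
    by (intro exI[of _ d] conjI exI[of _ "norm (D s) * (norm (D s) + 1)"]) auto
qed

text \<open>
  If the energy were larger at \<open>t\<close> than at \<open>s < t\<close>, start the evolution variational inequality at
  the last time at which the energy is at most the mean of the two values: it would give a negative
  squared distance at time \<open>t\<close>.
\<close>

lemma energy_antimono:
  assumes "0 < s" "s \<le> t" "s \<notin> N" "t \<notin> N"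
  shows "\<psi> t \<le> \<psi> s"
proof (rule ccontr)
  assume neg: "\<not> \<psi> t \<le> \<psi> s"
  obtain d K where d: "d > 0" and "K \<ge> 0" and lip: "\<And>t r. s \<le> t \<Longrightarrow> s \<le> r \<Longrightarrow> t \<notin> N \<Longrightarrow> r \<notin> N \<Longrightarrow> \<bar>t - r\<bar> < d \<Longrightarrow>
      \<psi> t - \<psi> r \<le> K * \<bar>t - r\<bar>"
    using energy_lipschitz[OF assms(1,3)] by (smt (verit, ccfv_SIG))
  \<comment> \<open>The gap is cut into quarters: \<open>c\<close> is the mean of the two energies
    and \<open>\<psi> t\<close> lies \<open>2 * q\<close> above it.\<close>
  define q where "q = (\<psi> t - \<psi> s) / 4"
  define c where "c = \<psi> s + 2 * q"
  have "q > 0" using neg by (simp add: q_def)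
  have ct: "\<psi> t = c + 2 * q" by (simp add: c_def q_def field_simps)
  \<comment> \<open>By the Lipschitz bound the energy is still at least \<open>c + q\<close> during
    the last time span of length \<open>l\<close>.\<close>
  define l where "l = min (d / 2) (q / (K + 1))"
  have l: "l > 0" "l < d" "K * l \<le> q"
    using d \<open>q > 0\<close> \<open>K \<ge> 0\<close> mult_right_mono[of K "K + 1" l] by (auto simp: l_def min_def field_simps)
  have near: "\<psi> r \<ge> c + q" if "s \<le> r" "t - l \<le> r" "r \<le> t" "r \<notin> N" for r
  proof -
    have "K * \<bar>t - r\<bar> \<le> K * l" using that \<open>K \<ge> 0\<close> by (intro mult_left_mono) auto
    then show ?thesis using lip[of t r] that assms l ct by auto
  qed
  define S where "S = {r. s \<le> r \<and> r \<le> t \<and> r \<notin> N \<and> \<psi> r \<le> c}"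
  have "s \<in> S" using assms \<open>q > 0\<close> by (auto simp: S_def c_def)
  have bdd: "bdd_above S" by (rule bdd_aboveI[of _ t]) (auto simp: S_def)
  define z where "z = Sup S"
  have "s \<le> z" unfolding z_def using \<open>s \<in> S\<close> bdd by (rule cSup_upper)
  have St: "r \<le> t - l" if "r \<in> S" for r
    using near[of r] that \<open>q > 0\<close> by (fastforce simp: S_def)
  then have "z \<le> t - l" unfolding z_def using \<open>s \<in> S\<close> by (intro cSup_least) auto
  define k where "k = min (l / 2) (q / (K + 1) / 2)"
  have "k > 0" using l \<open>q > 0\<close> \<open>K \<ge> 0\<close> by (auto simp: k_def)
  have "K * k < q"
  proof -
    have "K * k \<le> (K + 1) * (q / (K + 1) / 2)" using \<open>K \<ge> 0\<close> \<open>k > 0\<close> by (intro mult_mono) (auto simp: k_def)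
    also have "\<dots> = q / 2" using \<open>K \<ge> 0\<close> by (simp add: add_eq_0_iff_both_eq_0 del: distrib_right_numeral)
    also have "\<dots> < q" using \<open>q > 0\<close> by simp
    finally show ?thesis .
  qed
  have "k \<le> l / 2" unfolding k_def by (rule min.cobounded1)
  then have "k < l" "k < d" using l by auto
  \<comment> \<open>The supremum \<open>z\<close> may itself be an exceptional time, so the
    inequality starts from a good time of \<open>S\<close> less than \<open>k\<close> before
    it.\<close>
  obtain a where a: "a \<in> S" "z - k < a"
    using less_cSupE[of "z - k" S] \<open>s \<in> S\<close> \<open>k > 0\<close> unfolding z_def by force
  have "a \<le> z" unfolding z_def using a(1) bdd by (rule cSup_upper)
  have aN: "0 < a" "a \<notin> N" "s \<le> a" "\<psi> a \<le> c" using a(1) assms by (auto simp: S_def)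
  note G = mem[OF aN(1,2)]
  \<comment> \<open>Three stretches: up to \<open>z\<close> the energy falls below
    \<open>\<psi> a\<close> by at most \<open>K * k\<close>, up to \<open>t - l\<close> it stays
    above \<open>\<psi> a\<close>, and on the last stretch it exceeds it by \<open>q\<close>. The
    gain \<open>2 * q * l\<close> outweighs the loss because \<open>K * k < q\<close> and
    \<open>z - a < k < l\<close>.\<close>
  have "(norm (w z - w a))\<^sup>2 \<le> (norm (w a - w a))\<^sup>2 + 2 * (K * k) * (z - a)"
  proof (rule evi[OF _ \<open>a \<le> z\<close> G])
    fix r assume r: "a < r" "r < z" "r \<notin> N"
    then have "\<psi> a - \<psi> r \<le> K * \<bar>a - r\<bar>" using aN a(2) \<open>k < d\<close> by (intro lip) auto
    also have "\<dots> \<le> K * k" using r a(2) \<open>K \<ge> 0\<close> by (intro mult_left_mono) auto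
    finally show "\<psi> a - \<psi> r \<le> K * k" .
  qed (use aN in auto)
  moreover have "(norm (w (t - l) - w a))\<^sup>2 \<le> (norm (w z - w a))\<^sup>2 + 2 * 0 * (t - l - z)"
  proof (rule evi[OF _ \<open>z \<le> t - l\<close> G])
    fix r assume r: "z < r" "r < t - l" "r \<notin> N"
    have "r \<notin> S" using r(1) cSup_upper[OF _ bdd, of r] by (auto simp: z_def)
    then show "\<psi> a - \<psi> r \<le> 0" using r \<open>s \<le> z\<close> l aN by (auto simp: S_def)
  qed (use aN \<open>a \<le> z\<close> in auto)
  moreover have "(norm (w t - w a))\<^sup>2 \<le> (norm (w (t - l) - w a))\<^sup>2 + 2 * (- q) * (t - (t - l))"
  proof (rule evi[OF _ _ G])
    fix r assume r: "t - l < r" "r < t" "r \<notin> N"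
    then show "\<psi> a - \<psi> r \<le> - q" using near[of r] aN \<open>s \<le> z\<close> \<open>z \<le> t - l\<close> by auto
  qed (use aN \<open>a \<le> z\<close> \<open>z \<le> t - l\<close> l in auto)
  ultimately have "(norm (w t - w a))\<^sup>2 \<le> 0\<^sup>2 + 2 * (K * k) * (z - a) + 2 * 0 * (t - l - z) + 2 * (- q) * (t - (t - l))"
    unfolding diff_self norm_zero by linarith
  then have "(norm (w t - w a))\<^sup>2 \<le> 2 * (K * k) * (z - a) - 2 * q * l"
    by simp
  moreover have "K * k * (z - a) \<le> q * (z - a)" using \<open>K * k < q\<close> \<open>a \<le> z\<close> by (intro mult_right_mono) auto
  moreover have "q * (z - a) < q * l" using a(2) \<open>k < l\<close> \<open>q > 0\<close> by (intro mult_strict_left_mono) auto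
  moreover have "0 \<le> (norm (w t - w a))\<^sup>2" by simp
  ultimately show False by (simp only: mult.assoc)
qed

text \<open>Tested with the minimiser \<open>0\<close>; since the energy decreases, its final value
  bounds it from below on the whole interval.\<close>

lemma energy_bound:
  assumes "0 < t" "t \<notin> N"
  shows "2 * t * \<psi> t \<le> (norm (w 0))\<^sup>2"
proof -
  have "(norm (w t - 0))\<^sup>2 \<le> (norm (w 0 - 0))\<^sup>2 + 2 * (- \<psi> t) * (t - 0)"
  proof (rule evi[OF _ _ zero])
    fix r assume "0 < r" "r < t" "r \<notin> N"
    then show "0 - \<psi> r \<le> - \<psi> t" using energy_antimono[of r t] assms by simp
  qed (use assms in auto)
  moreover have "0 \<le> (norm (w t - 0))\<^sup>2" by simp
  ultimately have "0 \<le> (norm (w 0))\<^sup>2 + 2 * (- \<psi> t) * t" unfolding diff_zero by (rule order_trans[rotated])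
  then show ?thesis by (simp add: algebra_simps)
qed

text \<open>Stands in for the energy identity, at the price of a factor 2. Started at the earlier of
  two close times, \<open>evi\<close> bounds the squared distance by twice the energy drop times the
  elapsed time; inserting the lower bound \<open>L * h\<close> for the distance and dividing by time
  gives the claim for short steps, which are then added up.\<close>

lemma energy_drop:
  assumes "0 < a" "a \<notin> N" "t \<notin> N" "a \<le> t"
    and L: "\<And>r h. \<lbrakk>a \<le> r; 0 < h; h < d; r + h \<le> t\<rbrakk> \<Longrightarrow> L * h \<le> norm (w (r + h) - w r)"
    and "L \<ge> 0" "d > 0"
  shows "L\<^sup>2 * (t - a) \<le> 2 * (\<psi> a - \<psi> t)"
proof -
  have small: "L\<^sup>2 * (r' - r) \<le> 2 * (\<psi> r - \<psi> r')"
    if r: "a \<le> r" "r < r'" "r' \<le> t" "r' - r < d" "r \<notin> N" "r' \<notin> N" for r r'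
  proof -
    have "(norm (w r' - w r))\<^sup>2 \<le> (norm (w r - w r))\<^sup>2 + 2 * (\<psi> r - \<psi> r') * (r' - r)"
    proof (rule evi[OF _ _ mem])
      fix x assume "r < x" "x < r'" "x \<notin> N"
      then show "\<psi> r - \<psi> x \<le> \<psi> r - \<psi> r'" using energy_antimono[of x r'] r assms by simp
    qed (use r assms in auto)
    moreover have "(L * (r' - r))\<^sup>2 \<le> (norm (w r' - w r))\<^sup>2"
      using L[of r "r' - r"] r \<open>L \<ge> 0\<close> by (intro power_mono) auto
    ultimately have "L\<^sup>2 * (r' - r) * (r' - r) \<le> 2 * (\<psi> r - \<psi> r') * (r' - r)"
      by (simp add: power2_eq_square algebra_simps)
    then show ?thesis using r(2) by (simp add: mult_le_cancel_right)
  qed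
  have "L\<^sup>2 * (r' - a) \<le> 2 * (\<psi> a - \<psi> r')" if "a \<le> r'" "r' \<le> t" "r' - a < Suc n * (d / 2)" "r' \<notin> N" for r' n
    using that
  proof (induction n arbitrary: r')
    case 0
    then show ?case using small[of a r'] assms by (cases "a = r'") auto
  next
    case (Suc n)
    show ?case
    proof (cases "r' - a < d")
      case True
      then show ?thesis using small[of a r'] assms Suc.prems by (cases "a = r'") auto
    next
      case False
      \<comment> \<open>The intermediate good time leaves a last step shorter than \<open>d\<close>,
        so \<open>small\<close> applies, and longer than \<open>d / 2\<close>, so the induction
        advances.\<close>
      then have "max a (r' - d) < r' - d / 2" using \<open>d > 0\<close> by (auto simp: max_def)
      then obtain r where r: "max a (r' - d) < r" "r < r' - d / 2" "r \<notin> N" using good_between by blast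
      have "L\<^sup>2 * (r - a) \<le> 2 * (\<psi> a - \<psi> r)"
        using r Suc.prems \<open>d > 0\<close> by (intro Suc.IH) (auto simp: algebra_simps)
      moreover have "L\<^sup>2 * (r' - r) \<le> 2 * (\<psi> r - \<psi> r')"
        using r Suc.prems \<open>d > 0\<close> by (intro small) auto
      ultimately show ?thesis by (simp add: algebra_simps)
    qed
  qed
  moreover obtain n where "t - a < real n * (d / 2)"
    using reals_Archimedean3[of "d / 2"] \<open>d > 0\<close> half_gt_zero by blast
  then have "t - a < Suc n * (d / 2)" using \<open>d > 0\<close> by (simp add: algebra_simps)
  ultimately show ?thesis using assms by blast
qed

text \<open>Were the speed at \<open>t\<close> larger, the contraction of translates would make all
  earlier increments at least as long, and \<open>energy_drop\<close> would consume more energy than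
  is available at \<open>a\<close>.\<close>

lemma speed_bound:
  assumes "0 < a" "a \<notin> N" "t \<notin> N" "a < t"
  shows "(norm (D t))\<^sup>2 * (t - a) \<le> 2 * \<psi> a"
proof (rule ccontr)
  assume neg: "\<not> ?thesis"
  define q where "q = sqrt (2 * \<psi> a / (t - a))"
  have nn: "0 \<le> \<psi> a" "0 \<le> \<psi> t" using nonneg[OF mem[of a]] nonneg[OF mem[of t]] assms by auto
  then have "q \<ge> 0" and q2: "q\<^sup>2 * (t - a) = 2 * \<psi> a" using assms by (simp_all add: q_def)
  have "q < norm (D t)"
  proof (rule power2_less_imp_less)
    have "q\<^sup>2 * (t - a) < (norm (D t))\<^sup>2 * (t - a)" using neg q2 by simp
    then show "q\<^sup>2 < (norm (D t))\<^sup>2" using assms by (simp add: mult_less_cancel_right)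
  qed simp
  then obtain L where L: "q < L" "L < norm (D t)" using dense by blast
  have "\<forall>\<^sub>F h in at_right 0. L < norm (w (t + h) - w t) / h"
    by (rule order_tendstoD(1)[OF deriv_quotient]) (use assms L in auto)
  then obtain d where d: "d > 0" "\<And>h. 0 < h \<Longrightarrow> h < d \<Longrightarrow> L < norm (w (t + h) - w t) / h"
    unfolding eventually_at_right_field by auto
  have "L\<^sup>2 * (t - a) \<le> 2 * (\<psi> a - \<psi> t)"
  proof (rule energy_drop[OF assms(1,2,3) _ _ _ d(1)])
    fix r h assume "a \<le> r" "0 < h" "h < d" "r + h \<le> t"
    then have "L * h \<le> norm (w (t + h) - w t)" using d(2)[of h] by (simp add: divide_simps split: if_splits)
    also have "\<dots> \<le> norm (w (r + h) - w r)"
      using \<open>0 < h\<close> \<open>r + h \<le> t\<close> \<open>a \<le> r\<close> assms by (intro shift_contraction) auto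
    finally show "L * h \<le> norm (w (r + h) - w r)" .
  qed (use L \<open>q \<ge> 0\<close> assms in auto)
  moreover have "q\<^sup>2 * (t - a) < L\<^sup>2 * (t - a)"
    using L \<open>q \<ge> 0\<close> assms by (intro mult_strict_right_mono power_strict_mono) auto
  ultimately show False using q2 nn by simp
qed

text \<open>At a good time between \<open>\<tau> / 4\<close> and \<open>\<tau> / 2\<close> the
  energy is at most \<open>2 * (norm (w 0))\<^sup>2 / \<tau>\<close>; feeding this into
  \<open>speed_bound\<close> gives \<open>8\<close> in place of \<open>9\<close> for the square of
  the constant.\<close>

lemma speed_le:
  assumes "0 < \<tau>" "\<tau> \<le> t" "t \<notin> N"
  shows "norm (D t) \<le> 3 * norm (w 0) / \<tau>"
proof (rule power2_le_imp_le)
  obtain a where a: "\<tau> / 4 < a" "a < \<tau> / 2" "a \<notin> N" using good_between[of "\<tau> / 4" "\<tau> / 2"] assms by auto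
  have nn: "0 \<le> \<psi> a" using nonneg[OF mem[of a]] a assms by simp
  have "(norm (D t))\<^sup>2 * (\<tau> / 2) \<le> (norm (D t))\<^sup>2 * (t - a)" using a assms by (intro mult_left_mono) auto
  also have "\<dots> \<le> 2 * \<psi> a" using a assms by (intro speed_bound) auto
  finally have 1: "(norm (D t))\<^sup>2 * \<tau> \<le> 4 * \<psi> a" by simp
  have "\<tau> * \<psi> a \<le> 2 * (2 * a * \<psi> a)" using a nn assms mult_right_mono[of \<tau> "4 * a" "\<psi> a"] by simp
  also have "\<dots> \<le> 2 * (norm (w 0))\<^sup>2" using energy_bound[of a] a assms by simp
  finally have 2: "\<tau> * \<psi> a \<le> 2 * (norm (w 0))\<^sup>2" .
  have "(norm (D t))\<^sup>2 * \<tau> * \<tau> \<le> 4 * \<psi> a * \<tau>" using 1 assms by (intro mult_right_mono) auto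
  also have "\<dots> \<le> 8 * (norm (w 0))\<^sup>2" using 2 by (simp add: algebra_simps)
  finally show "(norm (D t))\<^sup>2 \<le> (3 * norm (w 0) / \<tau>)\<^sup>2"
    using assms by (simp add: power_divide power_mult_distrib divide_simps power2_eq_square algebra_simps)
      (use zero_le_square[of "norm (w 0)"] in linarith)
qed (use assms in auto)

text \<open>The reflected state \<open>- w t\<close> has the same energy as \<open>w t\<close>,
  which is at most every earlier energy, so the distance to it decreases:
  \<open>norm (2 *\<^sub>R w t) \<le> norm (w s + w t)\<close>. The parallelogram law turns this
  into the claim.\<close>

lemma bruck:
  assumes "\<And>y b. (y, b) \<in> G \<Longrightarrow> (- y, b) \<in> G" "0 \<le> s" "s \<le> t" "0 < t" "t \<notin> N"
  shows "(norm (w s - w t))\<^sup>2 \<le> 2 * ((norm (w s))\<^sup>2 - (norm (w t))\<^sup>2)"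
proof -
  have "(norm (w t - - w t))\<^sup>2 \<le> (norm (w s - - w t))\<^sup>2 + 2 * 0 * (t - s)"
  proof (rule evi[OF assms(2,3) assms(1)[OF mem[OF assms(4,5)]]])
    fix r assume "s < r" "r < t" "r \<notin> N"
    then show "\<psi> t - \<psi> r \<le> 0" using energy_antimono[of r t] assms by simp
  qed
  then show ?thesis by (simp add: power2_norm_eq_inner inner_add inner_diff inner_commute algebra_simps)
qed

end

text \<open>The competitor \<open>y\<close> is fixed on all of \<open>[p, q]\<close>: its energy is
  compared with that of \<open>u\<close> at the last time, which is the smallest. One
  \<open>\<delta>\<close> comes from the energy of \<open>y\<close>, one from comparing the energies
  of \<open>x r\<close>, and \<open>M * \<delta>\<close> from speed times distance; the sum is
  rounded up. The error is proportional to elapsed time.\<close>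

lemma comparison_step:
  assumes F1: "grad_flow G\<^sub>1 u D\<^sub>1 \<psi>\<^sub>1 N\<^sub>1" and F2: "grad_flow G\<^sub>2 x D\<^sub>2 \<psi>\<^sub>2 N\<^sub>2"
    and pq: "0 < p" "p \<le> t" "t \<le> q" "q \<notin> N\<^sub>1"
    and y: "(y, b) \<in> G\<^sub>2" "b \<le> \<psi>\<^sub>1 q + \<delta>" "\<And>r. \<lbrakk>p \<le> r; r \<le> q\<rbrakk> \<Longrightarrow> norm (y - u r) \<le> \<delta>"
    and M: "\<And>r. \<lbrakk>p < r; r < q; r \<notin> N\<^sub>2\<rbrakk> \<Longrightarrow> norm (D\<^sub>2 r) \<le> M"
    and c: "\<And>r. \<lbrakk>p < r; r < q; r \<notin> N\<^sub>2\<rbrakk> \<Longrightarrow> \<exists>c\<le>\<psi>\<^sub>2 r + \<delta>. (x r, c) \<in> G\<^sub>1"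
  shows "(norm (x t - u t))\<^sup>2 \<le> (norm (x p - u p))\<^sup>2 + 2 * ((3 + M) * \<delta>) * (t - p)"
proof (rule norm_sq_growth[OF pq(2), where W = "\<lambda>r. x r - u r" and D = "\<lambda>r. D\<^sub>2 r - D\<^sub>1 r" and N = "N\<^sub>1 \<union> N\<^sub>2"])
  interpret F1: grad_flow G\<^sub>1 u D\<^sub>1 \<psi>\<^sub>1 N\<^sub>1 by fact
  interpret F2: grad_flow G\<^sub>2 x D\<^sub>2 \<psi>\<^sub>2 N\<^sub>2 by fact
  show "continuous_on {p..t} (\<lambda>r. x r - u r)"
    using pq by (intro continuous_intros continuous_on_subset[OF F1.cont] continuous_on_subset[OF F2.cont]) auto
  show "negligible (N\<^sub>1 \<union> N\<^sub>2)" using F1.null F2.null by simp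
  show "ac_on a t (\<lambda>r. x r - u r)" if "p < a" "a \<le> t" for a
    using that pq by (intro ac_on_diff F1.ac F2.ac) auto
  fix r assume r: "p < r" "r < t" "r \<notin> N\<^sub>1 \<union> N\<^sub>2"
  then have r': "0 < r" "r \<notin> N\<^sub>1" "r \<notin> N\<^sub>2" "r < q" using pq by auto
  obtain c where c: "c \<le> \<psi>\<^sub>2 r + \<delta>" "(x r, c) \<in> G\<^sub>1" using c[of r] r r' by blast
  have "D\<^sub>2 r \<bullet> (y - u r) \<le> norm (D\<^sub>2 r) * norm (y - u r)" by (rule norm_cauchy_schwarz)
  also have "\<dots> \<le> M * \<delta>" using M[of r] y(3)[of r] r r' by (intro mult_mono) (auto intro: order_trans[OF norm_ge_zero])
  finally have 1: "D\<^sub>2 r \<bullet> (y - u r) \<le> M * \<delta>" .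
  have 2: "D\<^sub>2 r \<bullet> (x r - y) \<le> b - \<psi>\<^sub>2 r" using F2.sub y(1) r' by blast
  have 3: "D\<^sub>1 r \<bullet> (u r - x r) \<le> c - \<psi>\<^sub>1 r" using F1.sub c(2) r' by blast
  have 4: "\<psi>\<^sub>1 q \<le> \<psi>\<^sub>1 r" using F1.energy_antimono r' pq by simp
  have "0 \<le> \<delta>" using y(3)[of r] r r' by (auto intro: order_trans[OF norm_ge_zero])
  then have "(D\<^sub>2 r - D\<^sub>1 r) \<bullet> (x r - u r) \<le> (3 + M) * \<delta>"
    using 1 2 3 4 c(1) y(2) by (simp add: inner_diff algebra_simps)
  then show "((\<lambda>r. x r - u r) has_vector_derivative D\<^sub>2 r - D\<^sub>1 r) (at r) \<and>
      (D\<^sub>2 r - D\<^sub>1 r) \<bullet> (x r - u r) \<le> (3 + M) * \<delta>"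
    using F1.deriv F2.deriv r' by (auto intro: has_vector_derivative_diff)
qed


text \<open>Isolates what has to be known about the functionals. \<open>liminf\<close> is uniform on
  energy sublevels, because it is applied to the moving states \<open>x \<epsilon> r\<close>;
  \<open>limsup\<close> concerns fixed states. The space is not assumed complete: the limit at
  infinity is supplied by \<open>kernel\<close>, together with the fact that it is an equilibrium of
  every flow.\<close>

theorem flow_convergence:
  assumes u: "grad_flow G u D \<psi> N"
    and x: "\<And>\<epsilon>. \<epsilon> \<in> {0<..<1} \<Longrightarrow> grad_flow (G' \<epsilon>) (x \<epsilon>) (D' \<epsilon>) (\<psi>' \<epsilon>) (N' \<epsilon>)"
    and init: "((\<lambda>\<epsilon>. norm (x \<epsilon> 0 - u 0)) \<longlongrightarrow> 0) (at_right (0::real))"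
    and sym: "\<And>y b. (y, b) \<in> G \<Longrightarrow> (- y, b) \<in> G"
    and liminf: "\<And>K \<delta>. 0 < \<delta> \<Longrightarrow> \<forall>\<^sub>F \<epsilon> in at_right 0. \<forall>y b. (y, b) \<in> G' \<epsilon> \<and> b \<le> K \<longrightarrow> (\<exists>c\<le>b + \<delta>. (y, c) \<in> G)"
    and limsup: "\<And>y b \<delta>. \<lbrakk>(y, b) \<in> G; 0 < \<delta>\<rbrakk> \<Longrightarrow>
      \<exists>v. norm (v - y) < \<delta> \<and> (\<forall>\<^sub>F \<epsilon> in at_right 0. \<exists>c\<le>b + \<delta>. (v, c) \<in> G' \<epsilon>)"
    and kernel: "\<And>y b. \<lbrakk>\<And>n::nat. (y n, b n) \<in> G; Cauchy y; b \<longlonglongrightarrow> 0\<rbrakk> \<Longrightarrow>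
      \<exists>z. y \<longlonglongrightarrow> z \<and> (z, 0) \<in> G \<and> (\<forall>\<epsilon>\<in>{0<..<1}. (z, 0) \<in> G' \<epsilon>)"
    and "0 < e"
  shows "\<forall>\<^sub>F \<epsilon> in at_right 0. \<forall>t\<ge>0. norm (x \<epsilon> t - u t) \<le> e"
proof -
  interpret u: grad_flow G u D \<psi> N by fact
  have unit: "\<forall>\<^sub>F \<epsilon> in at_right 0. \<epsilon> \<in> {0<..<1::real}" by (rule eventually_at_right_real) simp

  \<comment> \<open>Strong limit of the limiting flow at infinity\<close>
  have "\<exists>t. \<forall>n::nat. real (n + 1) < t n \<and> t n < real (n + 2) \<and> t n \<notin> N"
    by (rule choice) (use u.good_between in auto)
  then obtain tn :: "nat \<Rightarrow> real" where tn: "\<And>n. real (n + 1) < tn n" "\<And>n. tn n < real (n + 2)" "\<And>n. tn n \<notin> N"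
    by blast
  have tn0: "0 < tn n" for n using tn(1)[of n] by simp
  have tn_mono: "tn m \<le> tn n" if "m \<le> n" for m n
    using that tn(1)[of n] tn(2)[of m] by (cases "m = n") auto
  have shrink: "(norm (u t))\<^sup>2 \<le> (norm (u s))\<^sup>2" if "0 \<le> s" "s \<le> t" for s t
    using u.evi_le[OF that u.zero] by simp
  define X where "X n = (norm (u (tn n)))\<^sup>2" for n
  have "decseq X" unfolding decseq_def X_def using shrink tn_mono tn0 less_imp_le by blast
  then have "convergent X"
    by (rule decseq_convergent[where B = 0]) (auto simp: X_def convergent_def)
  then have "Cauchy X" by (rule convergent_Cauchy)
  \<comment> \<open>The squared norms \<open>X\<close> decrease, hence form a Cauchy sequence, and
    \<open>bruck\<close> bounds squared distances by their differences.\<close>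
  have "Cauchy (\<lambda>n. u (tn n))"
  proof (rule metric_CauchyI)
    fix \<eta> :: real assume "\<eta> > 0"
    then obtain M where M: "\<And>m n. m \<ge> M \<Longrightarrow> n \<ge> M \<Longrightarrow> dist (X m) (X n) < \<eta>\<^sup>2 / 2"
      using metric_CauchyD[OF \<open>Cauchy X\<close>, of "\<eta>\<^sup>2 / 2"] by auto
    have *: "dist (u (tn m)) (u (tn n)) < \<eta>" if "m \<ge> M" "m \<le> n" for m n
    proof (rule power2_less_imp_less)
      have "(norm (u (tn m) - u (tn n)))\<^sup>2 \<le> 2 * (X m - X n)"
        unfolding X_def using tn0 tn tn_mono that by (intro u.bruck sym) (auto intro: less_imp_le)
      also have "2 * (X m - X n) < \<eta>\<^sup>2"
        using le_less_trans[OF abs_ge_self M[OF that(1) order_trans[OF that], unfolded dist_real_def]] by simp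
      finally show "(dist (u (tn m)) (u (tn n)))\<^sup>2 < \<eta>\<^sup>2" by (simp add: dist_norm)
    qed (use \<open>\<eta> > 0\<close> in simp)
    have "dist (u (tn m)) (u (tn n)) < \<eta>" if "m \<ge> M" "n \<ge> M" for m n
      using *[of m n] *[of n m] that by (cases "m \<le> n") (auto simp: dist_commute)
    then show "\<exists>M. \<forall>m\<ge>M. \<forall>n\<ge>M. dist (u (tn m)) (u (tn n)) < \<eta>" by blast
  qed
  moreover have "(\<lambda>n. \<psi> (tn n)) \<longlonglongrightarrow> 0"
  proof (rule tendsto_sandwich[of "\<lambda>_. 0"])
    have "(\<lambda>n. (norm (u 0))\<^sup>2 * inverse (real (Suc n))) \<longlonglongrightarrow> (norm (u 0))\<^sup>2 * 0"
      by (intro tendsto_mult tendsto_const LIMSEQ_inverse_real_of_nat)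
    then show "(\<lambda>n. (norm (u 0))\<^sup>2 * inverse (real (Suc n))) \<longlonglongrightarrow> 0" by simp
    have "\<psi> (tn n) \<le> (norm (u 0))\<^sup>2 * inverse (real (Suc n))" for n
    proof -
      have "real (Suc n) * \<psi> (tn n) \<le> 2 * tn n * \<psi> (tn n)"
        using tn(1)[of n] u.nonneg[OF u.mem[OF tn0 tn(3)]] by (intro mult_right_mono) auto
      also have "\<dots> \<le> (norm (u 0))\<^sup>2" by (rule u.energy_bound[OF tn0 tn(3)])
      finally show ?thesis by (simp add: field_simps)
    qed
    then show "\<forall>\<^sub>F n in sequentially. \<psi> (tn n) \<le> (norm (u 0))\<^sup>2 * inverse (real (Suc n))" by simp
    show "\<forall>\<^sub>F n in sequentially. 0 \<le> \<psi> (tn n)" using u.nonneg[OF u.mem[OF tn0 tn(3)]] by simp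
  qed simp
  ultimately obtain z where z: "(\<lambda>n. u (tn n)) \<longlonglongrightarrow> z" "(z, 0) \<in> G" "\<And>\<epsilon>. \<epsilon> \<in> {0<..<1} \<Longrightarrow> (z, 0) \<in> G' \<epsilon>"
    using kernel[of "\<lambda>n. u (tn n)" "\<lambda>n. \<psi> (tn n)"] u.mem[OF tn0 tn(3)] by blast

  \<comment> \<open>The bounds will be \<open>7 * e1\<close> for small times, \<open>8 * e1\<close>
    for intermediate ones and \<open>10 * e1\<close> for large ones.\<close>
  define e1 where "e1 = e / 16"
  have "e1 > 0" using \<open>0 < e\<close> by (simp add: e1_def)

  \<comment> \<open>Small times\<close>
  have "(u \<longlongrightarrow> u 0) (at_right 0)"
    using u.cont unfolding continuous_on_def by (auto intro: tendsto_within_subset)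
  then have "\<forall>\<^sub>F s in at_right 0. dist (u s) (u 0) < e1" using \<open>e1 > 0\<close> by (rule tendstoD)
  then obtain d0 where d0: "d0 > 0" "\<And>s. 0 < s \<Longrightarrow> s < d0 \<Longrightarrow> dist (u s) (u 0) < e1"
    unfolding eventually_at_right_field by auto
  \<comment> \<open>The initial datum may have infinite energy. The state at a good time
    \<open>s\<close> close to 0 has finite energy, so it has a recovery element \<open>v\<close>,
    the competitor for all small \<epsilon>.\<close>
  obtain s where s: "0 < s" "s < d0" "s \<notin> N" using u.good_between[OF d0(1)] by blast
  note us = u.mem[OF s(1,3)]
  have s0: "norm (u s - u 0) < e1" using d0(2)[OF s(1,2)] by (simp add: dist_norm)
  obtain v where v: "norm (v - u s) < e1" "\<forall>\<^sub>F \<epsilon> in at_right 0. \<exists>c\<le>\<psi> s + e1. (v, c) \<in> G' \<epsilon>"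
    using limsup[OF us \<open>e1 > 0\<close>] by blast
  define B where "B = \<psi> s + e1"
  have B: "B > 0" "\<psi> s \<le> B" using u.nonneg[OF us] \<open>e1 > 0\<close> by (auto simp: B_def)
  \<comment> \<open>Energies below \<open>B\<close> move a squared distance by at most
    \<open>2 * B * \<tau> = e1\<^sup>2\<close> up to time \<open>\<tau>\<close>.\<close>
  define \<tau> where "\<tau> = e1\<^sup>2 / (2 * B)"
  have "\<tau> > 0" using B \<open>e1 > 0\<close> by (simp add: \<tau>_def)
  have Bt: "2 * B * t \<le> e1\<^sup>2" if "t \<le> \<tau>" for t
    using that B by (simp add: \<tau>_def field_simps)
  have init': "\<forall>\<^sub>F \<epsilon> in at_right 0. norm (x \<epsilon> 0 - u 0) < r" if "r > 0" for r
    using order_tendstoD(2)[OF init that] .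
  have short: "\<forall>\<^sub>F \<epsilon> in at_right 0. \<forall>t. 0 \<le> t \<and> t \<le> \<tau> \<longrightarrow> norm (x \<epsilon> t - u t) \<le> 7 * e1"
    using v(2) init'[OF \<open>e1 > 0\<close>] unit
  proof eventually_elim
    case (elim \<epsilon>)
    interpret x: grad_flow "G' \<epsilon>" "x \<epsilon>" "D' \<epsilon>" "\<psi>' \<epsilon>" "N' \<epsilon>" using x elim(3) .
    obtain c where c: "c \<le> B" "(v, c) \<in> G' \<epsilon>" using elim(1) by (auto simp: B_def)
    show ?case
    proof (intro allI impI)
      fix t assume t: "0 \<le> t \<and> t \<le> \<tau>"
      have "(norm (x \<epsilon> t - v))\<^sup>2 \<le> (norm (x \<epsilon> 0 - v))\<^sup>2 + 2 * c * (t - 0)"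
        using t by (intro x.evi_le c) auto
      also have "\<dots> \<le> (3 * e1)\<^sup>2 + e1\<^sup>2"
      proof (rule add_mono)
        have "norm (x \<epsilon> 0 - v) \<le> 3 * e1"
          using elim(2) s0 v(1) norm_triangle_ineq[of "x \<epsilon> 0 - u 0" "u 0 - u s + (u s - v)"]
            norm_triangle_ineq[of "u 0 - u s" "u s - v"]
          by (simp add: norm_minus_commute)
        then show "(norm (x \<epsilon> 0 - v))\<^sup>2 \<le> (3 * e1)\<^sup>2" by (intro power_mono) auto
        have "2 * c * (t - 0) \<le> 2 * B * t" using c t by (simp add: mult_right_mono)
        then show "2 * c * (t - 0) \<le> e1\<^sup>2" using Bt[of t] t by simp
      qed
      also have "\<dots> \<le> (4 * e1)\<^sup>2" by (simp add: power2_eq_square)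
      finally have 1: "norm (x \<epsilon> t - v) \<le> 4 * e1" using \<open>e1 > 0\<close> power2_le_imp_le[of _ "4 * e1"] by simp
      have "(norm (u t - u s))\<^sup>2 \<le> (norm (u 0 - u s))\<^sup>2 + 2 * \<psi> s * (t - 0)"
        using t by (intro u.evi_le us) auto
      also have "\<dots> \<le> e1\<^sup>2 + e1\<^sup>2"
      proof (rule add_mono)
        show "(norm (u 0 - u s))\<^sup>2 \<le> e1\<^sup>2" using s0 by (intro power_mono) (auto simp: norm_minus_commute)
        have "2 * \<psi> s * (t - 0) \<le> 2 * B * t" using B t by (simp add: mult_right_mono)
        then show "2 * \<psi> s * (t - 0) \<le> e1\<^sup>2" using Bt[of t] t by simp
      qed
      also have "\<dots> \<le> (2 * e1)\<^sup>2" by (simp add: power2_eq_square)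
      finally have 2: "norm (u t - u s) \<le> 2 * e1" using \<open>e1 > 0\<close> power2_le_imp_le[of _ "2 * e1"] by simp
      show "norm (x \<epsilon> t - u t) \<le> 7 * e1"
        using 1 2 v(1) norm_triangle_ineq[of "x \<epsilon> t - v" "v - u s + (u s - u t)"]
          norm_triangle_ineq[of "v - u s" "u s - u t"] norm_minus_commute[of "u t" "u s"]
        by simp
    qed
  qed

  \<comment> \<open>Intermediate times\<close>
  obtain n0 where "\<And>n. n \<ge> n0 \<Longrightarrow> dist (u (tn n)) z < e1" using metric_LIMSEQ_D[OF z(1) \<open>e1 > 0\<close>] by blast
  moreover obtain n1 where "\<tau> < real n1" using reals_Archimedean2 by blast
  moreover define n where "n = max n0 n1"
  moreover have "real n1 \<le> real n" by (simp add: n_def)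
  ultimately have n: "dist (u (tn n)) z < e1" "\<tau> < tn n"
    using tn(1)[of n] by auto
  define T where "T = tn n"
  have T: "norm (u T - z) < e1" "\<tau> < T" "T \<notin> N" using n tn(3) by (auto simp: T_def dist_norm)

  \<comment> \<open>All constants are independent of \<epsilon>: \<open>R\<close> bounds the initial
    norms eventually, \<open>M\<close> is the resulting speed bound after time
    \<open>\<tau>\<close>, and \<open>K\<close> the energy bound. The rate \<open>\<kappa>\<close>
    adds up to \<open>e1\<^sup>2\<close> until time \<open>T\<close>, and \<open>\<delta>\<close> is
    chosen so that \<open>comparison_step\<close> has exactly this rate.\<close>
  define R where "R = norm (u 0) + 1"
  define M where "M = 3 * R / \<tau>"
  define K where "K = R\<^sup>2 / (2 * \<tau>)"
  define \<kappa> where "\<kappa> = e1\<^sup>2 / T"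
  define \<delta> where "\<delta> = \<kappa> / (2 * (3 + M))"
  have "R > 0" by (simp add: R_def add_nonneg_pos)
  have "M > 0" using \<open>R > 0\<close> \<open>\<tau> > 0\<close> by (simp add: M_def)
  have "\<kappa> > 0" using \<open>e1 > 0\<close> \<open>\<tau> > 0\<close> T by (simp add: \<kappa>_def)
  have "\<delta> > 0" using \<open>\<kappa> > 0\<close> \<open>M > 0\<close> by (simp add: \<delta>_def)
  have \<delta>\<kappa>: "2 * ((3 + M) * \<delta>) = \<kappa>" using \<open>M > 0\<close> by (simp add: \<delta>_def divide_simps)
  \<comment> \<open>On a piece shorter than \<open>d\<close>, an element within
    \<open>\<delta> / 2\<close> of the last state is within \<open>\<delta>\<close> of all
    states.\<close>
  have "uniformly_continuous_on {\<tau>..T} u"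
    using \<open>\<tau> > 0\<close> by (intro compact_uniformly_continuous continuous_on_subset[OF u.cont]) auto
  then obtain d where d: "d > 0" "\<And>a b. a \<in> {\<tau>..T} \<Longrightarrow> b \<in> {\<tau>..T} \<Longrightarrow> dist b a < d \<Longrightarrow> dist (u b) (u a) < \<delta> / 2"
    unfolding uniformly_continuous_on_def using \<open>\<delta> > 0\<close> half_gt_zero by metis
  have step: "\<forall>\<^sub>F \<epsilon> in at_right 0. \<forall>t\<in>{p..q}. (norm (x \<epsilon> t - u t))\<^sup>2 \<le> (norm (x \<epsilon> p - u p))\<^sup>2 + \<kappa> * (t - p)"
    if pq: "\<tau> \<le> p" "p \<le> q" "q \<le> T" "q - p < d" "q \<notin> N" for p q
  proof -
    have "0 < q" "0 < p" using pq \<open>\<tau> > 0\<close> by auto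
    \<comment> \<open>The element \<open>y\<close> is chosen from the single state
      \<open>u q\<close>, before \<epsilon>; how small \<epsilon> must be therefore depends on the
      piece only.\<close>
    obtain y where y: "norm (y - u q) < \<delta> / 2" "\<forall>\<^sub>F \<epsilon> in at_right 0. \<exists>c\<le>\<psi> q + \<delta> / 2. (y, c) \<in> G' \<epsilon>"
      using limsup[OF u.mem[OF \<open>0 < q\<close> pq(5)], of "\<delta> / 2"] \<open>\<delta> > 0\<close> by auto
    show ?thesis using y(2) liminf[OF \<open>\<delta> > 0\<close>, of K] init'[OF zero_less_one] unit
    proof eventually_elim
      case (elim \<epsilon>)
      interpret x: grad_flow "G' \<epsilon>" "x \<epsilon>" "D' \<epsilon>" "\<psi>' \<epsilon>" "N' \<epsilon>" using x elim(4) .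
      have x0: "norm (x \<epsilon> 0) \<le> R"
        using elim(3) norm_triangle_ineq[of "x \<epsilon> 0 - u 0" "u 0"] by (simp add: R_def)
      obtain c where c: "c \<le> \<psi> q + \<delta> / 2" "(y, c) \<in> G' \<epsilon>" using elim(1) by blast
      show ?case
      proof
        fix t assume t: "t \<in> {p..q}"
        have "(norm (x \<epsilon> t - u t))\<^sup>2 \<le> (norm (x \<epsilon> p - u p))\<^sup>2 + 2 * ((3 + M) * \<delta>) * (t - p)"
        proof (rule comparison_step[OF u x.grad_flow_axioms \<open>0 < p\<close> _ _ pq(5) c(2)])
          show "c \<le> \<psi> q + \<delta>" using c(1) \<open>\<delta> > 0\<close> by simp
          show "norm (y - u r) \<le> \<delta>" if "p \<le> r" "r \<le> q" for r
            using d(2)[of r q] y(1) that pq norm_triangle_ineq[of "y - u q" "u q - u r"]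
            by (auto simp: dist_norm)
          show "norm (D' \<epsilon> r) \<le> M" if "p < r" "r \<notin> N' \<epsilon>" for r
          proof -
            have "norm (D' \<epsilon> r) \<le> 3 * norm (x \<epsilon> 0) / \<tau>"
              using that pq \<open>\<tau> > 0\<close> by (intro x.speed_le) auto
            also have "\<dots> \<le> M" unfolding M_def using x0 \<open>\<tau> > 0\<close> by (intro divide_right_mono) auto
            finally show ?thesis .
          qed
          show "\<exists>c\<le>\<psi>' \<epsilon> r + \<delta>. (x \<epsilon> r, c) \<in> G" if "p < r" "r \<notin> N' \<epsilon>" for r
          proof -
            have r: "0 < r" "r \<notin> N' \<epsilon>" "\<tau> \<le> r" using that pq \<open>\<tau> > 0\<close> by auto
            note G' = x.mem[OF r(1,2)]
            have "2 * \<tau> * \<psi>' \<epsilon> r \<le> 2 * r * \<psi>' \<epsilon> r" using r x.nonneg[OF G'] by (intro mult_right_mono) auto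
            also have "\<dots> \<le> (norm (x \<epsilon> 0))\<^sup>2" by (rule x.energy_bound[OF r(1,2)])
            also have "\<dots> \<le> R\<^sup>2" using x0 by (intro power_mono) auto
            finally have "\<psi>' \<epsilon> r \<le> K" using \<open>\<tau> > 0\<close> by (simp add: K_def field_simps)
            then show ?thesis using elim(2) G' by blast
          qed
        qed (use t in auto)
        then show "(norm (x \<epsilon> t - u t))\<^sup>2 \<le> (norm (x \<epsilon> p - u p))\<^sup>2 + \<kappa> * (t - p)" by (simp only: \<delta>\<kappa>)
      qed
    qed
  qed
  \<comment> \<open>Pieces shorter than \<open>d\<close> but longer than \<open>d / 2\<close> reach
    every good time in finitely many steps, so only finitely many eventual statements are
    intersected.\<close>
  have chain: "\<forall>\<^sub>F \<epsilon> in at_right 0. \<forall>t\<in>{\<tau>..q}. (norm (x \<epsilon> t - u t))\<^sup>2 \<le> (norm (x \<epsilon> \<tau> - u \<tau>))\<^sup>2 + \<kappa> * (t - \<tau>)"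
    if "\<tau> \<le> q" "q \<le> T" "q - \<tau> < Suc k * (d / 2)" "q \<notin> N" for q k
    using that
  proof (induction k arbitrary: q)
    case 0
    then show ?case using step[of \<tau> q] \<open>d > 0\<close> by simp
  next
    case (Suc k)
    show ?case
    proof (cases "q - \<tau> < d")
      case True
      then show ?thesis using step[of \<tau> q] Suc.prems by simp
    next
      case False
      then have "max \<tau> (q - d) < q - d / 2" using \<open>d > 0\<close> by (auto simp: max_def)
      then obtain p where p: "max \<tau> (q - d) < p" "p < q - d / 2" "p \<notin> N" using u.good_between by blast
      have "\<forall>\<^sub>F \<epsilon> in at_right 0. \<forall>t\<in>{\<tau>..p}. (norm (x \<epsilon> t - u t))\<^sup>2 \<le> (norm (x \<epsilon> \<tau> - u \<tau>))\<^sup>2 + \<kappa> * (t - \<tau>)"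
        using p Suc.prems \<open>d > 0\<close> by (intro Suc.IH) (auto simp: algebra_simps)
      moreover have "\<forall>\<^sub>F \<epsilon> in at_right 0. \<forall>t\<in>{p..q}. (norm (x \<epsilon> t - u t))\<^sup>2 \<le> (norm (x \<epsilon> p - u p))\<^sup>2 + \<kappa> * (t - p)"
        using p Suc.prems \<open>d > 0\<close> by (intro step) auto
      ultimately show ?thesis
      proof eventually_elim
        case (elim \<epsilon>)
        show ?case
        proof
          fix t assume t: "t \<in> {\<tau>..q}"
          show "(norm (x \<epsilon> t - u t))\<^sup>2 \<le> (norm (x \<epsilon> \<tau> - u \<tau>))\<^sup>2 + \<kappa> * (t - \<tau>)"
          proof (cases "t \<le> p")
            case True
            then show ?thesis using elim(1) t by simp
          next
            case False
            have "(norm (x \<epsilon> t - u t))\<^sup>2 \<le> (norm (x \<epsilon> p - u p))\<^sup>2 + \<kappa> * (t - p)" using elim(2) t False by simp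
            moreover have "(norm (x \<epsilon> p - u p))\<^sup>2 \<le> (norm (x \<epsilon> \<tau> - u \<tau>))\<^sup>2 + \<kappa> * (p - \<tau>)" using elim(1) p by simp
            ultimately show ?thesis by (simp add: algebra_simps)
          qed
        qed
      qed
    qed
  qed
  obtain k where "T - \<tau> < real k * (d / 2)" using reals_Archimedean3[of "d / 2"] \<open>d > 0\<close> half_gt_zero by blast
  then have k: "T - \<tau> < Suc k * (d / 2)" using \<open>d > 0\<close> by (simp add: algebra_simps)

  \<comment> \<open>All times together\<close>
  show ?thesis using short chain[OF less_imp_le[OF T(2)] order_refl k T(3)] unit
  proof eventually_elim
    case (elim \<epsilon>)
    interpret x: grad_flow "G' \<epsilon>" "x \<epsilon>" "D' \<epsilon>" "\<psi>' \<epsilon>" "N' \<epsilon>" using x elim(3) .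
    have mid: "norm (x \<epsilon> t - u t) \<le> 8 * e1" if t: "\<tau> \<le> t" "t \<le> T" for t
    proof (rule power2_le_imp_le)
      have "(norm (x \<epsilon> t - u t))\<^sup>2 \<le> (norm (x \<epsilon> \<tau> - u \<tau>))\<^sup>2 + \<kappa> * (t - \<tau>)" using elim(2) t by simp
      also have "\<dots> \<le> (7 * e1)\<^sup>2 + e1\<^sup>2"
      proof (rule add_mono)
        show "(norm (x \<epsilon> \<tau> - u \<tau>))\<^sup>2 \<le> (7 * e1)\<^sup>2" using elim(1) \<open>\<tau> > 0\<close> by (intro power_mono) auto
        have "\<kappa> * (t - \<tau>) \<le> \<kappa> * T" using t \<open>\<kappa> > 0\<close> \<open>\<tau> > 0\<close> by (intro mult_left_mono) auto
        then show "\<kappa> * (t - \<tau>) \<le> e1\<^sup>2" using T \<open>\<tau> > 0\<close> by (simp add: \<kappa>_def)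
      qed
      also have "\<dots> \<le> (8 * e1)\<^sup>2" by (simp add: power2_eq_square)
      finally show "(norm (x \<epsilon> t - u t))\<^sup>2 \<le> (8 * e1)\<^sup>2" .
    qed (use \<open>e1 > 0\<close> in simp)
    show ?case
    proof (intro allI impI)
      fix t :: real assume "0 \<le> t"
      consider "t \<le> \<tau>" | "\<tau> \<le> t" "t \<le> T" | "T \<le> t" by linarith
      then show "norm (x \<epsilon> t - u t) \<le> e"
      proof cases
        case 1
        then have "norm (x \<epsilon> t - u t) \<le> 7 * e1" using elim(1) \<open>0 \<le> t\<close> by blast
        then show ?thesis using \<open>0 < e\<close> by (simp add: e1_def)
      next
        case 2
        then show ?thesis using mid[of t] \<open>0 < e\<close> by (simp add: e1_def)
      next
        case 3
        \<comment> \<open>After \<open>T\<close>, neither flow can move away from their common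
          equilibrium \<open>z\<close>, so the distance between them stays controlled by the state
          at time \<open>T\<close>.\<close>
        have "(norm (u t - z))\<^sup>2 \<le> (norm (u T - z))\<^sup>2 + 2 * 0 * (t - T)"
          using 3 T \<open>\<tau> > 0\<close> by (intro u.evi_le z) auto
        then have ut: "norm (u t - z) \<le> norm (u T - z)" by simp
        have "(norm (x \<epsilon> t - z))\<^sup>2 \<le> (norm (x \<epsilon> T - z))\<^sup>2 + 2 * 0 * (t - T)"
          using 3 T \<open>\<tau> > 0\<close> by (intro x.evi_le z elim) auto
        then have xt: "norm (x \<epsilon> t - z) \<le> norm (x \<epsilon> T - z)" by simp
        have "norm (x \<epsilon> t - u t) \<le> norm (x \<epsilon> t - z) + norm (u t - z)"
          using norm_triangle_ineq4[of "x \<epsilon> t - z" "u t - z"] by simp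
        also have "\<dots> \<le> norm (x \<epsilon> T - z) + norm (u T - z)" using ut xt by (rule add_mono[rotated])
        also have "norm (x \<epsilon> T - z) \<le> norm (x \<epsilon> T - u T) + norm (u T - z)"
          using norm_triangle_ineq[of "x \<epsilon> T - u T" "u T - z"] by simp
        also have "norm (x \<epsilon> T - u T) \<le> 8 * e1" using mid[of T] T by simp
        finally show ?thesis using T(1) \<open>0 < e\<close> by (simp add: e1_def)
      qed
    qed
  qed
qed

section \<open>Square integrable functions\<close>

lemma eLp_norm_2:
  "eLp_norm 2 \<Omega> f = (let I = (\<integral>\<^sup>+x. ennreal ((norm (f x))\<^sup>2) \<partial>lebesgue_on \<Omega>)
     in if I = \<infinity> then \<infinity> else ennreal (sqrt (enn2real I)))"
proof -
  have "(2::ennreal) \<noteq> \<infinity>" by simp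
  then show ?thesis by (simp add: eLp_norm_def powr_half_sqrt Let_def)
qed

lemma eLp_norm_1:
  "eLp_norm 1 \<Omega> f = (let I = (\<integral>\<^sup>+x. ennreal (norm (f x)) \<partial>lebesgue_on \<Omega>)
     in if I = \<infinity> then \<infinity> else I)"
  by (simp add: eLp_norm_def Let_def less_top[symmetric] ennreal_enn2real_if)

lemma L2_iff:
  fixes f :: "real ^ 'n \<Rightarrow> 'b::{real_normed_vector, second_countable_topology}"
  shows "f \<in> Lp 2 \<Omega> \<longleftrightarrow> f \<in> borel_measurable (lebesgue_on \<Omega>) \<and> integrable (lebesgue_on \<Omega>) (\<lambda>x. (norm (f x))\<^sup>2)"
proof -
  have "integrable (lebesgue_on \<Omega>) (\<lambda>x. (norm (f x))\<^sup>2) \<longleftrightarrow> eLp_norm 2 \<Omega> f < \<infinity>"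
    if f: "f \<in> borel_measurable (lebesgue_on \<Omega>)"
  proof -
    have "(\<lambda>x. (norm (f x))\<^sup>2) \<in> borel_measurable (lebesgue_on \<Omega>)" using f by measurable
    then show ?thesis by (simp add: integrable_iff_bounded eLp_norm_2 Let_def less_top)
  qed
  then show ?thesis unfolding Lp_def by blast
qed

lemma L1_iff:
  fixes f :: "real ^ 'n \<Rightarrow> 'b::{banach, second_countable_topology}"
  shows "f \<in> Lp 1 \<Omega> \<longleftrightarrow> integrable (lebesgue_on \<Omega>) f"
  by (auto simp: Lp_def integrable_iff_bounded eLp_norm_1 Let_def less_top)

definition square_integrable :: "(real ^ 'n \<Rightarrow> real) \<Rightarrow> bool" where
  "square_integrable f \<longleftrightarrow> f \<in> borel_measurable lebesgue \<and> integrable lebesgue (\<lambda>x. (f x)\<^sup>2)"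

lemma integrable_mult_of_squares:
  fixes f g :: "'a \<Rightarrow> real"
  assumes "f \<in> borel_measurable M" "g \<in> borel_measurable M"
    "integrable M (\<lambda>x. (f x)\<^sup>2)" "integrable M (\<lambda>x. (g x)\<^sup>2)"
  shows "integrable M (\<lambda>x. f x * g x)"
proof (rule Bochner_Integration.integrable_bound)
  show "integrable M (\<lambda>x. (f x)\<^sup>2 + (g x)\<^sup>2)" using assms by simp
  show "AE x in M. norm (f x * g x) \<le> norm ((f x)\<^sup>2 + (g x)\<^sup>2)"
  proof (rule AE_I2)
    fix x
    have "0 \<le> (\<bar>f x\<bar> - \<bar>g x\<bar>)\<^sup>2" "0 \<le> \<bar>f x\<bar> * \<bar>g x\<bar>" by simp_all
    then have "\<bar>f x\<bar> * \<bar>g x\<bar> \<le> (f x)\<^sup>2 + (g x)\<^sup>2" unfolding power2_diff power2_abs by linarith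
    then show "norm (f x * g x) \<le> norm ((f x)\<^sup>2 + (g x)\<^sup>2)" by (simp add: abs_mult)
  qed
qed (use assms in measurable)

lemma square_integrable_mult:
  "\<lbrakk>square_integrable f; square_integrable g\<rbrakk> \<Longrightarrow> integrable lebesgue (\<lambda>x. f x * g x)"
  unfolding square_integrable_def by (rule integrable_mult_of_squares) auto

lemma square_integrable_add:
  assumes "square_integrable f" "square_integrable g"
  shows "square_integrable (\<lambda>x. f x + g x)"
proof -
  have "integrable lebesgue (\<lambda>x. (f x)\<^sup>2 + (g x)\<^sup>2 + 2 * (f x * g x))"
    using assms square_integrable_mult[OF assms] by (simp add: square_integrable_def)
  moreover have "(\<lambda>x. f x + g x) \<in> borel_measurable lebesgue"
    using assms by (intro borel_measurable_add) (auto simp: square_integrable_def)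
  ultimately show ?thesis by (simp add: square_integrable_def power2_sum mult.assoc)
qed

lemma square_integrable_scale:
  "square_integrable f \<Longrightarrow> square_integrable (\<lambda>x. c * f x)"
  by (auto simp: square_integrable_def power_mult_distrib intro!: borel_measurable_times)

lemma square_integrable_0: "square_integrable (\<lambda>_. 0)"
  by (simp add: square_integrable_def)

text \<open>
  So that the type does not depend on \<open>\<Omega>\<close>, functions on \<open>\<Omega>\<close> are extended by zero to the whole space
  (by \<open>cls\<close> below, which sends functions outside \<open>L2 \<Omega>\<close> to \<open>0\<close>).
\<close>

quotient_type 'n l2 = "real ^ 'n \<Rightarrow> real" / partial:
  "\<lambda>f g. square_integrable f \<and> square_integrable g \<and> (AE x in lebesgue. f x = g x)"
proof (rule part_equivpI)
  show "\<exists>f :: real ^ 'n \<Rightarrow> real. square_integrable f \<and> square_integrable f \<and> (AE x in lebesgue. f x = f x)"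
    using square_integrable_0 by blast
qed (auto intro!: sympI transpI elim: AE_mp)

lemma square_integrable_diff:
  "\<lbrakk>square_integrable f; square_integrable g\<rbrakk> \<Longrightarrow> square_integrable (\<lambda>x. f x - g x)"
  using square_integrable_add[of f "\<lambda>x. (- 1) * g x"] square_integrable_scale[of g "- 1"] by simp

instantiation l2 :: (finite) real_vector
begin

lift_definition zero_l2 :: "'a l2" is "\<lambda>_. 0" by (simp add: square_integrable_0)
lift_definition plus_l2 :: "'a l2 \<Rightarrow> 'a l2 \<Rightarrow> 'a l2" is "\<lambda>f g x. f x + g x"
  by (auto intro: square_integrable_add)
lift_definition scaleR_l2 :: "real \<Rightarrow> 'a l2 \<Rightarrow> 'a l2" is "\<lambda>c f x. c * f x"
  by (auto intro: square_integrable_scale)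
lift_definition uminus_l2 :: "'a l2 \<Rightarrow> 'a l2" is "\<lambda>f x. - f x"
  using square_integrable_scale[of _ "- 1"] by auto
lift_definition minus_l2 :: "'a l2 \<Rightarrow> 'a l2 \<Rightarrow> 'a l2" is "\<lambda>f g x. f x - g x"
  by (auto intro: square_integrable_diff)

instance
proof
  fix a b c :: "'a l2" and r s :: real
  show "a + b + c = a + (b + c)" by transfer (auto simp: add_ac intro: square_integrable_add)
  show "a + b = b + a" by transfer (auto simp: add_ac intro: square_integrable_add)
  show "0 + a = a" by transfer auto
  show "- a + a = 0" by transfer (auto simp: square_integrable_0)
  show "a - b = a + - b" by transfer (auto intro: square_integrable_diff)
  show "r *\<^sub>R (a + b) = r *\<^sub>R a + r *\<^sub>R b"
    by transfer (auto simp: algebra_simps intro!: square_integrable_add square_integrable_scale)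
  show "(r + s) *\<^sub>R a = r *\<^sub>R a + s *\<^sub>R a"
    by transfer (auto simp: algebra_simps intro!: square_integrable_add square_integrable_scale)
  show "r *\<^sub>R s *\<^sub>R a = (r * s) *\<^sub>R a"
    by transfer (auto simp: algebra_simps intro!: square_integrable_scale)
  show "1 *\<^sub>R a = a" by transfer auto
qed

end

instantiation l2 :: (finite) real_inner
begin

lift_definition inner_l2 :: "'a l2 \<Rightarrow> 'a l2 \<Rightarrow> real" is "\<lambda>f g. LINT x|lebesgue. f x * g x"
proof -
  fix f f' g g' :: "real ^ 'a \<Rightarrow> real"
  assume "square_integrable f \<and> square_integrable f' \<and> (AE x in lebesgue. f x = f' x)"
    "square_integrable g \<and> square_integrable g' \<and> (AE x in lebesgue. g x = g' x)"
  then show "(LINT x|lebesgue. f x * g x) = (LINT x|lebesgue. f' x * g' x)"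
    by (intro integral_cong_AE) (auto simp: square_integrable_def)
qed
definition norm_l2 :: "'a l2 \<Rightarrow> real" where "norm_l2 a = sqrt (a \<bullet> a)"
definition dist_l2 :: "'a l2 \<Rightarrow> 'a l2 \<Rightarrow> real" where "dist_l2 a b = norm (a - b)"
definition sgn_l2 :: "'a l2 \<Rightarrow> 'a l2" where "sgn_l2 a = a /\<^sub>R norm a"
definition uniformity_l2 :: "('a l2 \<times> 'a l2) filter" where
  "uniformity_l2 = (INF e\<in>{0<..}. principal {(x, y). dist x y < e})"
definition open_l2 :: "'a l2 set \<Rightarrow> bool" where
  "open_l2 U \<longleftrightarrow> (\<forall>x\<in>U. \<forall>\<^sub>F (x', y) in uniformity. x' = x \<longrightarrow> y \<in> U)"

instance
proof
  fix a b c :: "'a l2" and r :: real and U :: "'a l2 set"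
  show "dist a b = norm (a - b)" by (rule dist_l2_def)
  show "sgn a = a /\<^sub>R norm a" by (rule sgn_l2_def)
  show "uniformity = (INF e\<in>{0<..}. principal {(x, y :: 'a l2). dist x y < e})" by (rule uniformity_l2_def)
  show "open U \<longleftrightarrow> (\<forall>x\<in>U. \<forall>\<^sub>F (x', y) in uniformity. x' = x \<longrightarrow> y \<in> U)" by (rule open_l2_def)
  show "a \<bullet> b = b \<bullet> a" by transfer (simp add: mult.commute)
  show "(a + b) \<bullet> c = a \<bullet> c + b \<bullet> c"
    by transfer (simp add: distrib_right square_integrable_mult)
  show "(r *\<^sub>R a) \<bullet> b = r * (a \<bullet> b)" by transfer (simp add: mult.assoc)
  show "0 \<le> a \<bullet> a" by transfer simp
  show "a \<bullet> a = 0 \<longleftrightarrow> a = 0"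
  proof transfer
    fix f :: "real ^ 'a \<Rightarrow> real"
    assume "square_integrable f \<and> square_integrable f \<and> (AE x in lebesgue. f x = f x)"
    then have f: "square_integrable f" by simp
    then have "(LINT x|lebesgue. f x * f x) = 0 \<longleftrightarrow> (AE x in lebesgue. f x * f x = 0)"
      by (intro integral_nonneg_eq_0_iff_AE square_integrable_mult) auto
    then show "(LINT x|lebesgue. f x * f x) = 0 \<longleftrightarrow>
        square_integrable f \<and> square_integrable (\<lambda>_ :: real ^ 'a. 0) \<and> (AE x in lebesgue. f x = 0)"
      using f by (auto intro: square_integrable_0)
  qed
  show "norm a = sqrt (a \<bullet> a)" by (rule norm_l2_def)
qed

end

lemma square_integrable_restrict:
  fixes \<Omega> :: "(real ^ 'n) set"
  assumes \<Omega>: "\<Omega> \<in> sets lebesgue" and f: "f \<in> L2 \<Omega>"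
  shows "square_integrable (\<lambda>x. indicator \<Omega> x * f x)"
proof -
  have "(\<lambda>x. indicator \<Omega> x * f x) \<in> borel_measurable lebesgue"
    using f \<Omega> borel_measurable_restrict_space_iff[of \<Omega> lebesgue f] by (simp add: L2_iff)
  moreover have "integrable lebesgue (\<lambda>x. indicator \<Omega> x *\<^sub>R (f x)\<^sup>2)"
    using f \<Omega> integrable_restrict_space[of \<Omega> lebesgue "\<lambda>x. (f x)\<^sup>2"] by (simp add: L2_iff)
  then have "integrable lebesgue (\<lambda>x. (indicator \<Omega> x * f x)\<^sup>2)"
    by (rule Bochner_Integration.integrable_cong[THEN iffD1, rotated -1]) (auto simp: indicator_def)
  ultimately show ?thesis by (simp add: square_integrable_def)
qed

lift_definition cls :: "(real ^ 'n) set \<Rightarrow> (real ^ 'n \<Rightarrow> real) \<Rightarrow> 'n l2"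
  is "\<lambda>\<Omega> f. if \<Omega> \<in> sets lebesgue \<and> f \<in> L2 \<Omega> then (\<lambda>x. indicator \<Omega> x * f x) else (\<lambda>_. 0)"
  by (simp add: square_integrable_0 square_integrable_restrict)

section \<open>Functions on \<Omega> and their classes\<close>

context
  fixes \<Omega> :: "(real ^ 'n) set"
  assumes \<Omega>: "\<Omega> \<in> sets lebesgue"
begin

lemma L2_add: "\<lbrakk>f \<in> L2 \<Omega>; g \<in> L2 \<Omega>\<rbrakk> \<Longrightarrow> (\<lambda>x. f x + g x) \<in> L2 \<Omega>"
  unfolding L2_iff using integrable_mult_of_squares[of f "lebesgue_on \<Omega>" g]
  by (auto simp: power2_sum mult.assoc intro!: borel_measurable_add)

lemma L2_scale: "f \<in> L2 \<Omega> \<Longrightarrow> (\<lambda>x. c * f x) \<in> L2 \<Omega>"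
  by (auto simp: L2_iff power_mult_distrib intro!: borel_measurable_times)

lemma L2_diff: "\<lbrakk>f \<in> L2 \<Omega>; g \<in> L2 \<Omega>\<rbrakk> \<Longrightarrow> (\<lambda>x. f x - g x) \<in> L2 \<Omega>"
  using L2_add[of f "\<lambda>x. (- 1) * g x"] L2_scale[of g "- 1"] by simp

lemma L2_0: "(\<lambda>_. 0) \<in> L2 \<Omega>" by (simp add: L2_iff)

lemma cls_0: "cls \<Omega> (\<lambda>_. 0) = 0"
  by transfer (simp add: square_integrable_0)

lemma inner_cls:
  assumes "f \<in> L2 \<Omega>" "g \<in> L2 \<Omega>"
  shows "cls \<Omega> f \<bullet> cls \<Omega> g = L2_inner \<Omega> f g"
proof -
  have "cls \<Omega> f \<bullet> cls \<Omega> g = (LINT x|lebesgue. (indicator \<Omega> x * f x) * (indicator \<Omega> x * g x))"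
    using assms \<Omega> by transfer simp
  also have "\<dots> = (LINT x|lebesgue. indicator \<Omega> x *\<^sub>R (f x * g x))"
    by (intro Bochner_Integration.integral_cong) (auto simp: indicator_def)
  also have "\<dots> = L2_inner \<Omega> f g"
    unfolding L2_inner_def using \<Omega> by (subst integral_restrict_space) auto
  finally show ?thesis .
qed

lemma cls_diff:
  assumes "f \<in> L2 \<Omega>" "g \<in> L2 \<Omega>"
  shows "cls \<Omega> (\<lambda>x. f x - g x) = cls \<Omega> f - cls \<Omega> g"
  using L2_diff[OF assms] assms \<Omega>
  by transfer (simp add: square_integrable_restrict square_integrable_diff right_diff_distrib[symmetric])

lemma cls_scale:
  assumes "f \<in> L2 \<Omega>"
  shows "cls \<Omega> (\<lambda>x. c * f x) = c *\<^sub>R cls \<Omega> f"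
  using L2_scale[OF assms, of c] assms \<Omega>
  by transfer (simp add: square_integrable_restrict square_integrable_scale mult.left_commute)

lemma norm_cls:
  assumes "f \<in> L2 \<Omega>"
  shows "norm (cls \<Omega> f) = sqrt (LINT x|lebesgue_on \<Omega>. (f x)\<^sup>2)"
  using inner_cls[OF assms assms] by (simp add: norm_eq_sqrt_inner L2_inner_def power2_eq_square)

lemma L2_edist_cls:
  assumes "f \<in> L2 \<Omega>" "g \<in> L2 \<Omega>"
  shows "L2_edist \<Omega> f g = ennreal (norm (cls \<Omega> f - cls \<Omega> g))"
proof -
  note d = L2_diff[OF assms]
  then have "integrable (lebesgue_on \<Omega>) (\<lambda>x. (f x - g x)\<^sup>2)" by (simp add: L2_iff)
  then have "(\<integral>\<^sup>+x. ennreal ((f x - g x)\<^sup>2) \<partial>lebesgue_on \<Omega>) = ennreal (LINT x|lebesgue_on \<Omega>. (f x - g x)\<^sup>2)"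
    by (intro nn_integral_eq_integral) auto
  then show ?thesis
    using norm_cls[OF d] cls_diff[OF assms] by (simp add: L2_edist_def eLp_norm_2 Let_def)
qed

lemma cls_eqI:
  assumes "f \<in> L2 \<Omega>" "g \<in> L2 \<Omega>" "AE x in lebesgue_on \<Omega>. f x = g x"
  shows "cls \<Omega> f = cls \<Omega> g"
proof -
  have "(LINT x|lebesgue_on \<Omega>. (f x - g x)\<^sup>2) = 0"
    using assms L2_diff[of f g] by (subst integral_eq_zero_AE) auto
  then show ?thesis using norm_cls[OF L2_diff[OF assms(1,2)]] cls_diff[OF assms(1,2)] by simp
qed

text \<open>The energies are defined on representatives. Recording pairs keeps every value taken on
  a class, so agreement of these values does not have to be part of the construction.\<close>

definition graph :: "((real ^ 'n \<Rightarrow> real) \<Rightarrow> ennreal) \<Rightarrow> ('n l2 \<times> real) set" where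
  "graph F = {(cls \<Omega> v, enn2real (F v)) |v. v \<in> L2 \<Omega> \<and> F v < \<infinity>}"

text \<open>Only points of finite energy enter the graph, so the extended real subdifferential
  inequality becomes the real inequality \<open>sub\<close>. The assumption \<open>F0\<close>
  supplies the pair \<open>(0, 0)\<close>.\<close>

lemma gradient_flow_imp_grad_flow:
  assumes flow: "gradient_flow \<Omega> F w\<^sub>0 w" and F0: "F (\<lambda>_. 0) = 0"
  shows "\<exists>D \<psi> N. grad_flow (graph F) (\<lambda>t. cls \<Omega> (w t)) D \<psi> N"
proof -
  have L2: "w t \<in> L2 \<Omega>" if "0 \<le> t" for t using flow that by (simp add: gradient_flow_def)
  have "AE t in lborel. 0 < t \<longrightarrow>
      (\<exists>w'. has_L2_derivative \<Omega> w w' t \<and> (\<lambda>x. - w' x) \<in> subdifferential \<Omega> F (w t))"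
    using flow by (simp add: gradient_flow_def)
  then obtain N where N: "N \<in> null_sets lborel"
    and "{t \<in> space lborel. \<not> (0 < t \<longrightarrow> (\<exists>w'. has_L2_derivative \<Omega> w w' t \<and> (\<lambda>x. - w' x) \<in> subdifferential \<Omega> F (w t)))} \<subseteq> N"
    by (auto elim!: AE_E simp: null_sets_def)
  then have "\<forall>t. \<exists>w'. 0 < t \<and> t \<notin> N \<longrightarrow> has_L2_derivative \<Omega> w w' t \<and> (\<lambda>x. - w' x) \<in> subdifferential \<Omega> F (w t)"
    by auto
  then obtain w' where w': "\<And>t. 0 < t \<Longrightarrow> t \<notin> N \<Longrightarrow> has_L2_derivative \<Omega> w (w' t) t"
    "\<And>t. 0 < t \<Longrightarrow> t \<notin> N \<Longrightarrow> (\<lambda>x. - w' t x) \<in> subdifferential \<Omega> F (w t)"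
    by metis
  have "grad_flow (graph F) (\<lambda>t. cls \<Omega> (w t)) (\<lambda>t. cls \<Omega> (w' t)) (\<lambda>t. enn2real (F (w t))) N"
  proof
    show "continuous_on {0..} (\<lambda>t. cls \<Omega> (w t))"
      unfolding continuous_on_def
    proof
      fix t :: real assume t: "t \<in> {0..}"
      have "((\<lambda>s. L2_edist \<Omega> (w s) (w t)) \<longlongrightarrow> 0) (at t within {0..})"
        using flow t by (simp add: gradient_flow_def L2_continuous_on_def)
      moreover have "\<forall>\<^sub>F s in at t within {0..}. L2_edist \<Omega> (w s) (w t) = ennreal (norm (cls \<Omega> (w s) - cls \<Omega> (w t)))"
        unfolding eventually_at_filter using L2 t by (auto intro!: always_eventually L2_edist_cls)
      ultimately have "((\<lambda>s. ennreal (norm (cls \<Omega> (w s) - cls \<Omega> (w t)))) \<longlongrightarrow> ennreal 0) (at t within {0..})"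
        by (simp add: tendsto_cong)
      then have "((\<lambda>s. norm (cls \<Omega> (w s) - cls \<Omega> (w t))) \<longlongrightarrow> 0) (at t within {0..})"
        by (subst (asm) tendsto_ennreal_iff) auto
      then show "((\<lambda>s. cls \<Omega> (w s)) \<longlongrightarrow> cls \<Omega> (w t)) (at t within {0..})"
        by (simp add: tendsto_norm_zero_iff Lim_null[symmetric])
    qed
  next
    fix a b :: real assume ab: "0 < a" "a \<le> b"
    show "ac_on a b (\<lambda>t. cls \<Omega> (w t))"
      unfolding ac_on_def
    proof (intro allI impI)
      fix e :: real assume "e > 0"
      have "L2_absolutely_continuous_on \<Omega> a b w" using flow ab by (simp add: gradient_flow_def)
      then obtain d where d: "d > 0" "\<And>(N::nat) l r. (\<forall>k<N. a \<le> l k \<and> l k \<le> r k \<and> r k \<le> b) \<and>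
          disjoint_family_on (\<lambda>k. {l k<..<r k}) {..<N} \<and> (\<Sum>k<N. r k - l k) < d \<Longrightarrow>
          (\<Sum>k<N. L2_edist \<Omega> (w (r k)) (w (l k))) < ennreal e"
        unfolding L2_absolutely_continuous_on_def using \<open>e > 0\<close> by meson
      show "\<exists>d>0. \<forall>(N::nat) l r. (\<forall>k<N. a \<le> l k \<and> l k \<le> r k \<and> r k \<le> b) \<and>
          disjoint_family_on (\<lambda>k. {l k<..<r k}) {..<N} \<and> (\<Sum>k<N. r k - l k) < d \<longrightarrow>
          (\<Sum>k<N. norm (cls \<Omega> (w (r k)) - cls \<Omega> (w (l k)))) < e"
      proof (intro exI[of _ d] conjI allI impI d(1))
        fix N :: nat and l r :: "nat \<Rightarrow> real"
        assume H: "(\<forall>k<N. a \<le> l k \<and> l k \<le> r k \<and> r k \<le> b) \<and>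
          disjoint_family_on (\<lambda>k. {l k<..<r k}) {..<N} \<and> (\<Sum>k<N. r k - l k) < d"
        have "ennreal (\<Sum>k<N. norm (cls \<Omega> (w (r k)) - cls \<Omega> (w (l k)))) =
            (\<Sum>k<N. ennreal (norm (cls \<Omega> (w (r k)) - cls \<Omega> (w (l k)))))"
          by (rule sum_ennreal[symmetric]) simp
        also have "\<dots> = (\<Sum>k<N. L2_edist \<Omega> (w (r k)) (w (l k)))"
        proof (intro sum.cong refl L2_edist_cls[symmetric] L2)
          fix k assume "k \<in> {..<N}"
          then have "a \<le> l k \<and> l k \<le> r k" using H by simp
          then show "0 \<le> r k" "0 \<le> l k" using ab by auto
        qed
        also have "\<dots> < ennreal e" by (rule d(2)[OF H])
        finally show "(\<Sum>k<N. norm (cls \<Omega> (w (r k)) - cls \<Omega> (w (l k)))) < e"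
          by (subst (asm) ennreal_less_iff) (auto intro: sum_nonneg)
      qed
    qed
  next
    show "negligible N" using N by (simp add: negligible_iff_null_sets null_sets_completionI)
  next
    fix t assume t: "0 < t" "t \<notin> N"
    note w't = w'(1)[OF t, unfolded has_L2_derivative_def]
    \<comment> \<open>For such \<open>h\<close> the time \<open>t + h\<close> is positive, so
      \<open>w (t + h)\<close> is square integrable, as \<open>L2_edist_cls\<close>
      requires.\<close>
    have "\<forall>\<^sub>F h in at 0. h \<in> {- t<..<t} - {0}"
      using t by (intro eventually_at_in_open) auto
    then have "\<forall>\<^sub>F h in at 0. L2_edist \<Omega> (\<lambda>x. (w (t + h) x - w t x) / h) (w' t) =
        ennreal (norm ((cls \<Omega> (w (t + h)) - cls \<Omega> (w t)) /\<^sub>R h - cls \<Omega> (w' t)))"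
    proof eventually_elim
      case (elim h)
      have L: "w (t + h) \<in> L2 \<Omega>" "w t \<in> L2 \<Omega>" using L2 elim t by auto
      note L' = L2_diff[OF L]
      have "L2_edist \<Omega> (\<lambda>x. inverse h * (w (t + h) x - w t x)) (w' t) =
         ennreal (norm (cls \<Omega> (\<lambda>x. inverse h * (w (t + h) x - w t x)) - cls \<Omega> (w' t)))"
        using w't L' by (intro L2_edist_cls L2_scale) auto
      then show ?case by (simp add: cls_scale[OF L'] cls_diff[OF L] divide_inverse_commute)
    qed
    with w't have "((\<lambda>h. ennreal (norm ((cls \<Omega> (w (t + h)) - cls \<Omega> (w t)) /\<^sub>R h - cls \<Omega> (w' t)))) \<longlongrightarrow> ennreal 0) (at 0)"
      by (simp add: tendsto_cong)
    then have "((\<lambda>h. norm ((cls \<Omega> (w (t + h)) - cls \<Omega> (w t)) /\<^sub>R h - cls \<Omega> (w' t))) \<longlongrightarrow> 0) (at 0)"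
      by (subst (asm) tendsto_ennreal_iff) auto
    then show "((\<lambda>t. cls \<Omega> (w t)) has_vector_derivative cls \<Omega> (w' t)) (at t)"
      unfolding has_vector_derivative_iff_quotient
      by (simp add: tendsto_norm_zero_iff Lim_null[symmetric])
    have sd: "F (w t) < \<infinity>" "w t \<in> L2 \<Omega>"
      "\<And>v. v \<in> L2 \<Omega> \<Longrightarrow> enn2ereal (F (w t)) + ereal (L2_inner \<Omega> (\<lambda>x. - w' t x) (\<lambda>x. v x - w t x)) \<le> enn2ereal (F v)"
      using w'(2)[OF t] by (auto simp: subdifferential_def)
    then show "(cls \<Omega> (w t), enn2real (F (w t))) \<in> graph F" by (auto simp: graph_def)
    fix y b assume "(y, b) \<in> graph F"
    then obtain v where v: "y = cls \<Omega> v" "b = enn2real (F v)" "v \<in> L2 \<Omega>" "F v < \<infinity>" by (auto simp: graph_def)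
    have e: "enn2ereal c = ereal (enn2real c)" if "c < \<infinity>" for c
      using that by (cases c) (auto simp: enn2ereal_ennreal)
    have "enn2real (F (w t)) + L2_inner \<Omega> (\<lambda>x. - w' t x) (\<lambda>x. v x - w t x) \<le> b"
      using sd(3)[OF v(3)] e[OF sd(1)] e[OF v(4)] v(2) by simp
    moreover have "L2_inner \<Omega> (\<lambda>x. - w' t x) (\<lambda>x. v x - w t x) = L2_inner \<Omega> (w' t) (\<lambda>x. w t x - v x)"
      unfolding L2_inner_def by (intro Bochner_Integration.integral_cong) (auto simp: algebra_simps)
    moreover have "\<dots> = cls \<Omega> (w' t) \<bullet> (cls \<Omega> (w t) - y)"
      using w't v sd(2) by (simp add: inner_cls L2_diff cls_diff[symmetric])
    ultimately show "cls \<Omega> (w' t) \<bullet> (cls \<Omega> (w t) - y) \<le> b - enn2real (F (w t))" by simp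
  next
    show "0 \<le> b" if "(y, b) \<in> graph F" for y b using that by (auto simp: graph_def)
    show "(0, 0) \<in> graph F"
      unfolding graph_def using L2_0 F0 cls_0 by (auto intro!: exI[of _ "\<lambda>_. 0"])
  qed
  then show ?thesis by blast
qed

text \<open>
  A rapidly convergent subsequence converges almost everywhere, by summability of the \<open>L\<^sup>1\<close> norms
  of its increments on a set of finite measure; Fatou's lemma then gives convergence in \<open>L\<^sup>2\<close>.
\<close>

lemma L2_complete:
  assumes fin: "emeasure lebesgue \<Omega> < \<infinity>" and f: "\<And>n::nat. f n \<in> L2 \<Omega>" and C: "Cauchy (\<lambda>n. cls \<Omega> (f n))"
  shows "\<exists>g\<in>L2 \<Omega>. (\<lambda>n. cls \<Omega> (f n)) \<longlonglongrightarrow> cls \<Omega> g"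
proof -
  have \<Omega>space: "space (lebesgue_on \<Omega>) = \<Omega>" by (simp add: space_restrict_space)
  interpret finite_measure "lebesgue_on \<Omega>"
    by (rule finite_measureI) (use fin \<Omega> in \<open>simp add: \<Omega>space emeasure_restrict_space less_top\<close>)
  have meas: "f n \<in> borel_measurable (lebesgue_on \<Omega>)" for n using f by (simp add: L2_iff)
  have one: "(\<lambda>_. 1) \<in> L2 \<Omega>" by (simp add: L2_iff)
  have dist: "norm (cls \<Omega> (f m) - cls \<Omega> (f n)) = sqrt (LINT x|lebesgue_on \<Omega>. (f m x - f n x)\<^sup>2)" for m n
    using norm_cls[OF L2_diff[OF f f]] cls_diff[OF f f] by simp
  have dist2: "(\<integral>\<^sup>+x. ennreal ((f m x - f n x)\<^sup>2) \<partial>lebesgue_on \<Omega>) = ennreal ((norm (cls \<Omega> (f m) - cls \<Omega> (f n)))\<^sup>2)" for m n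
  proof -
    have "integrable (lebesgue_on \<Omega>) (\<lambda>x. (f m x - f n x)\<^sup>2)" using L2_diff[OF f f] by (simp add: L2_iff)
    then show ?thesis by (subst nn_integral_eq_integral) (auto simp: dist)
  qed
  have "\<exists>N. \<forall>m\<ge>N. \<forall>n\<ge>N. norm (cls \<Omega> (f m) - cls \<Omega> (f n)) < (1/2) ^ k" for k :: nat
    using CauchyD[OF C, of "(1/2) ^ k"] by simp
  then obtain N where N: "\<And>k m n. N k \<le> m \<Longrightarrow> N k \<le> n \<Longrightarrow> norm (cls \<Omega> (f m) - cls \<Omega> (f n)) < (1/2) ^ k"
    by metis
  \<comment> \<open>Summing the thresholds makes the indices monotone and at least
    \<open>N k\<close>; adding \<open>k\<close> sends them to infinity.\<close>
  define r where "r k = (\<Sum>i\<le>k. N i) + k" for k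
  have rN: "N k \<le> r k" for k
    using member_le_sum[of k "{..k}" N] by (simp add: r_def)
  have r_ge: "k \<le> r k" for k by (simp add: r_def)
  have r_mono: "r k \<le> r (Suc k)" for k by (simp add: r_def)
  define h where "h k x = \<bar>f (r (Suc k)) x - f (r k) x\<bar>" for k x
  have hm: "h k \<in> borel_measurable (lebesgue_on \<Omega>)" for k unfolding h_def using meas by measurable
  \<comment> \<open>Cauchy-Schwarz against the constant \<open>1\<close>, which is square integrable
    because \<Omega> has finite measure.\<close>
  have hint: "(\<integral>\<^sup>+x. ennreal (h k x) \<partial>lebesgue_on \<Omega>) \<le> ennreal (norm (cls \<Omega> (\<lambda>_. 1)) * (1/2) ^ k)" for k
  proof -
    have hL: "h k \<in> L2 \<Omega>"
      using L2_diff[OF f f, of "r (Suc k)" "r k"] hm by (simp add: L2_iff h_def)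
    have "integrable (lebesgue_on \<Omega>) (\<lambda>x. 1 * h k x)"
      using hL one by (intro integrable_mult_of_squares) (auto simp: L2_iff)
    moreover have "AE x in lebesgue_on \<Omega>. 0 \<le> h k x" by (simp add: h_def)
    ultimately have "(\<integral>\<^sup>+x. ennreal (h k x) \<partial>lebesgue_on \<Omega>) = ennreal (L2_inner \<Omega> (\<lambda>_. 1) (h k))"
      by (simp add: L2_inner_def nn_integral_eq_integral)
    also have "L2_inner \<Omega> (\<lambda>_. 1) (h k) \<le> norm (cls \<Omega> (\<lambda>_. 1)) * norm (cls \<Omega> (h k))"
      unfolding inner_cls[OF one hL, symmetric] by (rule norm_cauchy_schwarz)
    also have "norm (cls \<Omega> (h k)) = norm (cls \<Omega> (f (r (Suc k))) - cls \<Omega> (f (r k)))"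
      by (simp add: norm_cls[OF hL] dist h_def)
    also have "\<dots> \<le> (1/2) ^ k"
      using N[of k "r (Suc k)" "r k"] rN[of k] r_mono[of k] by simp
    finally show ?thesis by (simp add: mult_left_mono ennreal_leI)
  qed
  have "(\<integral>\<^sup>+x. (\<Sum>k. ennreal (h k x)) \<partial>lebesgue_on \<Omega>) = (\<Sum>k. \<integral>\<^sup>+x. ennreal (h k x) \<partial>lebesgue_on \<Omega>)"
    using hm by (intro nn_integral_suminf) measurable
  also have "\<dots> \<le> (\<Sum>k. ennreal (norm (cls \<Omega> (\<lambda>_. 1)) * (1/2) ^ k))"
    by (intro suminf_le hint) auto
  also have "\<dots> < \<infinity>"
    by (subst suminf_ennreal2) (auto intro!: summable_mult)
  finally have "AE x in lebesgue_on \<Omega>. (\<Sum>k. ennreal (h k x)) \<noteq> \<infinity>"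
    using hm by (intro nn_integral_PInf_AE) (auto intro!: borel_measurable_suminf_order simp: less_top)
  then have conv: "AE x in lebesgue_on \<Omega>. convergent (\<lambda>k. f (r k) x)"
  proof eventually_elim
    case (elim x)
    have "summable (\<lambda>k. h k x)"
      using elim by (intro summable_suminf_not_top) (auto simp: h_def)
    then have "summable (\<lambda>k. f (r (Suc k)) x - f (r k) x)"
      unfolding h_def by (rule summable_rabs_cancel)
    then have "convergent (\<lambda>n. \<Sum>k<n. f (r (Suc k)) x - f (r k) x)" by (simp add: summable_iff_convergent)
    then have "convergent (\<lambda>n. f (r n) x - f (r 0) x)" by (simp only: sum_lessThan_telescope[of "\<lambda>n. f (r n) x"])
    then have "convergent (\<lambda>n. (f (r n) x - f (r 0) x) + f (r 0) x)" by (intro convergent_add convergent_const)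
    then show ?case by simp
  qed
  define g where "g x = lim (\<lambda>k. f (r k) x)" for x
  have gm: "g \<in> borel_measurable (lebesgue_on \<Omega>)"
    unfolding g_def using meas by (intro borel_measurable_lim_metric)
  have gconv: "AE x in lebesgue_on \<Omega>. (\<lambda>k. f (r k) x) \<longlonglongrightarrow> g x"
    using conv by eventually_elim (simp add: g_def convergent_LIMSEQ_iff)
  have bound: "(\<integral>\<^sup>+x. ennreal ((g x - f m x)\<^sup>2) \<partial>lebesgue_on \<Omega>) \<le> ennreal (((1/2) ^ k)\<^sup>2)" if "N k \<le> m" for k m
  proof -
    have "(\<integral>\<^sup>+x. ennreal ((g x - f m x)\<^sup>2) \<partial>lebesgue_on \<Omega>) =
        (\<integral>\<^sup>+x. liminf (\<lambda>j. ennreal ((f (r j) x - f m x)\<^sup>2)) \<partial>lebesgue_on \<Omega>)"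
    proof (rule nn_integral_cong_AE)
      show "AE x in lebesgue_on \<Omega>. ennreal ((g x - f m x)\<^sup>2) = liminf (\<lambda>j. ennreal ((f (r j) x - f m x)\<^sup>2))"
        using gconv
      proof eventually_elim
        case (elim x)
        then have "(\<lambda>j. ennreal ((f (r j) x - f m x)\<^sup>2)) \<longlonglongrightarrow> ennreal ((g x - f m x)\<^sup>2)"
          by (intro tendsto_ennrealI tendsto_intros)
        then show ?case by (rule lim_imp_Liminf[OF trivial_limit_sequentially, symmetric])
      qed
    qed
    also have "\<dots> \<le> liminf (\<lambda>j. \<integral>\<^sup>+x. ennreal ((f (r j) x - f m x)\<^sup>2) \<partial>lebesgue_on \<Omega>)"
      using meas by (intro nn_integral_liminf) measurable
    also have "\<dots> \<le> liminf (\<lambda>j. ennreal (((1/2) ^ k)\<^sup>2))"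
    proof (rule Liminf_mono)
      have "\<forall>\<^sub>F j in sequentially. N k \<le> r j"
        using eventually_ge_at_top[of "N k"] by eventually_elim (use r_ge order_trans in blast)
      then show "\<forall>\<^sub>F j in sequentially. (\<integral>\<^sup>+x. ennreal ((f (r j) x - f m x)\<^sup>2) \<partial>lebesgue_on \<Omega>) \<le> ennreal (((1/2) ^ k)\<^sup>2)"
      proof eventually_elim
        case (elim j)
        have "norm (cls \<Omega> (f (r j)) - cls \<Omega> (f m)) \<le> (1/2) ^ k" using N[OF elim that] by simp
        then show ?case unfolding dist2 by (intro ennreal_leI power_mono) auto
      qed
    qed
    also have "\<dots> = ennreal (((1/2) ^ k)\<^sup>2)" by (simp add: Liminf_const)
    finally show ?thesis .
  qed
  have gf: "(\<lambda>x. g x - f m x) \<in> L2 \<Omega>" if "N 0 \<le> m" for m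
  proof -
    have "(\<lambda>x. g x - f m x) \<in> borel_measurable (lebesgue_on \<Omega>)" using gm meas by measurable
    moreover have "(\<integral>\<^sup>+x. ennreal ((g x - f m x)\<^sup>2) \<partial>lebesgue_on \<Omega>) < \<infinity>"
      using bound[OF that] by (rule order.strict_trans1) simp
    ultimately show ?thesis by (simp add: L2_iff integrable_iff_bounded)
  qed
  have gL: "g \<in> L2 \<Omega>" using L2_add[OF gf[OF order_refl] f[of "N 0"]] by simp
  have "(\<lambda>n. cls \<Omega> (f n)) \<longlonglongrightarrow> cls \<Omega> g"
  proof (rule LIMSEQ_I)
    fix e :: real assume "e > 0"
    then obtain k where k: "(1/2) ^ k < e" using real_arch_pow_inv[of e "1/2"] by auto
    have "norm (cls \<Omega> (f n) - cls \<Omega> g) < e" if "N k \<le> n" for n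
    proof -
      have i: "integrable (lebesgue_on \<Omega>) (\<lambda>x. (g x - f n x)\<^sup>2)" using L2_diff[OF gL f] by (simp add: L2_iff)
      have "ennreal (LINT x|lebesgue_on \<Omega>. (g x - f n x)\<^sup>2) \<le> ennreal (((1/2) ^ k)\<^sup>2)"
        using bound[OF that] by (subst nn_integral_eq_integral[OF i, symmetric]) auto
      then have "(LINT x|lebesgue_on \<Omega>. (g x - f n x)\<^sup>2) \<le> ((1/2) ^ k)\<^sup>2" by simp
      then have "sqrt (LINT x|lebesgue_on \<Omega>. (g x - f n x)\<^sup>2) \<le> (1/2) ^ k"
        by (rule real_le_lsqrt[rotated -1]) auto
      then show ?thesis
        using norm_cls[OF L2_diff[OF gL f]] cls_diff[OF gL f] k by (simp add: norm_minus_commute)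
    qed
    then show "\<exists>n0. \<forall>n\<ge>n0. norm (cls \<Omega> (f n) - cls \<Omega> g) < e" by blast
  qed
  then show ?thesis using gL by blast
qed

end

section \<open>The convexified integrands\<close>

lemma convexification_ge:
  assumes "convex_on UNIV g" "\<And>s. g s \<le> f s"
  shows "g \<sigma> \<le> convexification f \<sigma>"
  unfolding convexification_def
  by (rule cSUP_upper2[where x = g and f = "\<lambda>g. g \<sigma>"]) (use assms in \<open>auto intro!: bdd_aboveI[of _ "f \<sigma>"]\<close>)

text \<open>The minorant \<open>g\<^sub>0\<close> witnesses that the set of convex minorants is
  nonempty, so that the real supremum is a genuine one.\<close>

lemma convexification_le:
  assumes "convex_on UNIV g\<^sub>0" "\<And>s. g\<^sub>0 s \<le> f s"
    and "\<And>g. \<lbrakk>convex_on UNIV g; \<And>s. g s \<le> f s\<rbrakk> \<Longrightarrow> g \<sigma> \<le> c"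
  shows "convexification f \<sigma> \<le> c"
  unfolding convexification_def by (rule cSUP_least) (use assms in auto)

lemma phi_eps_nonneg: "0 < \<epsilon> \<Longrightarrow> 0 \<le> phi_eps \<epsilon> \<sigma>"
  by (simp add: phi_eps_def)

lemma convexification_phi_nonneg: "0 < \<epsilon> \<Longrightarrow> 0 \<le> convexification (phi_eps \<epsilon>) \<sigma>"
  by (rule convexification_ge[of "\<lambda>_. 0"]) (auto simp: phi_eps_nonneg convex_on_const)

lemma convexification_phi_0: "0 < \<epsilon> \<Longrightarrow> convexification (phi_eps \<epsilon>) 0 = 0"
proof (rule antisym)
  assume "0 < \<epsilon>"
  then show "convexification (phi_eps \<epsilon>) 0 \<le> 0"
  proof (intro convexification_le[of "\<lambda>_. 0"] phi_eps_nonneg)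
    fix g assume "\<And>s. g s \<le> phi_eps \<epsilon> s"
    from this[of 0] show "g 0 \<le> 0" by (simp add: phi_eps_def)
  qed (auto simp: convex_on_const)
qed (rule convexification_phi_nonneg)

text \<open>
  For \<open>\<sigma> \<ge> \<epsilon> powr (- (1 - \<eta>)\<^sup>2)\<close> the logarithmic term is at least \<open>(1 - \<eta>)\<^sup>2 / \<epsilon>\<close>, and the claim is
  the inequality between the arithmetic and geometric mean; for smaller \<open>\<sigma> \<ge> \<eta>\<close> the logarithmic
  term alone suffices.
\<close>

lemma convexification_phi_lower:
  fixes \<eta> :: real
  assumes "0 < \<eta>" "\<eta> < 1"
  shows "\<forall>\<^sub>F \<epsilon> in at_right 0. \<forall>\<sigma>. (1 - \<eta>) * \<sigma> - \<eta> \<le> convexification (phi_eps \<epsilon>) \<sigma>"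
proof -
  \<comment> \<open>Completing the square in
    \<open>b / \<epsilon> + \<epsilon> / 4 * \<sigma>\<^sup>2\<close> yields slope exactly
    \<open>1 - \<eta>\<close> for this \<open>b\<close>; as \<open>b < 1\<close>, an exponent
    \<open>c > 0\<close> is left over for the smaller \<sigma>.\<close>
  define b where "b = (1 - \<eta>)\<^sup>2"
  define c where "c = 1 - b"
  have b: "0 < b" "b < 1" using assms by (auto simp: b_def power_less_one_iff)
  have "c > 0" using b by (simp add: c_def)
  define k where "k = ln (1 + \<eta>\<^sup>2) / 2"
  have "k > 0" using assms by (auto simp: k_def intro!: ln_gt_zero)
  \<comment> \<open>With \<open>\<epsilon> = exp (- L)\<close> this gives the decay of
    \<open>L * exp (- c * L)\<close>, which compares the threshold \<open>exp (b * L)\<close> with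
    the factor \<open>1 / (\<epsilon> * L)\<close> of the logarithm.\<close>
  have "LIM \<epsilon> at_right 0. c * (- ln \<epsilon>) :> at_top"
    using ln_at_0 \<open>c > 0\<close>
    by (intro filterlim_tendsto_pos_mult_at_top[OF tendsto_const]) (auto simp: filterlim_uminus_at_top)
  then have "((\<lambda>\<epsilon>. (c * (- ln \<epsilon>)) ^ 1 / exp (c * (- ln \<epsilon>))) \<longlongrightarrow> 0) (at_right (0::real))"
    by (rule filterlim_compose[OF tendsto_power_div_exp_0])
  then have "\<forall>\<^sub>F \<epsilon> in at_right (0::real). (c * (- ln \<epsilon>)) ^ 1 / exp (c * (- ln \<epsilon>)) < c * k"
    using \<open>c > 0\<close> \<open>k > 0\<close> by (intro order_tendstoD(2)) auto
  moreover have "\<forall>\<^sub>F \<epsilon> in at_right 0. \<epsilon> \<in> {0<..<1::real}" by (rule eventually_at_right_real) simp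
  ultimately show ?thesis
  proof eventually_elim
    case (elim \<epsilon>)
    define L where "L = - ln \<epsilon>"
    have \<epsilon>: "0 < \<epsilon>" "\<epsilon> < 1" using elim by auto
    then have "L > 0" by (simp add: L_def)
    have absln: "\<bar>ln \<epsilon>\<bar> = L" using \<epsilon> by (simp add: L_def)
    have "c * (L * exp (- c * L)) < c * k"
      using elim(1) by (simp add: L_def exp_minus[of "- (c * ln \<epsilon>)", simplified] divide_inverse mult.assoc)
    then have small: "L * exp (- c * L) < k" using \<open>c > 0\<close> by (simp only: mult_less_cancel_left_pos)
    have \<epsilon>L: "\<epsilon> = exp (- L)" using \<epsilon> by (simp add: L_def)
    have "(1 - \<eta>) * \<sigma> - \<eta> \<le> phi_eps \<epsilon> \<sigma>" for \<sigma>
    proof -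
      consider "\<sigma> \<le> \<eta>" | "\<eta> < \<sigma>" "2 * b * L \<le> ln (1 + \<sigma>\<^sup>2)" | "\<eta> < \<sigma>" "ln (1 + \<sigma>\<^sup>2) < 2 * b * L" by linarith
      then show ?thesis
      proof cases
        case 1
        have "(1 - \<eta>) * \<sigma> \<le> (1 - \<eta>) * \<eta>" using 1 assms by (intro mult_left_mono) auto
        also have "\<dots> \<le> \<eta>" using assms by (simp add: algebra_simps)
        finally show ?thesis using phi_eps_nonneg[OF \<epsilon>(1), of \<sigma>] by simp
      next
        case 2
        have "b / \<epsilon> = 1 / (2 * \<epsilon> * L) * (2 * b * L)" using \<epsilon> \<open>L > 0\<close> by (simp add: field_simps)
        also have "\<dots> \<le> 1 / (2 * \<epsilon> * L) * ln (1 + \<sigma>\<^sup>2)" using 2 \<epsilon> \<open>L > 0\<close> by (intro mult_left_mono) auto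
        finally have "b / \<epsilon> + \<epsilon> / 4 * \<sigma>\<^sup>2 \<le> phi_eps \<epsilon> \<sigma>" by (simp add: phi_eps_def absln)
        moreover have "b / \<epsilon> + \<epsilon> / 4 * \<sigma>\<^sup>2 - (1 - \<eta>) * \<sigma> = ((1 - \<eta>) - \<epsilon> * \<sigma> / 2)\<^sup>2 / \<epsilon>"
          using \<epsilon> by (simp add: b_def power2_eq_square field_simps)
        moreover have "0 \<le> ((1 - \<eta>) - \<epsilon> * \<sigma> / 2)\<^sup>2 / \<epsilon>" using \<epsilon> by simp
        ultimately show ?thesis using assms by linarith
      next
        case 3
        have "\<sigma>\<^sup>2 \<le> 1 + \<sigma>\<^sup>2" by simp
        also have "\<dots> = exp (ln (1 + \<sigma>\<^sup>2))" by (simp add: add_pos_nonneg)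
        also have "\<dots> \<le> exp (2 * b * L)" using 3 by simp
        also have "\<dots> = (exp (b * L))\<^sup>2" by (simp add: exp_double[symmetric] mult.assoc)
        finally have "\<sigma> \<le> exp (b * L)" by (rule power2_le_imp_le) simp
        moreover have "exp (b * L) \<le> k / (\<epsilon> * L)"
        proof -
          have "exp (b * L) * (\<epsilon> * L) = L * exp (- c * L)"
            by (simp add: \<epsilon>L c_def exp_add[symmetric] algebra_simps)
          then have "exp (b * L) * (\<epsilon> * L) \<le> k" using small by (simp only: less_imp_le)
          then show ?thesis using \<epsilon> \<open>L > 0\<close> by (simp only: pos_le_divide_eq mult_pos_pos)
        qed
        moreover have "k / (\<epsilon> * L) \<le> 1 / (2 * \<epsilon> * L) * ln (1 + \<sigma>\<^sup>2)"
        proof -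
          have "\<eta>\<^sup>2 \<le> \<sigma>\<^sup>2" using 3 assms by (intro power_mono) auto
          then have "ln (1 + \<eta>\<^sup>2) \<le> ln (1 + \<sigma>\<^sup>2)" using assms by (simp add: add_pos_nonneg)
          then have "1 / (2 * \<epsilon> * L) * ln (1 + \<eta>\<^sup>2) \<le> 1 / (2 * \<epsilon> * L) * ln (1 + \<sigma>\<^sup>2)"
            using \<epsilon> \<open>L > 0\<close> by (intro mult_left_mono) auto
          then show ?thesis by (simp add: k_def field_simps)
        qed
        moreover have "1 / (2 * \<epsilon> * L) * ln (1 + \<sigma>\<^sup>2) \<le> phi_eps \<epsilon> \<sigma>" using \<epsilon> by (simp add: phi_eps_def absln)
        moreover have "(1 - \<eta>) * \<sigma> \<le> \<sigma>" using 3 assms by (simp add: algebra_simps)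
        ultimately show ?thesis using assms by linarith
      qed
    qed
    moreover have "convex_on UNIV (\<lambda>\<sigma>. (1 - \<eta>) * \<sigma> - \<eta>)"
      by (rule convex_onI) (auto simp: algebra_simps)
    ultimately show ?case using convexification_ge[of "\<lambda>\<sigma>. (1 - \<eta>) * \<sigma> - \<eta>" "phi_eps \<epsilon>"] by blast
  qed
qed

text \<open>The convexification lies below the chord of \<open>phi_eps \<epsilon>\<close> from \<open>0\<close> to \<open>2 / \<epsilon>\<close>.\<close>

lemma convexification_phi_upper:
  fixes \<eta> M :: real
  assumes "0 < \<eta>"
  shows "\<forall>\<^sub>F \<epsilon> in at_right 0. \<forall>\<sigma>. 0 \<le> \<sigma> \<and> \<sigma> \<le> M \<longrightarrow> convexification (phi_eps \<epsilon>) \<sigma> \<le> (1 + \<eta>) * \<sigma>"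
proof -
  have "\<forall>\<^sub>F \<epsilon> in at_right (0::real). ln \<epsilon> < - (ln 5 / (4 * \<eta>))"
    using ln_at_0 by (simp add: filterlim_at_bot_dense)
  moreover have "\<forall>\<^sub>F \<epsilon> in at_right 0. \<epsilon> \<in> {0<..<1::real}" by (rule eventually_at_right_real) simp
  moreover have "\<forall>\<^sub>F \<epsilon> in at_right 0. \<epsilon> \<in> {0<..<2 / (\<bar>M\<bar> + 1)}"
    by (rule eventually_at_right_real) (simp add: add_nonneg_pos)
  ultimately show ?thesis
  proof eventually_elim
    case (elim \<epsilon>)
    define L where "L = - ln \<epsilon>"
    have \<epsilon>: "0 < \<epsilon>" "\<epsilon> < 1" using elim by auto
    then have "L > 0" by (simp add: L_def)
    have absln: "\<bar>ln \<epsilon>\<bar> = L" using \<epsilon> by (simp add: L_def)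
    \<comment> \<open>At \<open>s = A / \<epsilon>\<close> the chord has slope close to
      \<open>1 / A + A / 4\<close>, which is smallest, with value 1, for \<open>A = 2\<close>. The
      correction \<open>ln 5 / (4 * L)\<close> comes from
      \<open>1 + 4 / \<epsilon>\<^sup>2 \<le> 5 / \<epsilon>\<^sup>2\<close>.\<close>
    define s where "s = 2 / \<epsilon>"
    have "s > 0" using \<epsilon> by (simp add: s_def)
    have "\<epsilon> * (\<bar>M\<bar> + 1) < 2" using elim(3) by (simp add: pos_less_divide_eq add_nonneg_pos)
    moreover have "\<epsilon> * M \<le> \<epsilon> * (\<bar>M\<bar> + 1)" using \<epsilon> by (intro mult_left_mono) auto
    ultimately have "M * \<epsilon> \<le> 2" unfolding mult.commute[of M] by linarith
    then have Ms: "M \<le> s" using \<epsilon> by (simp add: s_def pos_le_divide_eq)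
    have "ln (1 + s\<^sup>2) \<le> ln (5 / \<epsilon>\<^sup>2)"
    proof (rule ln_mono)
      have "\<epsilon>\<^sup>2 \<le> 1" using \<epsilon> by (simp add: power_le_one)
      then show "1 + s\<^sup>2 \<le> 5 / \<epsilon>\<^sup>2" using \<epsilon> by (simp add: s_def power_divide field_simps)
    qed (auto simp: add_pos_nonneg)
    also have "\<dots> = ln 5 + 2 * L" using \<epsilon> by (simp add: ln_div ln_realpow L_def)
    finally have ln: "ln (1 + s\<^sup>2) \<le> ln 5 + 2 * L" .
    have "phi_eps \<epsilon> s / s = ln (1 + s\<^sup>2) / (4 * L) + 1 / 2"
      using \<epsilon> \<open>L > 0\<close> by (simp add: phi_eps_def absln s_def field_simps power2_eq_square)
    also have "\<dots> \<le> (ln 5 + 2 * L) / (4 * L) + 1 / 2" using ln \<open>L > 0\<close> by (intro add_mono divide_right_mono) auto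
    also have "\<dots> = 1 + ln 5 / (4 * L)" using \<open>L > 0\<close> by (simp add: field_simps)
    also have "ln 5 / (4 * L) \<le> \<eta>" using elim(1) \<open>0 < \<eta>\<close> \<open>L > 0\<close> by (simp add: L_def field_simps)
    finally have slope: "phi_eps \<epsilon> s / s \<le> 1 + \<eta>" by simp
    show ?case
    proof (intro allI impI convexification_le[of "\<lambda>_. 0"] phi_eps_nonneg[OF \<epsilon>(1)])
      fix \<sigma> g assume \<sigma>: "0 \<le> \<sigma> \<and> \<sigma> \<le> M" and g: "convex_on UNIV g" "\<And>r. g r \<le> phi_eps \<epsilon> r"
      define \<theta> where "\<theta> = \<sigma> / s"
      have \<theta>: "0 \<le> \<theta>" "\<theta> \<le> 1" using \<sigma> Ms \<open>s > 0\<close> by (auto simp: \<theta>_def)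
      have "g ((1 - \<theta>) *\<^sub>R 0 + \<theta> *\<^sub>R s) \<le> (1 - \<theta>) * g 0 + \<theta> * g s"
        using \<theta> by (intro convex_onD[OF g(1)]) auto
      also have "\<dots> \<le> (1 - \<theta>) * 0 + \<theta> * phi_eps \<epsilon> s"
        using \<theta> g(2)[of 0] g(2)[of s] by (intro add_mono mult_left_mono) (auto simp: phi_eps_def)
      also have "\<dots> = \<sigma> * (phi_eps \<epsilon> s / s)" by (simp add: \<theta>_def)
      also have "\<dots> \<le> \<sigma> * (1 + \<eta>)" using slope \<sigma> by (intro mult_left_mono) auto
      finally show "g \<sigma> \<le> (1 + \<eta>) * \<sigma>" using \<open>s > 0\<close> by (simp add: \<theta>_def mult.commute)
    qed (auto simp: convex_on_const)
  qed
qed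

section \<open>Mollification\<close>

lemma integrable_cball_indicator:
  "integrable lborel (\<lambda>x :: 'a::euclidean_space. c * indicator (cball 0 r) x :: real)"
  using emeasure_bounded_finite[OF bounded_cball[of 0 r]]
  by (intro integrable_mult_right integrable_real_indicator) auto

lemma AE_lborel_iff_lebesgue: "(AE x in lborel. P x) \<longleftrightarrow> (AE x in lebesgue. P x)"
  by (simp add: AE_completion_iff)

lemma abs_clamp_le: "0 \<le> K \<Longrightarrow> \<bar>max (- K) (min K y)\<bar> \<le> \<bar>y\<bar>" for K y :: real
  by (simp add: max_def min_def)

text \<open>Cut off the support and the values of \<open>f\<close> at a level \<open>k\<close>; the
  cut-off function is a limit almost everywhere of continuous functions cut off in the same way, and
  these are dominated. Dominated convergence is used for both limits.\<close>

lemma integrable_approx_continuous: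
  fixes f :: "'a::euclidean_space \<Rightarrow> real"
  assumes f: "integrable lborel f" and "e > 0"
  shows "\<exists>g. continuous_on UNIV g \<and> integrable lborel g \<and> (LINT x|lborel. \<bar>f x - g x\<bar>) < e"
proof -
  define T where "T k g x = max 0 (min 1 (real k + 1 - norm x)) * max (- real k) (min (real k) (g x))"
    for k :: nat and g :: "'a \<Rightarrow> real" and x
  have T_abs: "\<bar>T k g x\<bar> \<le> \<bar>g x\<bar>" for k g x
  proof -
    have 1: "\<bar>max 0 (min 1 (real k + 1 - norm x))\<bar> \<le> 1" by simp
    have 2: "\<bar>max (- real k) (min (real k) (g x))\<bar> \<le> \<bar>g x\<bar>" by (rule abs_clamp_le) simp
    have "\<bar>T k g x\<bar> \<le> 1 * \<bar>g x\<bar>"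
      unfolding T_def abs_mult by (rule mult_mono[OF 1 2 zero_le_one abs_ge_zero])
    then show ?thesis by simp
  qed
  have T_bd: "\<bar>T k g x\<bar> \<le> real k * indicator (cball 0 (real k + 1)) x" for k g x
  proof (cases "norm x \<le> real k + 1")
    case True
    have "\<bar>max 0 (min 1 (real k + 1 - norm x))\<bar> \<le> 1" "\<bar>max (- real k) (min (real k) (g x))\<bar> \<le> real k" by auto
    then have "\<bar>T k g x\<bar> \<le> 1 * real k" unfolding T_def abs_mult by (intro mult_mono) auto
    then show ?thesis using True by (simp add: dist_norm)
  qed (simp add: T_def dist_norm)
  have fm[measurable]: "f \<in> borel_measurable borel" using borel_measurable_integrable[OF f] by simp
  have "(\<lambda>k. LINT x|lborel. \<bar>f x - T k f x\<bar>) \<longlonglongrightarrow> (LINT x|(lborel :: 'a measure). 0)"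
  proof (rule integral_dominated_convergence[where w = "\<lambda>x. 2 * \<bar>f x\<bar>"])
    show "(\<lambda>x. \<bar>f x - T k f x\<bar>) \<in> borel_measurable lborel" for k unfolding T_def by measurable
    show "integrable lborel (\<lambda>x. 2 * \<bar>f x\<bar>)" using f by simp
    show "AE x in lborel. norm \<bar>f x - T k f x\<bar> \<le> 2 * \<bar>f x\<bar>" for k
    proof (rule AE_I2)
      show "norm \<bar>f x - T k f x\<bar> \<le> 2 * \<bar>f x\<bar>" for x using T_abs[of k f x] by auto
    qed
    show "AE x in lborel. (\<lambda>k. \<bar>f x - T k f x\<bar>) \<longlonglongrightarrow> 0"
    proof (rule AE_I2)
      fix x
      obtain m :: nat where m: "norm x + \<bar>f x\<bar> < real m" using reals_Archimedean2 by blast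
      have "\<bar>f x - T k f x\<bar> = 0" if "m \<le> k" for k
      proof -
        have "norm x < real k" "\<bar>f x\<bar> < real k" using m that norm_ge_zero[of x] abs_ge_zero[of "f x"] by linarith+
        then have "max 0 (min 1 (real k + 1 - norm x)) = 1" "max (- real k) (min (real k) (f x)) = f x"
          by (auto simp: abs_less_iff)
        then show ?thesis by (simp add: T_def)
      qed
      then have "\<forall>\<^sub>F k in sequentially. \<bar>f x - T k f x\<bar> = 0" unfolding eventually_sequentially by blast
      then show "(\<lambda>k. \<bar>f x - T k f x\<bar>) \<longlonglongrightarrow> 0" by (rule tendsto_eventually)
    qed
  qed simp
  then have "\<forall>\<^sub>F k in sequentially. (LINT x|lborel. \<bar>f x - T k f x\<bar>) < e / 2"
    using \<open>e > 0\<close> by (intro order_tendstoD(2)) auto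
  then obtain k where k: "(LINT x|lborel. \<bar>f x - T k f x\<bar>) < e / 2"
    unfolding eventually_sequentially by blast
  \<comment> \<open>This notion of measurability gives continuous functions converging to
    \<open>f\<close> off a negligible set, to which the continuous cut-off \<open>T k\<close>
    applies.\<close>
  have "f measurable_on UNIV"
    using fm by (intro lebesgue_measurable_imp_measurable_on_real measurable_completion) auto
  then obtain N g where N: "negligible N" and g: "\<And>n. continuous_on UNIV (g n)"
      "\<And>x. x \<notin> N \<Longrightarrow> (\<lambda>n. g n x) \<longlonglongrightarrow> f x"
    unfolding measurable_on_def by auto
  have Tcont: "continuous_on UNIV (T k (g n))" for n unfolding T_def by (intro continuous_intros g)
  have Tm[measurable]: "T k (g n) \<in> borel_measurable borel" for n by (rule borel_measurable_continuous_onI[OF Tcont])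
  have Tint: "integrable lborel (T k h)" if [measurable]: "h \<in> borel_measurable borel" for h
  proof (rule Bochner_Integration.integrable_bound[OF integrable_cball_indicator[of "real k" "real k + 1"]])
    show "T k h \<in> borel_measurable lborel" unfolding T_def by measurable
    show "AE x in lborel. norm (T k h x) \<le> norm (real k * indicator (cball 0 (real k + 1)) x :: real)"
      using T_bd[of k h] by (intro AE_I2) (auto simp: abs_mult)
  qed
  have gm: "g n \<in> borel_measurable borel" for n by (rule borel_measurable_continuous_onI[OF g(1)])
  have "(\<lambda>n. LINT x|lborel. \<bar>T k f x - T k (g n) x\<bar>) \<longlonglongrightarrow> (LINT x|(lborel :: 'a measure). 0)"
  proof (rule integral_dominated_convergence[where w = "\<lambda>x. 2 * (real k * indicator (cball 0 (real k + 1)) x)"])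
    show "integrable lborel (\<lambda>x::'a. 2 * (real k * indicator (cball 0 (real k + 1)) x))"
      by (intro integrable_mult_right integrable_cball_indicator)
    show "(\<lambda>x. \<bar>T k f x - T k (g n) x\<bar>) \<in> borel_measurable lborel" for n
      using Tint[OF fm] Tint[OF gm] by simp
    show "AE x in lborel. norm \<bar>T k f x - T k (g n) x\<bar> \<le> 2 * (real k * indicator (cball 0 (real k + 1)) x)" for n
    proof (rule AE_I2)
      show "norm \<bar>T k f x - T k (g n) x\<bar> \<le> 2 * (real k * indicator (cball 0 (real k + 1)) x)" for x
        using T_bd[of k f x] T_bd[of k "g n" x] by auto
    qed
    have "AE x in lebesgue. x \<notin> N" using N by (simp add: negligible_iff_null_sets AE_not_in)
    then have "AE x in lborel. x \<notin> N" by (simp add: AE_lborel_iff_lebesgue)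
    then show "AE x in lborel. (\<lambda>n. \<bar>T k f x - T k (g n) x\<bar>) \<longlonglongrightarrow> 0"
    proof eventually_elim
      case (elim x)
      have "(\<lambda>n. \<bar>T k f x - T k (g n) x\<bar>) \<longlonglongrightarrow> \<bar>T k f x - T k f x\<bar>"
        unfolding T_def by (intro tendsto_intros g(2) elim)
      then show ?case by simp
    qed
  qed simp
  then have "\<forall>\<^sub>F n in sequentially. (LINT x|lborel. \<bar>T k f x - T k (g n) x\<bar>) < e / 2"
    using \<open>e > 0\<close> by (intro order_tendstoD(2)) auto
  then obtain n where n: "(LINT x|lborel. \<bar>T k f x - T k (g n) x\<bar>) < e / 2"
    unfolding eventually_sequentially by blast
  have "(LINT x|lborel. \<bar>f x - T k (g n) x\<bar>) \<le> (LINT x|lborel. \<bar>f x - T k f x\<bar> + \<bar>T k f x - T k (g n) x\<bar>)"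
    using f Tint[OF fm] Tint[OF gm] by (intro integral_mono) auto
  also have "\<dots> = (LINT x|lborel. \<bar>f x - T k f x\<bar>) + (LINT x|lborel. \<bar>T k f x - T k (g n) x\<bar>)"
    using f Tint[OF fm] Tint[OF gm] by (intro Bochner_Integration.integral_add) auto
  also have "\<dots> < e" using k n by simp
  finally show ?thesis using Tcont Tint[OF gm] by blast
qed

lemma lborel_translate:
  fixes g :: "'a::euclidean_space \<Rightarrow> 'b::{banach, second_countable_topology}"
  assumes [measurable]: "g \<in> borel_measurable borel"
  shows "(LINT y|lborel. g (y + x)) = (LINT y|lborel. g y)"
    and "integrable lborel (\<lambda>y. g (y + x)) \<longleftrightarrow> integrable lborel g"
proof -
  have "(LINT y|lborel. g y) = (LINT y|distr lborel borel ((+) x). g y)" by (simp add: lborel_distr_plus)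
  also have "\<dots> = (LINT y|lborel. g (x + y))" by (rule integral_distr) auto
  finally show "(LINT y|lborel. g (y + x)) = (LINT y|lborel. g y)" by (simp add: add.commute)
  have "integrable lborel g \<longleftrightarrow> integrable (distr lborel borel ((+) x)) g" by (simp add: lborel_distr_plus)
  also have "\<dots> \<longleftrightarrow> integrable lborel (\<lambda>y. g (x + y))" by (rule integrable_distr_eq) auto
  finally show "integrable lborel (\<lambda>y. g (y + x)) \<longleftrightarrow> integrable lborel g" by (simp add: add.commute)
qed

text \<open>The function \<open>\<gamma>\<close> is the gradient of the kernel. It enters through a
  quadratic remainder and a Lipschitz bound, so that a convolution can be differentiated by
  integrating an elementary inequality. Oddness of \<open>\<gamma>\<close> lets the kernel change
  sides in Fubini's theorem.\<close>

locale mollifier =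
  fixes \<rho> :: "'a::euclidean_space \<Rightarrow> real" and \<gamma> :: "'a \<Rightarrow> 'a" and \<delta> C :: real
  assumes \<delta>: "0 < \<delta>"
    and nonneg: "0 \<le> \<rho> z"
    and bound: "\<rho> z \<le> C" "norm (\<gamma> z) \<le> C"
    and supp: "\<delta> \<le> norm z \<Longrightarrow> \<rho> z = 0" "\<delta> \<le> norm z \<Longrightarrow> \<gamma> z = 0"
    and cont: "continuous_on UNIV \<rho>"
    and even: "\<rho> (- z) = \<rho> z" "\<gamma> (- z) = - \<gamma> z"
    and integral: "(LINT z|lborel. \<rho> z) = 1"
    and taylor: "norm h \<le> \<delta> \<Longrightarrow> \<bar>\<rho> (z + h) - \<rho> z - \<gamma> z \<bullet> h\<bar> \<le> C * (norm h)\<^sup>2"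
    and lip: "norm (\<gamma> z - \<gamma> z') \<le> C * norm (z - z')"

text \<open>The profile is \<open>q z = (max 0 (1 - (norm z)\<^sup>2))\<^sup>2\<close>. Its gradient
  \<open>p z = - (4 * m z) *\<^sub>R z\<close> is Lipschitz across the unit sphere since
  \<open>m\<close> vanishes there. Scaling by \<open>\<delta>\<close> and division by the integral
  do the rest.\<close>

lemma mollifier_exists:
  assumes "0 < \<delta>"
  shows "\<exists>(\<rho> :: 'a::euclidean_space \<Rightarrow> real) \<gamma> C. mollifier \<rho> \<gamma> \<delta> C"
proof -
  define m where "m z = max 0 (1 - (norm (z::'a))\<^sup>2)" for z
  define q where "q z = (m z)\<^sup>2" for z
  define p where "p z = - (4 * m z) *\<^sub>R z" for z
  have m_cont: "continuous_on UNIV m" unfolding m_def by (intro continuous_intros)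
  have m0: "m z = 0" if "1 \<le> norm z" for z
    using that power_mono[OF that, of 2] by (simp add: m_def)
  have m1: "0 \<le> m z" "m z \<le> 1" for z by (auto simp: m_def)
  have m_lip: "\<bar>m z - m z'\<bar> \<le> 2 * norm (z - z')" for z z'
  proof -
    have *: "m a - m b \<le> 2 * norm (a - b)" if ab: "norm a < 1" for a b
    proof -
      have d: "norm b - norm a \<le> norm (a - b)" by (metis norm_minus_commute norm_triangle_ineq2)
      \<comment> \<open>Capping \<open>norm b\<close> at 1 lets the difference of squares be
        factored also when \<open>b\<close> lies outside the unit ball.\<close>
      define c where "c = min 1 (norm b)"
      have c: "0 \<le> c" "c \<le> 1" "c \<le> norm b" by (auto simp: c_def)
      have "1 - c\<^sup>2 \<le> m b"
      proof (cases "norm b \<le> 1")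
        case False
        then show ?thesis using m1[of b] by (simp add: c_def)
      qed (auto simp: c_def m_def)
      then have "m a - m b \<le> c\<^sup>2 - (norm a)\<^sup>2" using ab power_le_one[of "norm a" 2] by (simp add: m_def)
      also have "\<dots> = (c - norm a) * (c + norm a)" by (simp add: power2_eq_square algebra_simps)
      also have "\<dots> \<le> norm (a - b) * 2"
      proof (cases "norm a \<le> c")
        case True
        then show ?thesis using c ab d by (intro mult_mono) auto
      next
        case False
        then have "(c - norm a) * (c + norm a) \<le> 0" using c by (intro mult_nonpos_nonneg) auto
        then show ?thesis by (rule order_trans) simp
      qed
      finally show ?thesis by simp
    qed
    have **: "m a - m b \<le> 2 * norm (a - b)" for a b
    proof (cases "norm a < 1")
      case False
      then show ?thesis using m0[of a] m1(1)[of b] order_trans[of "- m b" 0 "2 * norm (a - b)"] by simp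
    qed (rule *)
    show ?thesis using **[of z z'] **[of z' z] by (simp add: norm_minus_commute abs_le_iff)
  qed
  have p_lip: "norm (p z - p z') \<le> 12 * norm (z - z')" for z z'
  proof -
    have *: "norm (m a *\<^sub>R a - m b *\<^sub>R b) \<le> 3 * norm (a - b)" if "norm a \<le> 1" for a b
    proof -
      have "m a *\<^sub>R a - m b *\<^sub>R b = (m a - m b) *\<^sub>R a + m b *\<^sub>R (a - b)" by (simp add: algebra_simps)
      also have "norm \<dots> \<le> \<bar>m a - m b\<bar> * norm a + m b * norm (a - b)"
        using m1[of b] by (metis norm_triangle_ineq norm_scaleR abs_of_nonneg)
      also have "\<dots> \<le> (2 * norm (a - b)) * 1 + 1 * norm (a - b)"
        using m_lip[of a b] m1[of b] that by (intro add_mono mult_mono) auto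
      finally show ?thesis by simp
    qed
    have "norm (m z *\<^sub>R z - m z' *\<^sub>R z') \<le> 3 * norm (z - z')"
    proof (cases "norm z \<le> 1")
      case False
      show ?thesis
      proof (cases "norm z' \<le> 1")
        case True
        then show ?thesis using *[of z' z] by (simp add: norm_minus_commute)
      next
        case F: False
        then show ?thesis using m0[of z] m0[of z'] False by simp
      qed
    qed (rule *)
    moreover have "p z - p z' = (- 4) *\<^sub>R (m z *\<^sub>R z - m z' *\<^sub>R z')" by (simp add: p_def algebra_simps)
    then have "norm (p z - p z') = 4 * norm (m z *\<^sub>R z - m z' *\<^sub>R z')" by simp
    ultimately show ?thesis by simp
  qed
  \<comment> \<open>For \<open>norm z \<le> 2\<close> and \<open>norm h \<le> 1\<close> the quantity
    \<open>1 - (norm z)\<^sup>2\<close> changes by at most \<open>5 * norm h\<close>. The remainder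
    of the squared positive part contributes 25, and the quadratic term of that change contributes
    2; for larger \<open>z\<close> everything vanishes.\<close>
  have q_taylor: "\<bar>q (z + h) - q z - p z \<bullet> h\<bar> \<le> 27 * (norm h)\<^sup>2" if h: "norm h \<le> 1" for z h
  proof (cases "norm z \<le> 2")
    case False
    have "1 \<le> norm (z + h)" using False h norm_triangle_ineq4[of "z + h" h] by simp
    then show ?thesis using m0[of z] m0[of "z + h"] False by (simp add: q_def p_def)
  next
    case True
    define s where "s = 1 - (norm z)\<^sup>2"
    define t where "t = 1 - (norm (z + h))\<^sup>2"
    have ts: "t - s = - (2 * (z \<bullet> h) + (norm h)\<^sup>2)"
      by (simp add: s_def t_def power2_norm_eq_inner inner_add inner_commute)
    have sq: "\<bar>(max 0 t)\<^sup>2 - (max 0 s)\<^sup>2 - 2 * max 0 s * (t - s)\<bar> \<le> (t - s)\<^sup>2"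
    proof -
      consider "0 \<le> s" "0 \<le> t" | "0 \<le> s" "t < 0" | "s < 0" "0 \<le> t" | "s < 0" "t < 0" by linarith
      then show ?thesis
      proof cases
        case 1
        then have "(max 0 t)\<^sup>2 - (max 0 s)\<^sup>2 - 2 * max 0 s * (t - s) = (t - s)\<^sup>2"
          by (simp add: power2_eq_square algebra_simps)
        then show ?thesis by simp
      next
        case 2
        have "s * t \<le> 0" using 2 by (simp add: mult_nonneg_nonpos)
        moreover have "0 \<le> t\<^sup>2" "0 \<le> s\<^sup>2" by simp_all
        ultimately have "\<bar>s\<^sup>2 - 2 * (s * t)\<bar> \<le> t\<^sup>2 + s\<^sup>2 - 2 * (s * t)" unfolding abs_le_iff by linarith
        then show ?thesis using 2 by (simp add: power2_eq_square algebra_simps)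
      next
        case 3
        have "s * t \<le> 0" using 3 by (simp add: mult_nonpos_nonneg)
        then show ?thesis using 3 by (simp add: power2_eq_square algebra_simps)
      qed simp
    qed
    have zh: "\<bar>z \<bullet> h\<bar> \<le> 2 * norm h"
      using Cauchy_Schwarz_ineq2[of z h] True mult_right_mono[of "norm z" 2 "norm h"] by simp
    have h2: "(norm h)\<^sup>2 \<le> norm h" using h mult_left_mono[of "norm h" 1 "norm h"] by (simp add: power2_eq_square)
    have "\<bar>t - s\<bar> \<le> 5 * norm h" 
      using zh h2 norm_ge_zero[of h] zero_le_power2[of "norm h"] unfolding ts abs_le_iff by linarith
    then have ts2: "(t - s)\<^sup>2 \<le> 25 * (norm h)\<^sup>2"
      using power_mono[of "\<bar>t - s\<bar>" "5 * norm h" 2] by (simp add: power_mult_distrib)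
    have ms: "m z = max 0 s" "m (z + h) = max 0 t" by (simp_all add: m_def s_def t_def)
    have "q (z + h) - q z - p z \<bullet> h
        = ((max 0 t)\<^sup>2 - (max 0 s)\<^sup>2 - 2 * max 0 s * (t - s)) - 2 * max 0 s * (norm h)\<^sup>2"
      unfolding q_def p_def ms ts by (simp add: algebra_simps)
    also have "\<bar>\<dots>\<bar> \<le> (t - s)\<^sup>2 + 2 * (norm h)\<^sup>2"
    proof -
      have "0 \<le> max 0 s * (norm h)\<^sup>2" "max 0 s * (norm h)\<^sup>2 \<le> 1 * (norm h)\<^sup>2"
        using m1[of z] mult_right_mono[of "max 0 s" 1 "(norm h)\<^sup>2"] unfolding ms by auto
      then show ?thesis using sq by linarith
    qed
    finally show ?thesis using ts2 by linarith
  qed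
  define b where "b z = q (z /\<^sub>R \<delta>)" for z
  have b_cont: "continuous_on UNIV b" unfolding b_def q_def
    by (intro continuous_intros continuous_on_compose2[OF m_cont]) auto
  then have [measurable]: "b \<in> borel_measurable borel" by (rule borel_measurable_continuous_onI)
  have b01: "0 \<le> b z" "b z \<le> 1" for z using m1 by (auto simp: b_def q_def power_le_one)
  have b0: "b z = 0" if "\<delta> \<le> norm z" for z
    using that \<open>0 < \<delta>\<close> m0[of "z /\<^sub>R \<delta>"] by (simp add: b_def q_def field_simps)
  have b_int: "integrable lborel b"
  proof (rule Bochner_Integration.integrable_bound[OF integrable_cball_indicator[of 1 \<delta>]])
    show "AE z in lborel. norm (b z) \<le> norm (1 * indicator (cball 0 \<delta>) z :: real)"
      using b01 b0 by (intro AE_I2) (auto simp: indicator_def)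
  qed simp
  define c where "c = (LINT z|lborel. b z)"
  have "0 < c"
  proof -
    have fin: "integrable lborel (\<lambda>z::'a. 9/16 * indicator (cball 0 (\<delta>/2)) z :: real)" by (rule integrable_cball_indicator)
    \<comment> \<open>On the half ball the profile is at least the square of \<open>1 - 1/4\<close>,
      so the normalising integral is positive.\<close>
    have "9/16 * indicator (cball 0 (\<delta>/2)) z \<le> b z" for z
    proof (cases "norm z \<le> \<delta> / 2")
      case True
      then have "norm (z /\<^sub>R \<delta>) \<le> 1 / 2" using \<open>0 < \<delta>\<close> by (simp add: field_simps)
      then have "(norm (z /\<^sub>R \<delta>))\<^sup>2 \<le> 1 / 4" using power_mono[of "norm (z /\<^sub>R \<delta>)" "1/2" 2] by (simp add: power2_eq_square)
      then have "3 / 4 \<le> m (z /\<^sub>R \<delta>)" by (simp add: m_def)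
      then show ?thesis using True power_mono[of "3/4" "m (z /\<^sub>R \<delta>)" 2] by (simp add: b_def q_def power2_eq_square)
    qed (use b01 in simp)
    then have "(LINT z|lborel. 9/16 * indicator (cball (0::'a) (\<delta>/2)) z) \<le> c"
      unfolding c_def by (intro integral_mono fin b_int)
    moreover have "0 < measure lborel (cball (0::'a) (\<delta>/2))" using \<open>0 < \<delta>\<close> content_cball_pos[of "\<delta>/2" "0::'a"] by simp
    moreover have "(LINT z|lborel. 9/16 * indicator (cball (0::'a) (\<delta>/2)) z) = 9/16 * measure lborel (cball (0::'a) (\<delta>/2))"
      by simp
    ultimately show ?thesis by linarith
  qed
  define C where "C = max (1 / c) (max (12 / (c * \<delta>)) (max (12 / (c * \<delta>\<^sup>2)) (27 / (c * \<delta>\<^sup>2))))"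
  have C: "1 / c \<le> C" "12 / (c * \<delta>) \<le> C" "12 / (c * \<delta>\<^sup>2) \<le> C" "27 / (c * \<delta>\<^sup>2) \<le> C"
    by (auto simp: C_def)
  have "mollifier (\<lambda>z. b z / c) (\<lambda>z. p (z /\<^sub>R \<delta>) /\<^sub>R (c * \<delta>)) \<delta> C"
  proof
    fix z z' h :: 'a
    show "0 < \<delta>" by fact
    show "0 \<le> b z / c" using b01 \<open>0 < c\<close> by simp
    have "b z / c \<le> 1 / c" using b01 \<open>0 < c\<close> by (intro divide_right_mono) auto
    then show "b z / c \<le> C" using C(1) by simp
    show "b z / c = 0" if "\<delta> \<le> norm z" using b0[OF that] by simp
    show *: "p (z /\<^sub>R \<delta>) /\<^sub>R (c * \<delta>) = 0" if "\<delta> \<le> norm z"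
      using that \<open>0 < \<delta>\<close> m0[of "z /\<^sub>R \<delta>"] by (simp add: p_def field_simps)
    show "continuous_on UNIV (\<lambda>z. b z / c)" using \<open>0 < c\<close> by (intro continuous_intros b_cont) auto
    show "b (- z) / c = b z / c" "p (- z /\<^sub>R \<delta>) /\<^sub>R (c * \<delta>) = - (p (z /\<^sub>R \<delta>) /\<^sub>R (c * \<delta>))"
      by (simp_all add: b_def q_def p_def m_def)
    show "(LINT z|lborel. b z / c) = 1" using \<open>0 < c\<close> by (simp add: c_def)
    show lip: "norm (p (z /\<^sub>R \<delta>) /\<^sub>R (c * \<delta>) - p (z' /\<^sub>R \<delta>) /\<^sub>R (c * \<delta>)) \<le> C * norm (z - z')" for z z'
    proof -
      have "norm (p (z /\<^sub>R \<delta>) /\<^sub>R (c * \<delta>) - p (z' /\<^sub>R \<delta>) /\<^sub>R (c * \<delta>)) = norm (p (z /\<^sub>R \<delta>) - p (z' /\<^sub>R \<delta>)) / (c * \<delta>)"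
        using \<open>0 < c\<close> \<open>0 < \<delta>\<close> by (simp add: scaleR_diff_right[symmetric] divide_inverse_commute abs_mult del: scaleR_scaleR)
      also have "\<dots> \<le> (12 * norm (z /\<^sub>R \<delta> - z' /\<^sub>R \<delta>)) / (c * \<delta>)"
        using p_lip \<open>0 < c\<close> \<open>0 < \<delta>\<close> by (intro divide_right_mono) auto
      also have "norm (z /\<^sub>R \<delta> - z' /\<^sub>R \<delta>) = norm (z - z') / \<delta>"
        using \<open>0 < \<delta>\<close> by (simp add: scaleR_diff_right[symmetric] divide_inverse_commute)
      also have "12 * (norm (z - z') / \<delta>) / (c * \<delta>) = 12 / (c * \<delta>\<^sup>2) * norm (z - z')" by (simp add: power2_eq_square)
      also have "\<dots> \<le> C * norm (z - z')" using C by (intro mult_right_mono) auto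
      finally show ?thesis .
    qed
    show "norm (p (z /\<^sub>R \<delta>) /\<^sub>R (c * \<delta>)) \<le> C"
    proof (cases "norm z \<le> \<delta>")
      case True
      have "norm (p (z /\<^sub>R \<delta>)) \<le> 12 * norm (z /\<^sub>R \<delta>)" using p_lip[of "z /\<^sub>R \<delta>" 0] by (simp add: p_def)
      also have "\<dots> \<le> 12" using True \<open>0 < \<delta>\<close> by (simp add: field_simps)
      finally have "norm (p (z /\<^sub>R \<delta>)) / (c * \<delta>) \<le> 12 / (c * \<delta>)" using \<open>0 < c\<close> \<open>0 < \<delta>\<close> by (intro divide_right_mono) auto
      moreover have "norm (p (z /\<^sub>R \<delta>) /\<^sub>R (c * \<delta>)) = norm (p (z /\<^sub>R \<delta>)) / (c * \<delta>)"
        using \<open>0 < c\<close> \<open>0 < \<delta>\<close> by (simp add: divide_inverse_commute abs_mult)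
      ultimately show ?thesis using C(2) by linarith
    next
      case False
      have "0 \<le> C" using C(1) \<open>0 < c\<close> order_trans[of 0 "1 / c" C] by simp
      then show ?thesis using *[OF less_imp_le] False by (metis norm_zero not_le)
    qed
    assume h: "norm h \<le> \<delta>"
    have "b (z + h) / c - b z / c - (p (z /\<^sub>R \<delta>) /\<^sub>R (c * \<delta>)) \<bullet> h
        = (q (z /\<^sub>R \<delta> + h /\<^sub>R \<delta>) - q (z /\<^sub>R \<delta>) - p (z /\<^sub>R \<delta>) \<bullet> (h /\<^sub>R \<delta>)) / c"
      by (simp add: b_def scaleR_add_right divide_inverse right_diff_distrib left_diff_distrib mult_ac)
    then have "\<bar>b (z + h) / c - b z / c - (p (z /\<^sub>R \<delta>) /\<^sub>R (c * \<delta>)) \<bullet> h\<bar>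
        = \<bar>q (z /\<^sub>R \<delta> + h /\<^sub>R \<delta>) - q (z /\<^sub>R \<delta>) - p (z /\<^sub>R \<delta>) \<bullet> (h /\<^sub>R \<delta>)\<bar> / c"
      using \<open>0 < c\<close> by (simp only: abs_divide abs_of_pos)
    also have "\<dots> \<le> (27 * (norm (h /\<^sub>R \<delta>))\<^sup>2) / c"
      using h \<open>0 < \<delta>\<close> \<open>0 < c\<close> by (intro divide_right_mono q_taylor) (auto simp: field_simps)
    also have "\<dots> = 27 / (c * \<delta>\<^sup>2) * (norm h)\<^sup>2" using \<open>0 < \<delta>\<close> by (simp add: power_mult_distrib field_simps)
    also have "\<dots> \<le> C * (norm h)\<^sup>2" using C by (intro mult_right_mono) auto
    finally show "\<bar>b (z + h) / c - b z / c - (p (z /\<^sub>R \<delta>) /\<^sub>R (c * \<delta>)) \<bullet> h\<bar> \<le> C * (norm h)\<^sup>2" .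
  qed
  then show ?thesis by blast
qed

section \<open>Convolution with a mollifier and its derivative\<close>

lemma norm_integral_le:
  fixes f :: "'a \<Rightarrow> 'b::{banach, second_countable_topology}"
  assumes "integrable M f" "integrable M g" "\<And>x. norm (f x) \<le> g x"
  shows "norm (integral\<^sup>L M f) \<le> integral\<^sup>L M g"
  by (rule order_trans[OF integral_norm_bound integral_mono]) (use assms in auto)

context mollifier
begin

lemma C_nonneg: "0 \<le> C" using bound(2)[of 0] norm_ge_zero[of "\<gamma> 0"] by linarith

lemma continuous_gamma: "continuous_on UNIV \<gamma>"
proof -
  have "C-lipschitz_on UNIV \<gamma>" using lip C_nonneg by (auto intro!: lipschitz_onI simp: dist_norm)
  then show ?thesis by (rule lipschitz_on_continuous_on)
qed

lemma measurable_kernels [measurable]: "\<rho> \<in> borel_measurable borel" "\<gamma> \<in> borel_measurable borel"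
  using cont continuous_gamma by (simp_all add: borel_measurable_continuous_onI)

lemma integrable_kernel:
  fixes f :: "'a \<Rightarrow> 'b::euclidean_space"
  assumes f: "integrable lborel f" and [measurable]: "k \<in> borel_measurable borel" and k: "\<And>z. \<bar>k z\<bar> \<le> B"
  shows "integrable lborel (\<lambda>y. k (x - y) *\<^sub>R f y)"
proof (rule Bochner_Integration.integrable_bound[of _ "\<lambda>y. B * norm (f y)"])
  have [measurable]: "f \<in> borel_measurable borel" using borel_measurable_integrable[OF f] by simp
  show "(\<lambda>y. k (x - y) *\<^sub>R f y) \<in> borel_measurable lborel" by measurable
  have "0 \<le> B" using k[of 0] abs_ge_zero[of "k 0"] by linarith
  then show "AE y in lborel. norm (k (x - y) *\<^sub>R f y) \<le> norm (B * norm (f y))"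
    by (intro AE_I2) (auto simp: abs_mult intro!: mult_right_mono k)
qed (use f in simp)

definition conv :: "('a \<Rightarrow> 'b::euclidean_space) \<Rightarrow> 'a \<Rightarrow> 'b" where
  "conv f x = (LINT y|lborel. \<rho> (x - y) *\<^sub>R f y)"

definition dconv :: "('a \<Rightarrow> 'b::euclidean_space) \<Rightarrow> 'a \<Rightarrow> 'a \<Rightarrow> 'b" where
  "dconv f x h = (LINT y|lborel. (\<gamma> (x - y) \<bullet> h) *\<^sub>R f y)"

lemma rho_abs: "\<bar>\<rho> z\<bar> \<le> C" using nonneg[of z] bound(1)[of z] by simp

lemma gamma_inner_abs: "\<bar>\<gamma> z \<bullet> h\<bar> \<le> C * norm h"
  using Cauchy_Schwarz_ineq2[of "\<gamma> z" h] mult_right_mono[OF bound(2)[of z], of "norm h"] by simp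

context
  fixes f :: "'a \<Rightarrow> 'b::euclidean_space"
  assumes f: "integrable lborel f"
begin

lemma integrable_rho: "integrable lborel (\<lambda>y. \<rho> (x - y) *\<^sub>R f y)"
  by (rule integrable_kernel[OF f _ rho_abs]) measurable

lemma integrable_gamma: "integrable lborel (\<lambda>y. (\<gamma> (x - y) \<bullet> h) *\<^sub>R f y)"
  by (rule integrable_kernel[OF f, where k = "\<lambda>z. \<gamma> z \<bullet> h", OF _ gamma_inner_abs]) measurable

lemma bounded_linear_dconv: "bounded_linear (dconv f x)"
proof -
  have "linear (dconv f x)"
    by (rule linearI) (simp_all add: dconv_def inner_add_right scaleR_add_left integrable_gamma
        scaleR_scaleR[symmetric] del: scaleR_scaleR)
  then show ?thesis by (simp add: linear_conv_bounded_linear)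
qed

text \<open>The Taylor bound of the kernel, integrated against \<open>norm (f z)\<close>, is a
  remainder of second order; integrability of \<open>f\<close> is the only regularity
  involved.\<close>

lemma conv_has_derivative: "(conv f has_derivative dconv f x) (at x)"
  unfolding has_derivative_at_alt
proof (intro conjI bounded_linear_dconv allI impI)
  fix e :: real assume "e > 0"
  define I where "I = C * (LINT y|lborel. norm (f y))"
  have "I \<ge> 0" using C_nonneg by (simp add: I_def)
  define d where "d = min \<delta> (e / (I + 1))"
  have "d > 0" using \<delta> \<open>e > 0\<close> \<open>I \<ge> 0\<close> by (simp add: d_def)
  have "norm (conv f y - conv f x - dconv f x (y - x)) \<le> e * norm (y - x)" if y: "norm (y - x) < d" for y
  proof -
    define h where "h = y - x"
    have h: "norm h \<le> \<delta>" "norm h * (I + 1) \<le> e"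
      using y \<open>I \<ge> 0\<close> by (auto simp: h_def d_def pos_less_divide_eq)
    have "conv f y - conv f x - dconv f x h
        = (LINT z|lborel. (\<rho> (x - z + h) - \<rho> (x - z) - \<gamma> (x - z) \<bullet> h) *\<^sub>R f z)"
      using integrable_rho[of y] integrable_rho[of x] integrable_gamma[of x h]
      by (simp add: conv_def dconv_def scaleR_diff_left h_def)
    also have "norm \<dots> \<le> (LINT z|lborel. (C * (norm h)\<^sup>2) * norm (f z))"
    proof (rule norm_integral_le)
      show "integrable lborel (\<lambda>z. (\<rho> (x - z + h) - \<rho> (x - z) - \<gamma> (x - z) \<bullet> h) *\<^sub>R f z)"
        using integrable_rho[of y] integrable_rho[of x] integrable_gamma[of x h]
        by (simp add: scaleR_diff_left h_def)
      show "integrable lborel (\<lambda>z. (C * (norm h)\<^sup>2) * norm (f z))" using f by simp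
      show "norm ((\<rho> (x - z + h) - \<rho> (x - z) - \<gamma> (x - z) \<bullet> h) *\<^sub>R f z) \<le> (C * (norm h)\<^sup>2) * norm (f z)" for z
        using taylor[OF h(1), of "x - z"] by (simp add: mult_right_mono)
    qed
    also have "\<dots> = norm h * (norm h * I)" by (simp add: I_def power2_eq_square)
    also have "\<dots> \<le> norm h * e"
      using h(2) \<open>I \<ge> 0\<close> by (intro mult_left_mono) (auto simp: algebra_simps intro: order_trans[rotated])
    finally show ?thesis by (simp add: h_def mult.commute)
  qed
  then show "\<exists>d>0. \<forall>y. norm (y - x) < d \<longrightarrow> norm (conv f y - conv f x - dconv f x (y - x)) \<le> e * norm (y - x)"
    using \<open>d > 0\<close> by blast
qed

lemma dconv_lipschitz:
  "norm (dconv f x h - dconv f x' h) \<le> C * (LINT y|lborel. norm (f y)) * norm (x - x') * norm h"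
proof -
  have "dconv f x h - dconv f x' h = (LINT y|lborel. ((\<gamma> (x - y) - \<gamma> (x' - y)) \<bullet> h) *\<^sub>R f y)"
    using integrable_gamma[of x h] integrable_gamma[of x' h] by (simp add: dconv_def inner_diff_left scaleR_diff_left)
  also have "norm \<dots> \<le> (LINT y|lborel. (C * norm (x - x') * norm h) * norm (f y))"
  proof (rule norm_integral_le)
    show "integrable lborel (\<lambda>y. ((\<gamma> (x - y) - \<gamma> (x' - y)) \<bullet> h) *\<^sub>R f y)"
      using integrable_gamma[of x h] integrable_gamma[of x' h] by (simp add: inner_diff_left scaleR_diff_left)
    show "integrable lborel (\<lambda>y. (C * norm (x - x') * norm h) * norm (f y))" using f by simp
    fix y
    have "\<bar>(\<gamma> (x - y) - \<gamma> (x' - y)) \<bullet> h\<bar> \<le> norm (\<gamma> (x - y) - \<gamma> (x' - y)) * norm h" by (rule Cauchy_Schwarz_ineq2)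
    also have "\<dots> \<le> C * norm (x - x') * norm h" using lip[of "x - y" "x' - y"] by (intro mult_right_mono) auto
    finally show "norm (((\<gamma> (x - y) - \<gamma> (x' - y)) \<bullet> h) *\<^sub>R f y) \<le> (C * norm (x - x') * norm h) * norm (f y)"
      by (simp add: mult_right_mono)
  qed
  also have "\<dots> = C * (LINT y|lborel. norm (f y)) * norm (x - x') * norm h" by simp
  finally show ?thesis .
qed

lemma conv_C1: "\<exists>\<phi>'. (\<forall>x. (conv f has_derivative blinfun_apply (\<phi>' x)) (at x)) \<and> continuous_on UNIV \<phi>'"
proof (intro exI[of _ "\<lambda>x. Blinfun (dconv f x)"] conjI allI)
  have app: "blinfun_apply (Blinfun (dconv f x)) = dconv f x" for x
    by (rule bounded_linear_Blinfun_apply[OF bounded_linear_dconv])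
  show "(conv f has_derivative blinfun_apply (Blinfun (dconv f x))) (at x)" for x
    unfolding app by (rule conv_has_derivative)
  define L where "L = C * (LINT y|lborel. norm (f y))"
  have "L \<ge> 0" using C_nonneg by (simp add: L_def)
  have "L-lipschitz_on UNIV (\<lambda>x. Blinfun (dconv f x))"
  proof (rule lipschitz_onI[OF _ \<open>L \<ge> 0\<close>])
    fix x y
    have "norm (Blinfun (dconv f x) - Blinfun (dconv f y)) \<le> L * norm (x - y)"
      by (rule norm_blinfun_bound)
        (use dconv_lipschitz \<open>L \<ge> 0\<close> in \<open>auto simp: blinfun.diff_left app L_def\<close>)
    then show "dist (Blinfun (dconv f x)) (Blinfun (dconv f y)) \<le> L * dist x y" by (simp add: dist_norm)
  qed
  then show "continuous_on UNIV (\<lambda>x. Blinfun (dconv f x))" by (rule lipschitz_on_continuous_on)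
qed

end

lemma conv_eq_0:
  assumes "\<And>y. dist x y < \<delta> \<Longrightarrow> f y = 0"
  shows "conv f x = 0" "dconv f x h = 0"
proof -
  have z: "\<rho> (x - y) *\<^sub>R f y = 0" "(\<gamma> (x - y) \<bullet> h) *\<^sub>R f y = 0" for y
    using assms[of y] supp[of "x - y"] by (cases "dist x y < \<delta>"; auto simp: dist_norm)+
  then show "conv f x = 0" "dconv f x h = 0" 
    unfolding conv_def dconv_def z by simp_all
qed

lemma integral_rho: "integrable lborel (\<lambda>y. \<rho> (x - y))" "(LINT y|lborel. \<rho> (x - y)) = 1"
proof -
  have *: "\<rho> (x - y) = \<rho> (y + - x)" for y using even(1)[of "y - x"] by simp
  have "integrable lborel \<rho>" using integral not_integrable_integral_eq by fastforce
  then show "integrable lborel (\<lambda>y. \<rho> (x - y))" "(LINT y|lborel. \<rho> (x - y)) = 1"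
    unfolding * using lborel_translate[OF measurable_kernels(1), of "- x"] integral by simp_all
qed

text \<open>Averages against a probability density stay in the unit ball, which keeps mollified
  fields admissible in \<open>TV\<close>.\<close>

lemma norm_conv_le:
  assumes f: "integrable lborel f" and "\<And>y. norm (f y) \<le> 1"
  shows "norm (conv f x) \<le> 1"
proof -
  have "norm (conv f x) \<le> (LINT y|lborel. \<rho> (x - y))"
    unfolding conv_def
  proof (rule norm_integral_le[OF integrable_rho[OF f] integral_rho(1)])
    show "norm (\<rho> (x - y) *\<^sub>R f y) \<le> \<rho> (x - y)" for y
      using nonneg[of "x - y"] assms(2)[of y] mult_left_mono[of "norm (f y)" 1 "\<rho> (x - y)"] by simp
  qed
  then show ?thesis by (simp add: integral_rho(2))
qed

definition grad_conv :: "('a \<Rightarrow> real) \<Rightarrow> 'a \<Rightarrow> 'a" where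
  "grad_conv f x = (LINT y|lborel. f y *\<^sub>R \<gamma> (x - y))"

lemma integrable_grad:
  assumes f: "integrable lborel f" shows "integrable lborel (\<lambda>y. f y *\<^sub>R \<gamma> (x - y))"
proof (rule Bochner_Integration.integrable_bound[of _ "\<lambda>y. C * \<bar>f y\<bar>"])
  have [measurable]: "f \<in> borel_measurable borel" using borel_measurable_integrable[OF f] by simp
  show "(\<lambda>y. f y *\<^sub>R \<gamma> (x - y)) \<in> borel_measurable lborel" by measurable
  show "AE y in lborel. norm (f y *\<^sub>R \<gamma> (x - y)) \<le> norm (C * \<bar>f y\<bar>)"
    using mult_left_mono[OF bound(2) abs_ge_zero] C_nonneg by (intro AE_I2) (simp add: abs_mult mult.commute[of C])
qed (use f in simp)

lemma dconv_grad:
  assumes "integrable lborel f" shows "dconv f x h = grad_conv f x \<bullet> h"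
proof -
  have "grad_conv f x \<bullet> h = (LINT y|lborel. (f y *\<^sub>R \<gamma> (x - y)) \<bullet> h)"
    unfolding grad_conv_def by (rule integral_inner_left[symmetric]) (rule integrable_grad[OF assms])
  then show ?thesis by (simp add: dconv_def mult.commute)
qed

lemma continuous_grad_conv:
  assumes f: "integrable lborel f" shows "continuous_on UNIV (grad_conv f)"
proof -
  define L where "L = C * (LINT y|lborel. norm (f y))"
  have "L \<ge> 0" using C_nonneg by (simp add: L_def)
  have "norm (grad_conv f x - grad_conv f x') \<le> L * norm (x - x')" for x x'
  proof -
    define v where "v = grad_conv f x - grad_conv f x'"
    have "(norm v)\<^sup>2 = dconv f x v - dconv f x' v"
      by (simp only: dconv_grad[OF f] power2_norm_eq_inner inner_diff_left[symmetric] v_def)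
    also have "\<dots> \<le> norm (dconv f x v - dconv f x' v)" by simp
    also have "\<dots> \<le> L * norm (x - x') * norm v"
      unfolding L_def by (rule dconv_lipschitz[OF f])
    finally show ?thesis using \<open>L \<ge> 0\<close> unfolding v_def[symmetric]
      by (cases "norm v = 0") (auto simp: power2_eq_square)
  qed
  then have "L-lipschitz_on UNIV (grad_conv f)" using \<open>L \<ge> 0\<close> by (auto intro!: lipschitz_onI simp: dist_norm)
  then show ?thesis by (rule lipschitz_on_continuous_on)
qed

text \<open>Makes translates of the kernel available as test fields.\<close>

lemma rho_has_derivative: "(\<rho> has_derivative (\<lambda>h. \<gamma> z \<bullet> h)) (at z)"
  unfolding has_derivative_at_alt
proof (intro conjI bounded_linear_inner_right allI impI)
  fix e :: real assume "e > 0"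
  define d where "d = min \<delta> (e / (C + 1))"
  have "d > 0" using \<delta> \<open>e > 0\<close> C_nonneg by (simp add: d_def)
  have "norm (\<rho> y - \<rho> z - \<gamma> z \<bullet> (y - z)) \<le> e * norm (y - z)" if y: "norm (y - z) < d" for y
  proof -
    have "norm (y - z) * (C + 1) \<le> e"
      using y C_nonneg by (auto simp: d_def pos_less_divide_eq)
    then have h: "C * norm (y - z) \<le> e" 
      using norm_ge_zero[of "y - z"] unfolding distrib_left mult.commute[of C] by linarith
    have "norm (\<rho> y - \<rho> z - \<gamma> z \<bullet> (y - z)) \<le> C * (norm (y - z))\<^sup>2"
      using taylor[of "y - z" z] y by (simp add: d_def)
    also have "\<dots> = C * norm (y - z) * norm (y - z)" by (simp add: power2_eq_square)
    also have "\<dots> \<le> e * norm (y - z)" using h by (intro mult_right_mono) auto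
    finally show ?thesis .
  qed
  then show "\<exists>d>0. \<forall>y. norm (y - z) < d \<longrightarrow> norm (\<rho> y - \<rho> z - \<gamma> z \<bullet> (y - z)) \<le> e * norm (y - z)"
    using \<open>d > 0\<close> by blast
qed

text \<open>Young's inequality for a kernel of mass one, by Tonelli's theorem and evenness of the
  kernel.\<close>

lemma nn_integral_conv_le:
  assumes h: "integrable lborel h"
  shows "(\<integral>\<^sup>+x. ennreal \<bar>conv h x\<bar> \<partial>lborel) \<le> (\<integral>\<^sup>+x. ennreal \<bar>h x\<bar> \<partial>lborel)"
proof -
  have [measurable]: "h \<in> borel_measurable borel" using borel_measurable_integrable[OF h] by simp
  have "(\<integral>\<^sup>+x. ennreal \<bar>conv h x\<bar> \<partial>lborel) \<le> (\<integral>\<^sup>+x. (\<integral>\<^sup>+y. ennreal (\<rho> (x - y)) * ennreal \<bar>h y\<bar> \<partial>lborel) \<partial>lborel)"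
  proof (rule nn_integral_mono)
    fix x
    have "ennreal \<bar>conv h x\<bar> \<le> (\<integral>\<^sup>+y. ennreal (norm (\<rho> (x - y) *\<^sub>R h y)) \<partial>lborel)"
      unfolding conv_def real_norm_def[symmetric] by (rule integral_norm_bound_ennreal[OF integrable_rho[OF h]])
    then show "ennreal \<bar>conv h x\<bar> \<le> (\<integral>\<^sup>+y. ennreal (\<rho> (x - y)) * ennreal \<bar>h y\<bar> \<partial>lborel)"
      using nonneg by (simp add: abs_mult ennreal_mult)
  qed
  also have "\<dots> = (\<integral>\<^sup>+y. (\<integral>\<^sup>+x. ennreal (\<rho> (x - y)) * ennreal \<bar>h y\<bar> \<partial>lborel) \<partial>lborel)"
    by (rule lborel_pair.Fubini') measurable
  also have "\<dots> = (\<integral>\<^sup>+y. ennreal \<bar>h y\<bar> \<partial>lborel)"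
  proof (rule nn_integral_cong)
    fix y
    have "\<rho> (x - y) = \<rho> (y - x)" for x using even(1)[of "y - x"] by simp
    then have "(\<integral>\<^sup>+x. ennreal (\<rho> (x - y)) \<partial>lborel) = ennreal (LINT x|lborel. \<rho> (y - x))"
      using nonneg integral_rho(1)[of y] by (simp only: nn_integral_eq_integral AE_I2)
    then show "(\<integral>\<^sup>+x. ennreal (\<rho> (x - y)) * ennreal \<bar>h y\<bar> \<partial>lborel) = ennreal \<bar>h y\<bar>"
      by (subst nn_integral_multc) (auto simp: integral_rho(2))
  qed
  finally show ?thesis .
qed

end

section \<open>Mollified fields as test fields for the total variation\<close>

lemma conv_in_C1c:
  fixes \<psi> :: "real ^ 'n \<Rightarrow> real ^ 'n"
  assumes M: "mollifier \<rho> \<gamma> \<delta> C" and \<psi>: "integrable lborel \<psi>"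
    and K: "compact K" "K \<subseteq> U" "\<And>x. \<psi> x \<noteq> 0 \<Longrightarrow> cball x \<delta> \<subseteq> K"
  shows "mollifier.conv \<rho> \<psi> \<in> C1c U"
proof -
  interpret mollifier \<rho> \<gamma> \<delta> C by fact
  have "conv \<psi> x = 0" if "x \<notin> K" for x
  proof (rule conv_eq_0(1))
    fix y assume "dist x y < \<delta>"
    then have "x \<in> cball y \<delta>" by (simp add: dist_commute)
    then show "\<psi> y = 0" using K(3) that by blast
  qed
  then have "{x. conv \<psi> x \<noteq> 0} \<subseteq> K" by blast
  then have "closure {x. conv \<psi> x \<noteq> 0} \<subseteq> K" by (rule closure_minimal) (use K(1) compact_imp_closed in blast)
  moreover have "compact (closure {x. conv \<psi> x \<noteq> 0})"
    using calculation K(1) by (metis closed_closure compact_Int_closed inf.absorb_iff2)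
  ultimately show ?thesis using conv_C1[OF \<psi>] K(2) by (auto simp: C1c_def)
qed

lemma divergence_conv:
  fixes \<psi> :: "real ^ 'n \<Rightarrow> real ^ 'n"
  assumes M: "mollifier \<rho> \<gamma> \<delta> C" and \<psi>: "integrable lborel \<psi>"
  shows "divergence (mollifier.conv \<rho> \<psi>) x = (LINT y|lborel. \<gamma> (x - y) \<bullet> \<psi> y)"
proof -
  interpret mollifier \<rho> \<gamma> \<delta> C by fact
  have fd: "frechet_derivative (conv \<psi>) (at x) = dconv \<psi> x"
    using frechet_derivative_at[OF conv_has_derivative[OF \<psi>]] by simp
  have nth: "dconv \<psi> x h $ i = (LINT y|lborel. (\<gamma> (x - y) \<bullet> h) * \<psi> y $ i)" for h i
    unfolding dconv_def
    using integral_bounded_linear[OF bounded_linear_vec_nth integrable_gamma[OF \<psi>, of x h], of i] by simp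
  have int: "integrable lborel (\<lambda>y. (\<gamma> (x - y) \<bullet> h) * \<psi> y $ i)" for h i
    using integrable_bounded_linear[OF bounded_linear_vec_nth integrable_gamma[OF \<psi>, of x h], of i] by simp
  have "divergence (conv \<psi>) x = (\<Sum>i\<in>UNIV. (LINT y|lborel. (\<gamma> (x - y) \<bullet> axis i 1) * \<psi> y $ i))"
    by (simp add: divergence_def fd nth)
  also have "\<dots> = (LINT y|lborel. (\<Sum>i\<in>UNIV. (\<gamma> (x - y) \<bullet> axis i 1) * \<psi> y $ i))"
    by (rule Bochner_Integration.integral_sum[symmetric]) (rule int)
  finally show ?thesis by (simp only: inner_axis inner_real_def mult_1_right) (simp add: inner_vec_def)
qed

lemma integral_lebesgue_on_eq_lborel:
  fixes F :: "'a::euclidean_space \<Rightarrow> 'b::{banach, second_countable_topology}"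
  assumes "U \<in> sets lebesgue" "F \<in> borel_measurable borel" "\<And>x. x \<notin> U \<Longrightarrow> F x = 0"
  shows "(LINT x|lebesgue_on U. F x) = (LINT x|lborel. F x)"
proof -
  have "(LINT x|lebesgue_on U. F x) = (LINT x|lebesgue. indicator U x *\<^sub>R F x)"
    using assms by (subst integral_restrict_space) auto
  also have "(\<lambda>x. indicator U x *\<^sub>R F x) = F" using assms(3) by (auto simp: indicator_def)
  finally show ?thesis using assms(2) by (simp add: integral_completion)
qed

text \<open>
  The gradient of the mollification is tested against the mollification of its own direction field:
  by Fubini's theorem, the mollifier can be moved to the test field, and only bounded measurability of
  that field is needed.
\<close>

lemma grad_conv_le_TV:
  fixes f :: "real ^ 'n \<Rightarrow> real"
  assumes M: "mollifier \<rho> \<gamma> \<delta> C" and f: "integrable lborel f" and B: "B \<in> sets borel" "open U"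
    and K: "compact K" "K \<subseteq> U" "\<And>x. x \<in> B \<Longrightarrow> cball x \<delta> \<subseteq> K"
  shows "integrable lborel (\<lambda>x. indicator B x * norm (mollifier.grad_conv \<gamma> f x))"
    and "ennreal (LINT x|lborel. indicator B x * norm (mollifier.grad_conv \<gamma> f x)) \<le> TV U f"
proof -
  interpret mollifier \<rho> \<gamma> \<delta> C by fact
  have [measurable]: "f \<in> borel_measurable borel" using borel_measurable_integrable[OF f] by simp
  note [measurable] = B(1)
  have [measurable]: "grad_conv f \<in> borel_measurable borel"
    by (rule borel_measurable_continuous_onI[OF continuous_grad_conv[OF f]])
  have BK: "B \<subseteq> K" using K(3) \<delta> by force
  then have "bounded B" using K(1) compact_imp_bounded bounded_subset by blast
  then have Bfin: "emeasure lborel B < \<infinity>" by (rule emeasure_bounded_finite)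
  have Bint: "integrable lborel (\<lambda>x. c * indicator B x :: real)" for c
    using Bfin B by (intro integrable_mult_right integrable_real_indicator) auto
  have grad_bd: "norm (grad_conv f x) \<le> C * (LINT y|lborel. \<bar>f y\<bar>)" for x
  proof -
    have "norm (grad_conv f x) \<le> (LINT y|lborel. C * \<bar>f y\<bar>)"
      unfolding grad_conv_def
    proof (rule norm_integral_le[OF integrable_grad[OF f]])
      show "norm (f y *\<^sub>R \<gamma> (x - y)) \<le> C * \<bar>f y\<bar>" for y
        using mult_left_mono[OF bound(2) abs_ge_zero] by (simp add: mult.commute[of C])
    qed (use f in simp)
    then show ?thesis by simp
  qed
  show "integrable lborel (\<lambda>x. indicator B x * norm (grad_conv f x))"
  proof (rule Bochner_Integration.integrable_bound[OF Bint[of "C * (LINT y|lborel. \<bar>f y\<bar>)"]])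
    show "AE x in lborel. norm (indicator B x * norm (grad_conv f x)) \<le> norm (C * (LINT y|lborel. \<bar>f y\<bar>) * indicator B x :: real)"
    proof (rule AE_I2)
      show "norm (indicator B x * norm (grad_conv f x)) \<le> norm (C * (LINT y|lborel. \<bar>f y\<bar>) * indicator B x :: real)" for x
        using grad_bd[of x] C_nonneg by (auto simp: indicator_def abs_mult)
    qed
  qed measurable
  \<comment> \<open>The direction of the gradient, restricted to \<open>B\<close>. The minus sign
    compensates the one from oddness of \<open>\<gamma>\<close>, so that the pairing with the
    divergence is the integral of the norm.\<close>
  define \<psi> where "\<psi> x = indicator B x *\<^sub>R - sgn (grad_conv f x)" for x
  have \<psi>m[measurable]: "\<psi> \<in> borel_measurable borel" unfolding \<psi>_def sgn_div_norm by measurable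
  have \<psi>1: "norm (\<psi> x) \<le> indicator B x" for x by (auto simp: \<psi>_def indicator_def norm_sgn)
  then have \<psi>1': "norm (\<psi> x) \<le> 1" for x by (rule order_trans) (auto simp: indicator_def)
  have \<psi>: "integrable lborel \<psi>"
    by (rule Bochner_Integration.integrable_bound[OF Bint[of 1]]) (use \<psi>1 in auto)
  have \<psi>K: "cball x \<delta> \<subseteq> K" if "\<psi> x \<noteq> 0" for x
    using K(3)[of x] that by (auto simp: \<psi>_def indicator_def split: if_splits)
  have \<Phi>: "conv \<psi> \<in> C1c U" by (rule conv_in_C1c[OF M \<psi> K(1,2) \<psi>K])
  have div0: "divergence (conv \<psi>) y = 0" if "y \<notin> K" for y
  proof -
    have "frechet_derivative (conv \<psi>) (at y) h = 0" for h
    proof -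
      have "frechet_derivative (conv \<psi>) (at y) = dconv \<psi> y"
        using frechet_derivative_at[OF conv_has_derivative[OF \<psi>]] by simp
      moreover have "dconv \<psi> y h = 0"
      proof (rule conv_eq_0(2))
        fix z assume "dist y z < \<delta>"
        then have "y \<in> cball z \<delta>" by (simp add: dist_commute)
        then show "\<psi> z = 0" using \<psi>K that by blast
      qed
      ultimately show ?thesis by simp
    qed
    then show ?thesis by (simp add: divergence_def)
  qed
  have divm[measurable]: "divergence (conv \<psi>) \<in> borel_measurable borel"
    unfolding divergence_conv[OF M \<psi>, abs_def] by measurable
  have "(LINT y|lebesgue_on U. f y * divergence (conv \<psi>) y) = (LINT y|lborel. f y * divergence (conv \<psi>) y)"
    using B(2) div0 K(2) by (intro integral_lebesgue_on_eq_lborel) auto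
  also have "\<dots> = (LINT y|lborel. (LINT x|lborel. f y * (\<gamma> (y - x) \<bullet> \<psi> x)))"
    unfolding divergence_conv[OF M \<psi>] by simp
  also have "\<dots> = (LINT x|lborel. (LINT y|lborel. f y * (\<gamma> (y - x) \<bullet> \<psi> x)))"
  proof (rule lborel_pair.Fubini_integral)
    show "integrable (lborel \<Otimes>\<^sub>M lborel) (\<lambda>(x, y). f y * (\<gamma> (y - x) \<bullet> \<psi> x))"
    proof (rule lborel_pair.Fubini_integrable)
      have bd: "norm (f y * (\<gamma> (y - x) \<bullet> \<psi> x)) \<le> (C * indicator B x) * \<bar>f y\<bar>" for x y
      proof -
        have "\<bar>\<gamma> (y - x) \<bullet> \<psi> x\<bar> \<le> C * norm (\<psi> x)" by (rule gamma_inner_abs)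
        also have "\<dots> \<le> C * indicator B x" using \<psi>1 C_nonneg by (intro mult_left_mono)
        finally show ?thesis by (simp add: abs_mult mult.commute[of "\<bar>f y\<bar>"] mult_right_mono)
      qed
      have meas: "(\<lambda>y. f y * (\<gamma> (y - x) \<bullet> \<psi> x)) \<in> borel_measurable lborel" for x by measurable
      have int: "integrable lborel (\<lambda>y. f y * (\<gamma> (y - x) \<bullet> \<psi> x))" for x
        by (rule Bochner_Integration.integrable_bound[of _ "\<lambda>y. (C * indicator B x) * \<bar>f y\<bar>", OF _ meas])
          (use f bd in \<open>auto intro: order_trans[OF _ abs_ge_self]\<close>)
      show "(\<lambda>(x, y). f y * (\<gamma> (y - x) \<bullet> \<psi> x)) \<in> borel_measurable (lborel \<Otimes>\<^sub>M lborel)" by measurable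
      show "AE x in lborel. integrable lborel (\<lambda>y. case (x, y) of (x, y) \<Rightarrow> f y * (\<gamma> (y - x) \<bullet> \<psi> x))"
        using int by simp
      show "integrable lborel (\<lambda>x. LINT y|lborel. norm (case (x, y) of (x, y) \<Rightarrow> f y * (\<gamma> (y - x) \<bullet> \<psi> x)))"
      proof (rule Bochner_Integration.integrable_bound[OF Bint[of "C * (LINT y|lborel. \<bar>f y\<bar>)"]])
        show "(\<lambda>x. LINT y|lborel. norm (case (x, y) of (x, y) \<Rightarrow> f y * (\<gamma> (y - x) \<bullet> \<psi> x))) \<in> borel_measurable lborel"
          by measurable
        show "AE x in lborel. norm (LINT y|lborel. norm (case (x, y) of (x, y) \<Rightarrow> f y * (\<gamma> (y - x) \<bullet> \<psi> x)))
            \<le> norm (C * (LINT y|lborel. \<bar>f y\<bar>) * indicator B x :: real)"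
        proof (rule AE_I2)
          fix x
          have "(LINT y|lborel. norm (f y * (\<gamma> (y - x) \<bullet> \<psi> x))) \<le> (LINT y|lborel. (C * indicator B x) * \<bar>f y\<bar>)"
            using f bd int by (intro integral_mono) auto
          also have "\<dots> = C * (LINT y|lborel. \<bar>f y\<bar>) * indicator B x" by simp
          finally show "norm (LINT y|lborel. norm (case (x, y) of (x, y) \<Rightarrow> f y * (\<gamma> (y - x) \<bullet> \<psi> x)))
            \<le> norm (C * (LINT y|lborel. \<bar>f y\<bar>) * indicator B x :: real)" by simp
        qed
      qed
    qed
  qed
  also have "\<dots> = (LINT x|lborel. indicator B x * norm (grad_conv f x))"
  proof (rule Bochner_Integration.integral_cong[OF refl])
    fix x
    have "(LINT y|lborel. f y * (\<gamma> (y - x) \<bullet> \<psi> x)) = (LINT y|lborel. (f y *\<^sub>R \<gamma> (x - y)) \<bullet> (- \<psi> x))"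
      using even(2)[of "x - y" for y] by (intro Bochner_Integration.integral_cong) auto
    also have "\<dots> = grad_conv f x \<bullet> (- \<psi> x)"
      unfolding grad_conv_def by (rule integral_inner_left) (rule integrable_grad[OF f])
    also have "\<dots> = indicator B x * norm (grad_conv f x)"
      by (cases "grad_conv f x = 0")
        (simp_all add: \<psi>_def sgn_div_norm power2_norm_eq_inner[symmetric] power2_eq_square)
    finally show "(LINT y|lborel. f y * (\<gamma> (y - x) \<bullet> \<psi> x)) = indicator B x * norm (grad_conv f x)" .
  qed
  finally have "ennreal (LINT x|lborel. indicator B x * norm (grad_conv f x))
      = ennreal (LINT y|lebesgue_on U. f y * divergence (conv \<psi>) y)" by simp
  also have "\<dots> \<le> TV U f"
    unfolding TV_def by (rule SUP_upper) (use \<Phi> norm_conv_le[OF \<psi> \<psi>1'] in auto)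
  finally show "ennreal (LINT x|lborel. indicator B x * norm (grad_conv f x)) \<le> TV U f" .
qed

text \<open>Replace \<open>f\<close> by a continuous \<open>g\<close> close to it in the mean. The
  convolution does not enlarge the error \<open>f - g\<close>, and on the bounded set
  \<open>S\<close> uniform continuity of \<open>g\<close> makes its mollification uniformly close.
  The threshold for the radius is uniform over all mollifiers.\<close>

lemma mollify_L1:
  fixes f :: "'a::euclidean_space \<Rightarrow> real"
  assumes f: "integrable lborel f" and S: "bounded S" "S \<in> sets borel" and "e > 0"
  shows "\<exists>\<delta>\<^sub>0>0. \<forall>\<rho> \<gamma> \<delta> C. mollifier \<rho> \<gamma> \<delta> C \<and> \<delta> < \<delta>\<^sub>0 \<longrightarrow>
    (\<integral>\<^sup>+x. ennreal (indicator S x * \<bar>mollifier.conv \<rho> f x - f x\<bar>) \<partial>lborel) \<le> ennreal e"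
proof -
  obtain g where g: "continuous_on UNIV g" "integrable lborel g" "(LINT x|lborel. \<bar>f x - g x\<bar>) < e / 3"
    using integrable_approx_continuous[OF f, of "e / 3"] \<open>e > 0\<close> by auto
  have [measurable]: "f \<in> borel_measurable borel" "g \<in> borel_measurable borel"
    using borel_measurable_integrable[OF f] borel_measurable_integrable[OF g(2)] by simp_all
  note [measurable] = S(2)
  have Sfin: "emeasure lborel S < \<infinity>" using S(1) by (rule emeasure_bounded_finite)
  obtain R where R: "\<And>x. x \<in> S \<Longrightarrow> norm x \<le> R" using S(1) by (auto simp: bounded_iff)
  define \<eta> where "\<eta> = e / (3 * (measure lborel S + 1))"
  have "\<eta> > 0" using \<open>e > 0\<close> by (simp add: \<eta>_def add_nonneg_pos)
  have \<eta>S: "\<eta> * measure lborel S \<le> e / 3"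
  proof -
    have "\<eta> * measure lborel S \<le> \<eta> * (measure lborel S + 1)" using \<open>\<eta> > 0\<close> by (intro mult_left_mono) auto
    also have "\<dots> = e / 3"
    proof -
      have "\<And>D. 0 < D \<Longrightarrow> e / (3 * D) * D = e / 3" by simp
      then show ?thesis unfolding \<eta>_def using measure_nonneg[of lborel S] by (simp only: add_nonneg_pos zero_less_one)
    qed
    finally show ?thesis .
  qed
  have "uniformly_continuous_on (cball 0 (R + 1)) g"
    by (intro compact_uniformly_continuous continuous_on_subset[OF g(1)]) auto
  then obtain d where d: "d > 0" "\<And>x y. x \<in> cball 0 (R + 1) \<Longrightarrow> y \<in> cball 0 (R + 1) \<Longrightarrow> dist y x < d \<Longrightarrow> dist (g y) (g x) < \<eta>"
    unfolding uniformly_continuous_on_def using \<open>\<eta> > 0\<close> by metis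
  \<comment> \<open>A radius below 1 keeps the points averaged around \<open>S\<close> inside
    \<open>cball 0 (R + 1)\<close>, where \<open>g\<close> is uniformly continuous.\<close>
  have "(\<integral>\<^sup>+x. ennreal (indicator S x * \<bar>mollifier.conv \<rho> f x - f x\<bar>) \<partial>lborel) \<le> ennreal e"
    if M: "mollifier \<rho> \<gamma> \<delta> C" and "\<delta> < min 1 d" for \<rho> \<gamma> \<delta> C
  proof -
    interpret mollifier \<rho> \<gamma> \<delta> C by fact
    have fg: "integrable lborel (\<lambda>x. f x - g x)" using f g by simp
    have [measurable]: "conv (\<lambda>x. f x - g x) \<in> borel_measurable borel" "conv f \<in> borel_measurable borel"
      unfolding conv_def by measurable
    have split: "conv f x = conv (\<lambda>x. f x - g x) x + conv g x" for x
      using integrable_rho[OF f, of x] integrable_rho[OF g(2), of x] by (simp add: conv_def right_diff_distrib)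
    have near: "\<bar>conv g x - g x\<bar> \<le> \<eta>" if "x \<in> S" for x
    proof -
      have "conv g x - g x = (LINT y|lborel. \<rho> (x - y) * (g y - g x))"
        using integrable_rho[OF g(2), of x] integral_rho[of x] by (simp add: conv_def right_diff_distrib)
      also have "norm \<dots> \<le> (LINT y|lborel. \<eta> * \<rho> (x - y))"
      proof (rule norm_integral_le)
        show "integrable lborel (\<lambda>y. \<rho> (x - y) * (g y - g x))"
          using integrable_rho[OF g(2), of x] integral_rho(1)[of x] by (simp add: right_diff_distrib)
        show "integrable lborel (\<lambda>y. \<eta> * \<rho> (x - y))" using integral_rho(1) by simp
        fix y
        show "norm (\<rho> (x - y) * (g y - g x)) \<le> \<eta> * \<rho> (x - y)"
        proof (cases "norm (x - y) < \<delta>")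
          case True
          have "norm y \<le> norm x + norm (x - y)" using norm_triangle_ineq4[of x "x - y"] by simp
          then have "dist (g y) (g x) < \<eta>"
            using R[OF \<open>x \<in> S\<close>] True \<open>\<delta> < min 1 d\<close> by (intro d(2)) (auto simp: dist_norm norm_minus_commute)
          then have "\<bar>g y - g x\<bar> \<le> \<eta>" by (simp add: dist_real_def)
          then show ?thesis using nonneg[of "x - y"] using mult_left_mono[of "\<bar>g y - g x\<bar>" \<eta> "\<rho> (x - y)"]
            by (simp add: abs_mult mult.commute)
        qed (use supp(1)[of "x - y"] in simp)
      qed
      also have "\<dots> = \<eta>" using integral_rho(2)[of x] by simp
      finally show ?thesis by simp
    qed
    have "(\<integral>\<^sup>+x. ennreal (indicator S x * \<bar>conv f x - f x\<bar>) \<partial>lborel) \<le>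
        (\<integral>\<^sup>+x. (ennreal \<bar>conv (\<lambda>x. f x - g x) x\<bar> + ennreal \<bar>f x - g x\<bar>) + ennreal \<eta> * indicator S x \<partial>lborel)"
    proof (rule nn_integral_mono)
      fix x
      show "ennreal (indicator S x * \<bar>conv f x - f x\<bar>) \<le>
          (ennreal \<bar>conv (\<lambda>x. f x - g x) x\<bar> + ennreal \<bar>f x - g x\<bar>) + ennreal \<eta> * indicator S x"
      proof (cases "x \<in> S")
        case True
        have "\<bar>conv f x - f x\<bar> \<le> \<bar>conv (\<lambda>x. f x - g x) x\<bar> + \<bar>f x - g x\<bar> + \<eta>"
          using near[OF True] split[of x] by linarith
        then show ?thesis using True \<open>\<eta> > 0\<close> by (simp add: ennreal_plus[symmetric] ennreal_leI del: ennreal_plus)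
      qed simp
    qed
    also have "\<dots> = (\<integral>\<^sup>+x. ennreal \<bar>conv (\<lambda>x. f x - g x) x\<bar> \<partial>lborel) + (\<integral>\<^sup>+x. ennreal \<bar>f x - g x\<bar> \<partial>lborel)
        + ennreal \<eta> * emeasure lborel S"
      by (simp add: nn_integral_add nn_integral_cmult_indicator)
    also have "\<dots> \<le> ennreal (e / 3) + ennreal (e / 3) + ennreal (e / 3)"
    proof -
      have 1: "(\<integral>\<^sup>+x. ennreal \<bar>f x - g x\<bar> \<partial>lborel) \<le> ennreal (e / 3)"
        using fg g(3) by (subst nn_integral_eq_integral) (auto intro: ennreal_leI)
      have 2: "(\<integral>\<^sup>+x. ennreal \<bar>conv (\<lambda>x. f x - g x) x\<bar> \<partial>lborel) \<le> ennreal (e / 3)"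
        using nn_integral_conv_le[OF fg] 1 by (rule order_trans)
      have "emeasure lborel S = ennreal (measure lborel S)" using Sfin by (simp add: emeasure_eq_ennreal_measure less_top)
      then have 3: "ennreal \<eta> * emeasure lborel S \<le> ennreal (e / 3)"
        using \<eta>S \<open>\<eta> > 0\<close> by (simp add: ennreal_mult[symmetric] ennreal_leI)
      show ?thesis by (intro add_mono 1 2 3)
    qed
    also have "\<dots> = ennreal e" using \<open>e > 0\<close> by (simp add: ennreal_plus[symmetric] del: ennreal_plus)
    finally show ?thesis .
  qed
  moreover have "0 < min 1 d" using d(1) by simp
  ultimately show ?thesis by blast
qed

section \<open>Test fields and integration by parts\<close>

lemma C1cI:
  fixes \<phi> :: "real ^ 'n \<Rightarrow> real ^ 'n"
  assumes D: "\<And>x. (\<phi> has_derivative D x) (at x)" and cont: "\<And>h. continuous_on UNIV (\<lambda>x. D x h)"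
    and K: "compact K" "K \<subseteq> U" "\<And>x. x \<notin> K \<Longrightarrow> \<phi> x = 0"
  shows "\<phi> \<in> C1c U"
proof -
  have app: "blinfun_apply (Blinfun (D x)) = D x" for x
    using bounded_linear_Blinfun_apply[OF has_derivative_bounded_linear[OF D]] .
  have "\<forall>x. (\<phi> has_derivative blinfun_apply (Blinfun (D x))) (at x)" unfolding app using D by blast
  moreover have "continuous_on UNIV (\<lambda>x. Blinfun (D x))"
    by (rule continuous_on_blinfun_componentwise) (simp add: app cont)
  moreover have "{x. \<phi> x \<noteq> 0} \<subseteq> K" using K(3) by blast
  then have "closure {x. \<phi> x \<noteq> 0} \<subseteq> K" by (rule closure_minimal) (use K(1) compact_imp_closed in blast)
  moreover from this have "compact (closure {x. \<phi> x \<noteq> 0})"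
    using K(1) by (metis closed_closure compact_Int_closed inf.absorb_iff2)
  ultimately show ?thesis using K(2) by (auto simp: C1c_def)
qed

text \<open>In finite dimensions continuity of the derivative as an operator amounts to continuity
  of each directional derivative, which is easier to handle. The derivative vanishes off
  \<open>K\<close> as well, because the complement of the closed support is open.\<close>

lemma C1cE:
  fixes \<phi> :: "real ^ 'n \<Rightarrow> real ^ 'n"
  assumes "\<phi> \<in> C1c U"
  obtains D K where "\<And>x. (\<phi> has_derivative D x) (at x)" "\<And>h. continuous_on UNIV (\<lambda>x. D x h)"
    "compact K" "K \<subseteq> U" "\<And>x. x \<notin> K \<Longrightarrow> \<phi> x = 0" "\<And>x h. x \<notin> K \<Longrightarrow> D x h = 0"
    "\<And>x. divergence \<phi> x = (\<Sum>i\<in>UNIV. D x (axis i 1) $ i)"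
proof -
  obtain \<phi>' where \<phi>': "\<And>x. (\<phi> has_derivative blinfun_apply (\<phi>' x)) (at x)" "continuous_on UNIV \<phi>'"
    and K: "compact (closure {x. \<phi> x \<noteq> 0})" "closure {x. \<phi> x \<noteq> 0} \<subseteq> U"
    using assms unfolding C1c_def by blast
  define S where "S = closure {x. \<phi> x \<noteq> 0}"
  have S: "compact S" "S \<subseteq> U" "closed S" using K by (auto simp: S_def)
  have z: "\<phi> x = 0" if "x \<notin> S" for x using that closure_subset[of "{x. \<phi> x \<noteq> 0}"] unfolding S_def by blast
  have "blinfun_apply (\<phi>' x) h = 0" if "x \<notin> S" for x h
  proof -
    have "((\<lambda>_. 0) has_derivative blinfun_apply (\<phi>' x)) (at x)"
      by (rule has_derivative_transform_within_open[OF \<phi>'(1)[of x], of "- S"])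
        (simp_all add: that z S(3) open_Compl)
    moreover have "((\<lambda>_. 0::real ^ 'n) has_derivative (\<lambda>_. 0)) (at x)" by (rule has_derivative_const)
    ultimately have "blinfun_apply (\<phi>' x) = (\<lambda>_. 0)" by (rule has_derivative_unique)
    then show ?thesis by simp
  qed
  moreover have "divergence \<phi> x = (\<Sum>i\<in>UNIV. blinfun_apply (\<phi>' x) (axis i 1) $ i)" for x
    using frechet_derivative_at[OF \<phi>'(1)[of x]] by (simp add: divergence_def)
  moreover have "continuous_on UNIV (\<lambda>x. blinfun_apply (\<phi>' x) h)" for h
    using \<phi>'(2) by (intro continuous_intros)
  ultimately show ?thesis using that[of "\<lambda>x. blinfun_apply (\<phi>' x)" S] \<phi>'(1) S(1,2) z by blast
qed

text \<open>Difference quotients have integral 0 by translation invariance. The mean value theorem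
  dominates them by a constant on a fixed ball, so the limit may be taken under the
  integral.\<close>

lemma integral_directional_derivative_eq_0:
  fixes p :: "'a::euclidean_space \<Rightarrow> real"
  assumes D: "\<And>x. (p has_derivative D x) (at x)" and cont: "continuous_on UNIV (\<lambda>x. D x e)"
    and R: "\<And>x. R < norm x \<Longrightarrow> p x = 0"
  shows "(LINT x|lborel. D x e) = 0"
proof -
  have pc: "continuous_on UNIV p" by (rule has_derivative_continuous_on) (rule D)
  then have [measurable]: "p \<in> borel_measurable borel" by (rule borel_measurable_continuous_onI)
  have [measurable]: "(\<lambda>x. D x e) \<in> borel_measurable borel" using cont by (rule borel_measurable_continuous_onI)
  have lin: "linear (D x)" for x using has_derivative_linear[OF D] .
  have pint: "integrable lborel p"
  proof -
    have "integrable lborel (\<lambda>x. indicator (cball 0 R) x *\<^sub>R p x)"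
      by (rule borel_integrable_compact) (auto intro: continuous_on_subset[OF pc])
    moreover have "(\<lambda>x. indicator (cball 0 R) x *\<^sub>R p x) = p" using R by (auto simp: indicator_def fun_eq_iff)
    ultimately show ?thesis by simp
  qed
  define s where "s k = inverse (real (Suc k))" for k
  have s: "0 < s k" "s k \<le> 1" for k by (auto simp: s_def field_simps)
  have s0: "s \<longlonglongrightarrow> 0" unfolding s_def by (rule LIMSEQ_inverse_real_of_nat)
  \<comment> \<open>Quotients with step at most 1 vanish outside radius \<open>R + norm e\<close>,
    and intermediate points of the mean value theorem lie at most \<open>norm e\<close> further
    out.\<close>
  have "bounded ((\<lambda>x. D x e) ` cball 0 (R + 2 * norm e))"
    by (intro compact_imp_bounded compact_continuous_image continuous_on_subset[OF cont]) auto
  then obtain B where B: "\<And>x. norm x \<le> R + 2 * norm e \<Longrightarrow> \<bar>D x e\<bar> \<le> B"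
    by (force simp: bounded_iff)
  define q where "q k x = (p (x + s k *\<^sub>R e) - p x) / s k" for k x
  have q_bd: "\<bar>q k x\<bar> \<le> \<bar>B\<bar> * indicator (cball 0 (R + norm e)) x" for k x
  proof (cases "norm x \<le> R + norm e")
    case True
    have "\<exists>t\<in>{0<..<s k}. p (x + s k *\<^sub>R e) - p (x + 0 *\<^sub>R e) = D (x + t *\<^sub>R e) ((s k - 0) *\<^sub>R e)"
    proof -
      have "\<exists>t\<in>{0<..<s k}. (\<lambda>t. p (x + t *\<^sub>R e)) (s k) - (\<lambda>t. p (x + t *\<^sub>R e)) 0 = (\<lambda>h. D (x + t *\<^sub>R e) (h *\<^sub>R e)) (s k - 0)"
      proof (rule mvt_simple[OF s(1)])
        fix t assume "0 \<le> t" "t \<le> s k"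
        have "((\<lambda>t. x + t *\<^sub>R e) has_derivative (\<lambda>h. h *\<^sub>R e)) (at t within {0..s k})"
          by (auto intro!: derivative_eq_intros)
        from has_derivative_compose[OF this D]
        show "((\<lambda>t. p (x + t *\<^sub>R e)) has_derivative (\<lambda>h. D (x + t *\<^sub>R e) (h *\<^sub>R e))) (at t within {0..s k})" .
      qed
      then show ?thesis by simp
    qed
    then obtain t where t: "0 < t" "t < s k" "p (x + s k *\<^sub>R e) - p x = s k * D (x + t *\<^sub>R e) e"
      using lin by (auto simp: linear_scale)
    have "norm (x + t *\<^sub>R e) \<le> norm x + t * norm e" using norm_triangle_ineq[of x "t *\<^sub>R e"] t by simp
    also have "\<dots> \<le> R + norm e + 1 * norm e" using True t s(2)[of k] by (intro add_mono mult_right_mono) auto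
    finally have "\<bar>D (x + t *\<^sub>R e) e\<bar> \<le> B" by (intro B) simp
    then show ?thesis using t(3) s(1)[of k] True by (simp add: q_def dist_norm)
  next
    case False
    have "norm x \<le> norm (x + s k *\<^sub>R e) + norm (s k *\<^sub>R e)" using norm_triangle_ineq4[of "x + s k *\<^sub>R e" "s k *\<^sub>R e"] by simp
    also have "norm (s k *\<^sub>R e) \<le> 1 * norm e" using s[of k] mult_right_mono[of "s k" 1 "norm e"] by simp
    finally have "R < norm (x + s k *\<^sub>R e)" "R < norm x" using False norm_ge_zero[of e] by linarith+
    then show ?thesis using R by (simp add: q_def)
  qed
  have "(\<lambda>k. LINT x|lborel. q k x) \<longlonglongrightarrow> (LINT x|lborel. D x e)"
  proof (rule integral_dominated_convergence[where w = "\<lambda>x. \<bar>B\<bar> * indicator (cball 0 (R + norm e)) x"])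
    show "integrable lborel (\<lambda>x. \<bar>B\<bar> * indicator (cball 0 (R + norm e)) x)" by (rule integrable_cball_indicator)
    show "AE x in lborel. norm (q k x) \<le> \<bar>B\<bar> * indicator (cball 0 (R + norm e)) x" for k using q_bd by simp
    show "q k \<in> borel_measurable lborel" for k unfolding q_def by measurable
    show "AE x in lborel. (\<lambda>k. q k x) \<longlonglongrightarrow> D x e"
    proof (rule AE_I2)
      fix x
      have "((\<lambda>t. x + t *\<^sub>R e) has_derivative (\<lambda>h. h *\<^sub>R e)) (at 0)" by (auto intro!: derivative_eq_intros)
      from has_derivative_compose[OF this, of p "D (x + 0 *\<^sub>R e)"] D
      have "((\<lambda>t. p (x + t *\<^sub>R e)) has_derivative (\<lambda>h. D x (h *\<^sub>R e))) (at 0)" by simp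
      then have "((\<lambda>t. p (x + t *\<^sub>R e)) has_vector_derivative D x e) (at 0)"
        using lin by (simp add: has_vector_derivative_def linear_scale)
      then have "((\<lambda>h. (p (x + h *\<^sub>R e) - p x) /\<^sub>R h) \<longlongrightarrow> D x e) (at 0)"
        by (simp add: has_vector_derivative_iff_quotient)
      moreover have "filterlim s (at 0) sequentially"
        using s0 s(1) by (auto simp: filterlim_at intro!: always_eventually less_imp_neq[symmetric])
      ultimately have "(\<lambda>k. (p (x + s k *\<^sub>R e) - p x) /\<^sub>R s k) \<longlonglongrightarrow> D x e" by (rule filterlim_compose)
      then show "(\<lambda>k. q k x) \<longlonglongrightarrow> D x e" by (simp add: q_def divide_inverse_commute)
    qed
  qed simp
  moreover have "(LINT x|lborel. q k x) = 0" for k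
    unfolding q_def using lborel_translate[of p "s k *\<^sub>R e"] pint by simp
  ultimately show ?thesis using LIMSEQ_unique[OF _ tendsto_const] by simp
qed

lemma integrable_lebesgue_on_compact:
  fixes F :: "'a::euclidean_space \<Rightarrow> 'b::{banach, second_countable_topology}"
  assumes "compact K" "continuous_on K F"
  shows "integrable (lebesgue_on K) F"
proof -
  have i: "integrable lborel (\<lambda>x. indicator K x *\<^sub>R F x)" using assms by (rule borel_integrable_compact)
  then have "integrable lebesgue (\<lambda>x. indicator K x *\<^sub>R F x)"
    using borel_measurable_integrable[OF i] by (simp add: integrable_completion)
  moreover have "K \<in> sets lebesgue" using fmeasurableD[OF lmeasurable_compact[OF assms(1)]] .
  ultimately show ?thesis by (subst integrable_restrict_space) auto
qed

text \<open>Each product of \<open>v\<close> with a component of the field has compact support, so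
  its partial derivative integrates to 0; summing over the components gives the integration by
  parts.\<close>

lemma weak_gradient_C1:
  fixes v :: "real ^ 'n \<Rightarrow> real"
  assumes \<Omega>: "open \<Omega>" and v: "\<And>x. (v has_derivative (\<lambda>h. g x \<bullet> h)) (at x)" and g: "continuous_on UNIV g"
  shows "weak_gradient \<Omega> v g"
  unfolding weak_gradient_def
proof (intro conjI allI ballI impI)
  have vc: "continuous_on UNIV v" by (rule has_derivative_continuous_on) (rule v)
  fix K :: "(real ^ 'n) set" assume "compact K"
  then show "integrable (lebesgue_on K) v" "integrable (lebesgue_on K) g"
    by (auto intro!: integrable_lebesgue_on_compact continuous_on_subset[OF vc] continuous_on_subset[OF g])
next
  have vc: "continuous_on UNIV v" by (rule has_derivative_continuous_on) (rule v)
  fix \<phi> assume "\<phi> \<in> C1c \<Omega>"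
  then obtain D K where D: "\<And>x. (\<phi> has_derivative D x) (at x)" "\<And>h. continuous_on UNIV (\<lambda>x. D x h)"
    and K: "compact K" "K \<subseteq> \<Omega>" "\<And>x. x \<notin> K \<Longrightarrow> \<phi> x = 0" "\<And>x h. x \<notin> K \<Longrightarrow> D x h = 0"
    and div: "\<And>x. divergence \<phi> x = (\<Sum>i\<in>UNIV. D x (axis i 1) $ i)"
    by (rule C1cE) blast
  have \<phi>c: "continuous_on UNIV \<phi>" by (rule has_derivative_continuous_on) (rule D(1))
  have divc: "continuous_on UNIV (divergence \<phi>)"
    unfolding div[abs_def] by (intro continuous_intros D)
  obtain R where R: "\<And>x. x \<in> K \<Longrightarrow> norm x \<le> R" using compact_imp_bounded[OF K(1)] by (auto simp: bounded_iff)
  define P where "P i x h = (g x \<bullet> h) * \<phi> x $ i + v x * D x h $ i" for i x h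
  have P: "((\<lambda>x. v x * \<phi> x $ i) has_derivative P i x) (at x)" for i x
    unfolding P_def
    by (rule has_derivative_eq_rhs[OF has_derivative_mult[OF v bounded_linear.has_derivative[OF bounded_linear_vec_nth D(1)]]]) (auto simp: algebra_simps)
  have Pc: "continuous_on UNIV (\<lambda>x. P i x h)" for i h
    unfolding P_def by (intro continuous_intros g vc \<phi>c D)
  have "(LINT x|lborel. P i x (axis i 1)) = 0" for i
  proof (rule integral_directional_derivative_eq_0[OF P Pc])
    fix x :: "real ^ 'n" assume "R < norm x"
    then have "x \<notin> K" using R by force
    then show "v x * \<phi> x $ i = 0" using K(3) by simp
  qed
  then have "0 = (\<Sum>i\<in>UNIV. (LINT x|lborel. P i x (axis i 1)))" by simp
  also have "\<dots> = (LINT x|lborel. (\<Sum>i\<in>UNIV. P i x (axis i 1)))"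
  proof (rule Bochner_Integration.integral_sum[symmetric])
    fix i
    have "integrable lborel (\<lambda>x. indicator K x *\<^sub>R P i x (axis i 1))"
      using K(1) by (intro borel_integrable_compact continuous_on_subset[OF Pc]) auto
    moreover have "(\<lambda>x. indicator K x *\<^sub>R P i x (axis i 1)) = (\<lambda>x. P i x (axis i 1))"
      using K by (auto simp: P_def indicator_def fun_eq_iff)
    ultimately show "integrable lborel (\<lambda>x. P i x (axis i 1))" by simp
  qed
  also have "(\<lambda>x. \<Sum>i\<in>UNIV. P i x (axis i 1)) = (\<lambda>x. v x * divergence \<phi> x + g x \<bullet> \<phi> x)"
  proof
    fix x
    have "(\<Sum>i\<in>UNIV. P i x (axis i 1)) = (\<Sum>i\<in>UNIV. g x $ i * \<phi> x $ i) + v x * (\<Sum>i\<in>UNIV. D x (axis i 1) $ i)"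
      by (simp only: P_def inner_axis inner_real_def mult_1_right sum.distrib sum_distrib_left)
    then show "(\<Sum>i\<in>UNIV. P i x (axis i 1)) = v x * divergence \<phi> x + g x \<bullet> \<phi> x"
      by (simp add: div inner_vec_def)
  qed
  also have "(LINT x|lborel. v x * divergence \<phi> x + g x \<bullet> \<phi> x)
      = (LINT x|lborel. v x * divergence \<phi> x) + (LINT x|lborel. g x \<bullet> \<phi> x)"
  proof (rule Bochner_Integration.integral_add)
    have c: "continuous_on UNIV (\<lambda>x. v x * divergence \<phi> x)" "continuous_on UNIV (\<lambda>x. g x \<bullet> \<phi> x)"
      by (intro continuous_intros vc divc g \<phi>c)+
    have "integrable lborel (\<lambda>x. indicator K x *\<^sub>R (v x * divergence \<phi> x))" "integrable lborel (\<lambda>x. indicator K x *\<^sub>R (g x \<bullet> \<phi> x))"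
      by (rule borel_integrable_compact[OF K(1) continuous_on_subset[OF c(1) subset_UNIV]],
          rule borel_integrable_compact[OF K(1) continuous_on_subset[OF c(2) subset_UNIV]])
    moreover have "(\<lambda>x. indicator K x *\<^sub>R (v x * divergence \<phi> x)) = (\<lambda>x. v x * divergence \<phi> x)"
        "(\<lambda>x. indicator K x *\<^sub>R (g x \<bullet> \<phi> x)) = (\<lambda>x. g x \<bullet> \<phi> x)"
      using K by (auto simp: indicator_def fun_eq_iff div)
    ultimately show "integrable lborel (\<lambda>x. v x * divergence \<phi> x)" "integrable lborel (\<lambda>x. g x \<bullet> \<phi> x)" by simp_all
  qed
  finally have parts: "(LINT x|lborel. v x * divergence \<phi> x) = - (LINT x|lborel. g x \<bullet> \<phi> x)" by simp
  have out: "x \<notin> K" if "x \<notin> \<Omega>" for x using K(2) that by blast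
  have "(LINT x|lebesgue_on \<Omega>. v x * divergence \<phi> x) = (LINT x|lborel. v x * divergence \<phi> x)"
    using \<Omega> K by (intro integral_lebesgue_on_eq_lborel borel_measurable_continuous_onI continuous_intros vc divc) (simp_all add: div out K)
  moreover have "(LINT x|lebesgue_on \<Omega>. g x \<bullet> \<phi> x) = (LINT x|lborel. g x \<bullet> \<phi> x)"
    using \<Omega> K by (intro integral_lebesgue_on_eq_lborel borel_measurable_continuous_onI continuous_intros g \<phi>c) (simp_all add: out K)
  ultimately show "(LINT x|lebesgue_on \<Omega>. v x * divergence \<phi> x) = - (LINT x|lebesgue_on \<Omega>. g x \<bullet> \<phi> x)" using parts by simp
qed

section \<open>Weak gradients and total variation\<close>

text \<open>Kernel translates times a coordinate vector are test fields, so near any point the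
  mollifications of the difference of the gradients vanish. They converge to that difference in the
  mean, which is therefore zero almost everywhere near the point; local negligibility is then
  global.\<close>

lemma weak_gradient_unique:
  fixes \<Omega> :: "(real ^ 'n) set"
  assumes \<Omega>: "open \<Omega>" and g1: "weak_gradient \<Omega> u g\<^sub>1" and g2: "weak_gradient \<Omega> u g\<^sub>2"
  shows "AE x in lebesgue_on \<Omega>. g\<^sub>1 x = g\<^sub>2 x"
proof -
  have loc: "\<exists>U. open U \<and> x0 \<in> U \<and> (AE x in lebesgue. x \<in> U \<longrightarrow> g\<^sub>1 x = g\<^sub>2 x)" if "x0 \<in> \<Omega>" for x0
  proof -
    obtain e where "e > 0" "cball x0 e \<subseteq> \<Omega>" using \<Omega> \<open>x0 \<in> \<Omega>\<close> open_contains_cball by blast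
    define r where "r = e / 2"
    \<comment> \<open>The radius \<open>2 * r\<close> leaves room: a kernel of radius below
      \<open>r\<close> centred in \<open>ball x0 r\<close> is supported in \<open>Q\<close>.\<close>
    define Q where "Q = cball x0 (2 * r)"
    have r: "r > 0" and Q: "compact Q" "Q \<subseteq> \<Omega>" using \<open>e > 0\<close> \<open>cball x0 e \<subseteq> \<Omega>\<close> by (auto simp: r_def Q_def)
    have Qs: "Q \<in> sets lebesgue" "\<Omega> \<in> sets lebesgue" using fmeasurableD[OF lmeasurable_compact[OF Q(1)]] \<Omega> by auto
    have comp: "AE x in lebesgue. x \<in> ball x0 r \<longrightarrow> g\<^sub>1 x $ i = g\<^sub>2 x $ i" for i
    proof -
      define G where "G g x = indicator Q x * (g x $ i)" for g :: "real ^ 'n \<Rightarrow> real ^ 'n" and x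
      have Gint: "integrable lebesgue (G g)" if "weak_gradient \<Omega> u g" for g
      proof -
        have "integrable (lebesgue_on Q) g" using that Q by (simp add: weak_gradient_def)
        then have "integrable (lebesgue_on Q) (\<lambda>x. g x $ i)"
          by (rule integrable_bounded_linear[OF bounded_linear_vec_nth])
        then show ?thesis using Qs unfolding G_def by (subst (asm) integrable_restrict_space) auto
      qed
      have Gdiff: "integrable lebesgue (\<lambda>x. G g\<^sub>1 x - G g\<^sub>2 x)" using Gint g1 g2 by simp
      \<comment> \<open>Mollification is formulated for Borel functions and \<open>lborel\<close>,
        so the Lebesgue measurable difference is replaced by a Borel version.\<close>
      obtain F where F[measurable]: "F \<in> borel_measurable lborel" and FG: "AE x in lborel. G g\<^sub>1 x - G g\<^sub>2 x = F x"
        using completion_ex_borel_measurable_real[OF borel_measurable_integrable[OF Gdiff]] by blast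
      have Fb: "F \<in> borel_measurable borel" using F by simp
      have FG': "AE x in lebesgue. G g\<^sub>1 x - G g\<^sub>2 x = F x" using FG by (simp add: AE_lborel_iff_lebesgue)
      have FL[measurable]: "F \<in> borel_measurable lebesgue" by (rule measurable_completion[OF F])
      have "integrable lebesgue F"
        using integrable_cong_AE_imp[OF Gdiff FL] FG' by (simp add: eq_commute)
      then have Fint: "integrable lborel F" using F by (simp add: integrable_completion)
      have conv0: "mollifier.conv \<rho> F x = 0" if M: "mollifier \<rho> \<gamma> \<delta> C" and "\<delta> < r" and x: "x \<in> ball x0 r" for \<rho> \<gamma> \<delta> C x
      proof -
        interpret mollifier \<rho> \<gamma> \<delta> C by fact
        define \<phi> where "\<phi> y = \<rho> (y - x) *\<^sub>R (axis i 1 :: real ^ 'n)" for y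
        have KQ: "cball x \<delta> \<subseteq> Q"
        proof
          fix y assume "y \<in> cball x \<delta>"
          then show "y \<in> Q" using x \<open>\<delta> < r\<close> dist_triangle[of x0 y x] by (auto simp: Q_def)
        qed
        have out: "\<rho> (y - x) = 0" if "y \<notin> Q" for y
        proof -
          have "y \<notin> cball x \<delta>" using that KQ by blast
          then show ?thesis using supp(1)[of "y - x"] by (simp add: dist_norm norm_minus_commute)
        qed
        have "\<phi> \<in> C1c \<Omega>"
        proof (rule C1cI[where K = "cball x \<delta>" and D = "\<lambda>y h. (\<gamma> (y - x) \<bullet> h) *\<^sub>R axis i 1"])
          show "(\<phi> has_derivative (\<lambda>h. (\<gamma> (y - x) \<bullet> h) *\<^sub>R axis i 1)) (at y)" for y
          proof -
            have "((\<lambda>y. y - x) has_derivative (\<lambda>h. h)) (at y)" by (auto intro!: derivative_eq_intros)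
            from has_derivative_compose[OF this rho_has_derivative]
            show ?thesis unfolding \<phi>_def by (rule has_derivative_scaleR_left)
          qed
          show "continuous_on UNIV (\<lambda>y. (\<gamma> (y - x) \<bullet> h) *\<^sub>R (axis i 1 :: real ^ 'n))" for h
          proof -
            have "continuous_on UNIV (\<lambda>y. \<gamma> (y - x))"
              by (rule continuous_on_compose2[OF continuous_gamma]) (auto intro!: continuous_intros)
            then show ?thesis by (intro continuous_intros)
          qed
          show "\<phi> y = 0" if "y \<notin> cball x \<delta>" for y
            using that supp(1)[of "y - x"] by (simp add: \<phi>_def dist_norm norm_minus_commute)
        qed (use KQ Q in auto)
        then have eq: "(LINT y|lebesgue_on \<Omega>. g\<^sub>1 y \<bullet> \<phi> y) = (LINT y|lebesgue_on \<Omega>. g\<^sub>2 y \<bullet> \<phi> y)"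
          using g1 g2 by (simp add: weak_gradient_def)
        have rew: "(LINT y|lebesgue_on \<Omega>. g y \<bullet> \<phi> y) = (LINT y|lebesgue. \<rho> (x - y) * G g y)" for g
        proof -
          have sym: "\<rho> (x - y) = \<rho> (y - x)" for y using even(1)[of "x - y"] by simp
          have "(LINT y|lebesgue_on \<Omega>. g y \<bullet> \<phi> y) = (LINT y|lebesgue. indicator \<Omega> y *\<^sub>R (g y \<bullet> \<phi> y))"
            using Qs by (subst integral_restrict_space) auto
          also have "\<dots> = (LINT y|lebesgue. \<rho> (x - y) * G g y)"
          proof (rule Bochner_Integration.integral_cong[OF refl])
            fix y
            show "indicator \<Omega> y *\<^sub>R (g y \<bullet> \<phi> y) = \<rho> (x - y) * G g y"
              using Q(2) out[of y] by (cases "y \<in> Q") (auto simp: \<phi>_def G_def sym inner_axis indicator_def)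
          qed
          finally show ?thesis .
        qed
        have \<rho>m[measurable]: "(\<lambda>y. \<rho> (x - y)) \<in> borel_measurable lebesgue"
          by (rule measurable_completion) measurable
        have int: "integrable lebesgue (\<lambda>y. \<rho> (x - y) * G g y)" if "weak_gradient \<Omega> u g" for g
        proof (rule Bochner_Integration.integrable_bound[of _ "\<lambda>y. C * G g y"])
          show "integrable lebesgue (\<lambda>y. C * G g y)" using Gint[OF that] by simp
          show "(\<lambda>y. \<rho> (x - y) * G g y) \<in> borel_measurable lebesgue"
            using \<rho>m borel_measurable_integrable[OF Gint[OF that]] by (rule borel_measurable_times)
          show "AE y in lebesgue. norm (\<rho> (x - y) * G g y) \<le> norm (C * G g y)"
            using rho_abs C_nonneg by (intro AE_I2) (auto simp: abs_mult intro!: mult_right_mono)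
        qed
        have "conv F x = (LINT y|lebesgue. \<rho> (x - y) * F y)"
          unfolding conv_def by (subst integral_completion) (use F in auto)
        also have "\<dots> = (LINT y|lebesgue. \<rho> (x - y) * G g\<^sub>1 y - \<rho> (x - y) * G g\<^sub>2 y)"
        proof (rule integral_cong_AE)
          show "(\<lambda>y. \<rho> (x - y) * F y) \<in> borel_measurable lebesgue" using \<rho>m FL by (rule borel_measurable_times)
          show "(\<lambda>y. \<rho> (x - y) * G g\<^sub>1 y - \<rho> (x - y) * G g\<^sub>2 y) \<in> borel_measurable lebesgue"
            using borel_measurable_integrable[OF int[OF g1]] borel_measurable_integrable[OF int[OF g2]] by (rule borel_measurable_diff)
          show "AE y in lebesgue. \<rho> (x - y) * F y = \<rho> (x - y) * G g\<^sub>1 y - \<rho> (x - y) * G g\<^sub>2 y"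
            using FG' by eventually_elim (simp add: right_diff_distrib[symmetric])
        qed
        also have "\<dots> = 0" using int g1 g2 eq rew by simp
        finally show ?thesis .
      qed
      have bound: "(\<integral>\<^sup>+x. ennreal (indicator (ball x0 r) x * \<bar>F x\<bar>) \<partial>lborel) \<le> ennreal e" if "e > 0" for e
      proof -
        obtain \<delta>\<^sub>0 where \<delta>\<^sub>0: "\<delta>\<^sub>0 > 0" "\<forall>\<rho> \<gamma> \<delta> C. mollifier \<rho> \<gamma> \<delta> C \<and> \<delta> < \<delta>\<^sub>0 \<longrightarrow>
            (\<integral>\<^sup>+x. ennreal (indicator (ball x0 r) x * \<bar>mollifier.conv \<rho> F x - F x\<bar>) \<partial>lborel) \<le> ennreal e"
          using mollify_L1[OF Fint bounded_ball _ \<open>e > 0\<close>, of x0 r] by auto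
        define \<delta> where "\<delta> = min \<delta>\<^sub>0 r / 2"
        have \<delta>: "0 < \<delta>" "\<delta> < \<delta>\<^sub>0" "\<delta> < r" using \<delta>\<^sub>0(1) r by (auto simp: \<delta>_def)
        obtain \<rho> :: "real ^ 'n \<Rightarrow> real" and \<gamma> C where M: "mollifier \<rho> \<gamma> \<delta> C" using mollifier_exists[OF \<delta>(1)] by blast
        have "(\<integral>\<^sup>+x. ennreal (indicator (ball x0 r) x * \<bar>F x\<bar>) \<partial>lborel)
            = (\<integral>\<^sup>+x. ennreal (indicator (ball x0 r) x * \<bar>mollifier.conv \<rho> F x - F x\<bar>) \<partial>lborel)"
          by (rule nn_integral_cong) (use conv0[OF M \<delta>(3)] in \<open>auto simp: indicator_def\<close>)
        also have "\<dots> \<le> ennreal e" using \<delta>\<^sub>0(2) M \<delta>(2) by blast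
        finally show ?thesis .
      qed
      have "(\<integral>\<^sup>+x. ennreal (indicator (ball x0 r) x * \<bar>F x\<bar>) \<partial>lborel) = 0"
        using ennreal_le_epsilon[of 0 "\<integral>\<^sup>+x. ennreal (indicator (ball x0 r) x * \<bar>F x\<bar>) \<partial>lborel"] bound by auto
      then have "AE x in lborel. ennreal (indicator (ball x0 r) x * \<bar>F x\<bar>) = 0"
        using Fb by (subst (asm) nn_integral_0_iff_AE)
          (auto intro!: borel_measurable_times borel_measurable_indicator borel_measurable_abs)
      then have "AE x in lebesgue. ennreal (indicator (ball x0 r) x * \<bar>F x\<bar>) = 0" by (simp only: AE_lborel_iff_lebesgue)
      with FG' show ?thesis
      proof eventually_elim
        case (elim x)
        have "x \<in> Q" if "x \<in> ball x0 r" using that r by (auto simp: Q_def)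
        then show ?case using elim by (auto simp: G_def)
      qed
    qed
    have "AE x in lebesgue. \<forall>i. x \<in> ball x0 r \<longrightarrow> g\<^sub>1 x $ i = g\<^sub>2 x $ i"
      using AE_finite_allI[of UNIV "\<lambda>i x. x \<in> ball x0 r \<longrightarrow> g\<^sub>1 x $ i = g\<^sub>2 x $ i" lebesgue] comp by simp
    then have "AE x in lebesgue. x \<in> ball x0 r \<longrightarrow> g\<^sub>1 x = g\<^sub>2 x" by (simp add: vec_eq_iff)
    then show ?thesis using r by (intro exI[of _ "ball x0 r"]) auto
  qed
  define S where "S = {x \<in> \<Omega>. g\<^sub>1 x \<noteq> g\<^sub>2 x}"
  have "negligible S"
  proof (rule locally_negligible_alt[THEN iffD2], rule ballI)
    fix x0 assume "x0 \<in> S"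
    then obtain U where U: "open U" "x0 \<in> U" "AE x in lebesgue. x \<in> U \<longrightarrow> g\<^sub>1 x = g\<^sub>2 x" using loc[of x0] by (auto simp: S_def)
    obtain N where N: "{x \<in> space lebesgue. \<not> (x \<in> U \<longrightarrow> g\<^sub>1 x = g\<^sub>2 x)} \<subseteq> N"
      "emeasure lebesgue N = 0" "N \<in> sets lebesgue"
      by (rule AE_E[OF U(3)])
    have "negligible N" unfolding negligible_iff_null_sets by (rule null_setsI[OF N(2,3)])
    then have "negligible (S \<inter> U)" by (rule negligible_subset) (use N(1) in \<open>auto simp: S_def\<close>)
    then show "\<exists>U. openin (top_of_set S) U \<and> x0 \<in> U \<and> negligible U"
      using U \<open>x0 \<in> S\<close> by (intro exI[of _ "S \<inter> U"]) (auto simp: openin_open_Int)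
  qed
  then have "AE x in lebesgue. x \<notin> S" by (simp add: negligible_iff_null_sets AE_not_in)
  then show ?thesis using \<Omega> by (subst AE_restrict_space_iff) (auto simp: S_def elim: AE_mp)
qed

lemma TV_cong_AE:
  fixes U :: "(real ^ 'n) set"
  assumes U: "open U" and f: "f \<in> borel_measurable (lebesgue_on U)" "g \<in> borel_measurable (lebesgue_on U)"
    and AE: "AE x in lebesgue_on U. f x = g x"
  shows "TV U f = TV U g"
  unfolding TV_def
proof (rule SUP_cong[OF refl])
  fix \<phi> assume "\<phi> \<in> {\<phi> \<in> C1c U. \<forall>x. norm (\<phi> x) \<le> 1}"
  then have "\<phi> \<in> C1c U" by simp
  then have "continuous_on UNIV (divergence \<phi>)"
    by (rule C1cE) (auto simp: fun_eq_iff intro!: continuous_intros cong: continuous_on_cong)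
  then have d: "divergence \<phi> \<in> borel_measurable (lebesgue_on U)"
    by (intro measurable_restrict_space1 measurable_completion) (simp add: borel_measurable_continuous_onI)
  have "(LINT x|lebesgue_on U. f x * divergence \<phi> x) = (LINT x|lebesgue_on U. g x * divergence \<phi> x)"
    by (rule integral_cong_AE) (use f d AE in \<open>auto intro: borel_measurable_times elim: AE_mp\<close>)
  then show "ennreal (LINT x|lebesgue_on U. f x * divergence \<phi> x) = ennreal (LINT x|lebesgue_on U. g x * divergence \<phi> x)"
    by simp
qed

lemma TV_le_weak_gradient:
  assumes g: "weak_gradient \<Omega> u g"
  shows "TV \<Omega> u \<le> (\<integral>\<^sup>+x. ennreal (norm (g x)) \<partial>lebesgue_on \<Omega>)"
  unfolding TV_def
proof (rule SUP_least)
  fix \<phi> assume \<phi>: "\<phi> \<in> {\<phi> \<in> C1c \<Omega>. \<forall>x. norm (\<phi> x) \<le> 1}"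
  then have "(LINT x|lebesgue_on \<Omega>. u x * divergence \<phi> x) = - (LINT x|lebesgue_on \<Omega>. g x \<bullet> \<phi> x)"
    using g by (simp add: weak_gradient_def)
  also have "ennreal \<dots> \<le> ennreal (norm (LINT x|lebesgue_on \<Omega>. g x \<bullet> \<phi> x))" by (intro ennreal_leI) simp
  also have "\<dots> \<le> (\<integral>\<^sup>+x. ennreal (norm (g x \<bullet> \<phi> x)) \<partial>lebesgue_on \<Omega>)"
  \<comment> \<open>In the nonintegrable case the Bochner integral has the default value 0.\<close>
  proof (cases "integrable (lebesgue_on \<Omega>) (\<lambda>x. g x \<bullet> \<phi> x)")
    case True
    then show ?thesis by (rule integral_norm_bound_ennreal)
  qed (simp add: not_integrable_integral_eq)
  also have "\<dots> \<le> (\<integral>\<^sup>+x. ennreal (norm (g x)) \<partial>lebesgue_on \<Omega>)"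
  proof (intro nn_integral_mono ennreal_leI)
    fix x
    have "norm (g x \<bullet> \<phi> x) \<le> norm (g x) * norm (\<phi> x)" using Cauchy_Schwarz_ineq2 by simp
    also have "\<dots> \<le> norm (g x) * 1" using \<phi> by (intro mult_left_mono) auto
    finally show "norm (g x \<bullet> \<phi> x) \<le> norm (g x)" by simp
  qed
  finally show "ennreal (LINT x|lebesgue_on \<Omega>. u x * divergence \<phi> x) \<le> (\<integral>\<^sup>+x. ennreal (norm (g x)) \<partial>lebesgue_on \<Omega>)" .
qed

section \<open>Recovery sequences\<close>

lemma arctan_diff_le: "\<bar>arctan a - arctan b\<bar> \<le> \<bar>a - b\<bar>"
proof -
  have *: "arctan y - arctan x \<le> y - x" if xy: "x < y" for x y :: real
  proof -
    have "\<exists>z>x. z < y \<and> arctan y - arctan x = (y - x) * inverse (1 + z\<^sup>2)"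
      by (rule MVT2[OF xy DERIV_arctan])
    then obtain z where "arctan y - arctan x = (y - x) * inverse (1 + z\<^sup>2)" by blast
    moreover have "(y - x) * inverse (1 + z\<^sup>2) \<le> (y - x) * 1"
      using xy by (intro mult_left_mono) (auto simp: inverse_le_1_iff)
    ultimately show ?thesis by simp
  qed
  show ?thesis
  proof (cases a b rule: linorder_cases)
    case less
    then show ?thesis using *[OF less] arctan_monotone[OF less] by simp
  next
    case greater
    then show ?thesis using *[OF greater] arctan_monotone[OF greater] by simp
  qed simp
qed

text \<open>A smooth substitute for clamping at height about \<open>k\<close>: it is bounded by
  \<open>2 * k\<close>, is 1-Lipschitz and tends to the identity as \<open>k\<close> grows. Being
  differentiable, it keeps a truncated mollification continuously differentiable.\<close>

definition trunc :: "real \<Rightarrow> real \<Rightarrow> real" where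
  "trunc k s = k * arctan (s / k)"

lemma trunc_lipschitz: "0 < k \<Longrightarrow> \<bar>trunc k a - trunc k b\<bar> \<le> \<bar>a - b\<bar>"
proof -
  assume "0 < k"
  then have "\<bar>trunc k a - trunc k b\<bar> = k * \<bar>arctan (a / k) - arctan (b / k)\<bar>"
    by (simp add: trunc_def right_diff_distrib[symmetric] abs_mult)
  also have "\<dots> \<le> k * \<bar>a / k - b / k\<bar>" using \<open>0 < k\<close> by (intro mult_left_mono arctan_diff_le) auto
  also have "\<dots> = \<bar>a - b\<bar>" using \<open>0 < k\<close> by (simp add: diff_divide_distrib[symmetric])
  finally show ?thesis .
qed

lemma trunc_bound: "0 < k \<Longrightarrow> \<bar>trunc k a\<bar> \<le> 2 * k"
proof -
  assume "0 < k"
  have "\<bar>arctan (a / k)\<bar> \<le> 2" using arctan_ubound[of "a / k"] arctan_lbound[of "a / k"] pi_less_4 by linarith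
  then show ?thesis using \<open>0 < k\<close> by (simp add: trunc_def abs_mult mult.commute[of k] mult_right_mono)
qed

lemma trunc_abs_le: "0 < k \<Longrightarrow> \<bar>trunc k a\<bar> \<le> \<bar>a\<bar>"
  using trunc_lipschitz[of k a 0] by (simp add: trunc_def)

text \<open>One factor of the square is estimated by boundedness, the other by the Lipschitz
  property. For fixed \<open>k\<close>, closeness in the mean thus becomes closeness in the square
  mean.\<close>

lemma trunc_sq_diff: "0 < k \<Longrightarrow> (trunc k a - trunc k b)\<^sup>2 \<le> 4 * k * \<bar>a - b\<bar>"
proof -
  assume k: "0 < k"
  have "(trunc k a - trunc k b)\<^sup>2 = \<bar>trunc k a - trunc k b\<bar> * \<bar>trunc k a - trunc k b\<bar>" by (simp add: power2_eq_square)
  also have "\<dots> \<le> (2 * k + 2 * k) * \<bar>a - b\<bar>"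
  proof (rule mult_mono)
    show "\<bar>trunc k a - trunc k b\<bar> \<le> 2 * k + 2 * k" using trunc_bound[OF k, of a] trunc_bound[OF k, of b] by linarith
  qed (use k trunc_lipschitz in auto)
  finally show ?thesis by simp
qed

lemma trunc_has_derivative: "0 < k \<Longrightarrow> (trunc k has_real_derivative 1 / (1 + (s / k)\<^sup>2)) (at s)"
  unfolding trunc_def by (auto intro!: derivative_eq_intros simp: divide_inverse)

lemma trunc_tendsto: "(\<lambda>n. trunc (real (Suc n)) s) \<longlonglongrightarrow> s"
proof -
  have "((\<lambda>t. arctan (s * t)) has_real_derivative s) (at 0)"
    by (auto intro!: derivative_eq_intros)
  then have "((\<lambda>h. arctan (s * h) / h) \<longlongrightarrow> s) (at 0)" by (simp add: DERIV_def)
  moreover have "filterlim (\<lambda>n. inverse (real (Suc n))) (at 0) sequentially"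
    using LIMSEQ_inverse_real_of_nat by (auto simp: filterlim_at)
  ultimately have "(\<lambda>n. arctan (s * inverse (real (Suc n))) / inverse (real (Suc n))) \<longlonglongrightarrow> s"
    by (rule filterlim_compose)
  then show ?thesis by (simp add: trunc_def divide_inverse mult.commute)
qed

text \<open>A connected set that meets \<Omega> but not its frontier lies in \<Omega>.\<close>

lemma cball_subset_of_frontier_disjoint:
  fixes \<Omega> :: "'a::euclidean_space set"
  assumes "x \<in> \<Omega>" "0 \<le> \<delta>" "cball x \<delta> \<inter> frontier \<Omega> = {}"
  shows "cball x \<delta> \<subseteq> \<Omega>"
proof -
  have "x \<in> cball x \<delta> \<inter> \<Omega>" using assms by simp
  then show ?thesis
    using connected_Int_frontier[of "cball x \<delta>" \<Omega>] assms(3) convex_connected[OF convex_cball] by blast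
qed

text \<open>
  The energy of the mollified extension on \<open>\<Omega>\<close> is split at a small distance from the boundary: in the
  interior it is controlled by the total variation of \<open>w\<close>, near the boundary by the total variation of
  the extension in a neighbourhood of the boundary, which is small. The extension need not be square
  integrable, so the mollification is truncated afterwards.
\<close>

lemma recovery:
  fixes \<Omega> :: "(real ^ 'n) set"
  assumes bdd: "bounded \<Omega>" and ext: "extension_domain \<Omega>" and w: "w \<in> L2 \<Omega>" and TVw: "TV \<Omega> w < \<infinity>" and "0 < \<eta>"
  shows "\<exists>v g. (\<forall>x. (v has_derivative (\<lambda>h. g x \<bullet> h)) (at x)) \<and> continuous_on UNIV g \<and> v \<in> L2 \<Omega> \<and>
    norm (cls \<Omega> v - cls \<Omega> w) < \<eta> \<and>
    ennreal (LINT x|lborel. indicator \<Omega> x * norm (g x)) \<le> TV \<Omega> w + ennreal \<eta>"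
proof -
  have \<Omega>: "open \<Omega>" using ext by (simp add: extension_domain_def)
  have \<Omega>s: "\<Omega> \<in> sets lebesgue" "\<Omega> \<in> sets borel" using \<Omega> by auto
  have \<Omega>fin: "emeasure lborel \<Omega> < \<infinity>" using bdd by (rule emeasure_bounded_finite)
  have \<Omega>space: "space (lebesgue_on \<Omega>) = \<Omega>" by (simp add: space_restrict_space)
  interpret fin: finite_measure "lebesgue_on \<Omega>"
    by (rule finite_measureI) (use \<Omega>fin \<Omega>s in \<open>simp add: \<Omega>space emeasure_restrict_space less_top\<close>)
  have wm: "w \<in> borel_measurable (lebesgue_on \<Omega>)" and w2: "integrable (lebesgue_on \<Omega>) (\<lambda>x. (w x)\<^sup>2)"
    using w by (simp_all add: L2_iff)
  have w1: "integrable (lebesgue_on \<Omega>) w"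
    using integrable_mult_of_squares[OF wm _ w2, of "\<lambda>_. 1"] by simp
  define u where "u = (\<lambda>i::nat. w)"
  have "w \<in> BV \<Omega>" using w1 TVw by (simp add: BV_def L1_iff)
  then have u: "u \<in> vec_space 1 (BV \<Omega>)" by (simp add: u_def vec_space_def)
  obtain T where T: "extension_operator 1 \<Omega> UNIV T"
    using ext by (auto simp: extension_domain_def)
  define f0 where "f0 = T u 0"
  have "T u \<in> vec_space 1 (BV UNIV)" using T u by (simp add: extension_operator_def)
  then have "integrable (lebesgue_on UNIV) f0" by (simp add: vec_space_def BV_def L1_iff f0_def)
  then have f0: "integrable lebesgue f0" by (simp add: lebesgue_on_UNIV_eq)
  have f0w: "AE x in lebesgue_on \<Omega>. f0 x = w x"
    using T u unfolding extension_operator_def f0_def by (auto simp: u_def)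
  have "variation_measure 1 (T u) (frontier \<Omega>) = 0" using T u by (simp add: extension_operator_def)
  then have "(INF A\<in>{A. open A \<and> frontier \<Omega> \<subseteq> A}. variation 1 A (T u)) < ennreal (\<eta> / 2)"
    using \<open>0 < \<eta>\<close> by (simp add: variation_measure_def)
  then obtain A where A: "open A" "frontier \<Omega> \<subseteq> A" "variation 1 A (T u) < ennreal (\<eta> / 2)"
    by (auto simp: INF_less_iff)
  \<comment> \<open>The extension is replaced by a Borel version, to which the mollification
    applies.\<close>
  obtain f where fm: "f \<in> borel_measurable lborel" and f0f: "AE x in lborel. f0 x = f x"
    using completion_ex_borel_measurable_real[OF borel_measurable_integrable[OF f0]] by blast
  have f0f': "AE x in lebesgue. f0 x = f x" using f0f by (simp add: AE_lborel_iff_lebesgue)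
  have fL: "f \<in> borel_measurable lebesgue" by (rule measurable_completion[OF fm])
  have "integrable lebesgue f"
    using integrable_cong_AE_imp[OF f0 fL] f0f' by (simp add: eq_commute)
  then have f: "integrable lborel f" using fm by (simp add: integrable_completion)
  have onU: "AE x in lebesgue_on U. f0 x = f x" "f0 \<in> borel_measurable (lebesgue_on U)" "f \<in> borel_measurable (lebesgue_on U)"
    if "open U" for U
    using that f0f' borel_measurable_integrable[OF f0] fL
    by (auto simp: AE_restrict_space_iff intro: measurable_restrict_space1 elim: AE_mp)
  have TVA: "TV A f \<le> ennreal (\<eta> / 2)"
  proof -
    have "TV A f = TV A f0" by (rule TV_cong_AE[OF A(1)]) (use onU[OF A(1)] in \<open>auto elim: AE_mp\<close>)
    \<comment> \<open>Every field admissible in \<open>TV\<close> is a family of one admissible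
      field in \<open>variation\<close>.\<close>
    also have "\<dots> \<le> variation 1 A (T u)"
      unfolding TV_def
    proof (rule SUP_least)
      fix \<phi> assume \<phi>: "\<phi> \<in> {\<phi> \<in> C1c A. \<forall>x. norm (\<phi> x) \<le> 1}"
      show "ennreal (LINT x|lebesgue_on A. f0 x * divergence \<phi> x) \<le> variation 1 A (T u)"
        unfolding variation_def by (rule SUP_upper2[of "\<lambda>_. \<phi>"]) (use \<phi> in \<open>auto simp: f0_def power_le_one\<close>)
    qed
    finally show ?thesis using A(3) by simp
  qed
  have fw: "AE x in lebesgue_on \<Omega>. f x = w x"
    using f0w onU(1)[OF \<Omega>] by eventually_elim simp
  have TV\<Omega>: "TV \<Omega> f = TV \<Omega> w" by (rule TV_cong_AE[OF \<Omega> onU(3)[OF \<Omega>] wm fw])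

  \<comment> \<open>The truncation level is fixed before the mollification radius, because the
    latter has to beat a factor proportional to \<open>k\<close>.\<close>
  have "(\<lambda>n. LINT x|lebesgue_on \<Omega>. (trunc (real (Suc n)) (w x) - w x)\<^sup>2) \<longlonglongrightarrow> (LINT x|lebesgue_on \<Omega>. 0)"
  proof (rule integral_dominated_convergence[where w = "\<lambda>x. 4 * (w x)\<^sup>2"])
    show "(\<lambda>x. (trunc (real (Suc n)) (w x) - w x)\<^sup>2) \<in> borel_measurable (lebesgue_on \<Omega>)" for n
      unfolding trunc_def using wm by measurable
    show "AE x in lebesgue_on \<Omega>. norm ((trunc (real (Suc n)) (w x) - w x)\<^sup>2) \<le> 4 * (w x)\<^sup>2" for n
    proof (rule AE_I2)
      fix x
      have "\<bar>trunc (real (Suc n)) (w x) - w x\<bar> \<le> 2 * \<bar>w x\<bar>" using trunc_abs_le[of "real (Suc n)" "w x"] by linarith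
      then show "norm ((trunc (real (Suc n)) (w x) - w x)\<^sup>2) \<le> 4 * (w x)\<^sup>2"
        using power_mono[of "\<bar>trunc (real (Suc n)) (w x) - w x\<bar>" "2 * \<bar>w x\<bar>" 2] by (simp add: power_mult_distrib)
    qed
    show "AE x in lebesgue_on \<Omega>. (\<lambda>n. (trunc (real (Suc n)) (w x) - w x)\<^sup>2) \<longlonglongrightarrow> 0"
    proof (rule AE_I2)
      fix x
      have "(\<lambda>n. (trunc (real (Suc n)) (w x) - w x)\<^sup>2) \<longlonglongrightarrow> (w x - w x)\<^sup>2"
        by (intro tendsto_intros trunc_tendsto)
      then show "(\<lambda>n. (trunc (real (Suc n)) (w x) - w x)\<^sup>2) \<longlonglongrightarrow> 0" by simp
    qed
  qed (use w2 in auto)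
  then have "\<forall>\<^sub>F n in sequentially. (LINT x|lebesgue_on \<Omega>. (trunc (real (Suc n)) (w x) - w x)\<^sup>2) < (\<eta> / 2)\<^sup>2"
    using \<open>0 < \<eta>\<close> by (intro order_tendstoD(2)) auto
  then obtain n where n: "(LINT x|lebesgue_on \<Omega>. (trunc (real (Suc n)) (w x) - w x)\<^sup>2) < (\<eta> / 2)\<^sup>2"
    unfolding eventually_sequentially by blast
  define k where "k = real (Suc n)"
  have "0 < k" by (simp add: k_def)

  have frc: "compact (frontier \<Omega>)" using ext by (simp add: extension_domain_def compact_eq_bounded_closed)
  obtain R where R: "R > 0" "(\<Union>x\<in>frontier \<Omega>. cball x R) \<subseteq> A"
    using compact_subset_open_imp_cball_epsilon_subset[OF frc A(1,2)] by blast
  define r where "r = R / 2"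
  have "r > 0" using R by (simp add: r_def)
  \<comment> \<open>The radii are nested: a ball of radius \<open>\<delta> \<le> r / 2\<close>
    around a point of \<open>B1\<close> keeps distance \<open>r / 2\<close> from the frontier, hence
    lies in \<open>K1\<close>; around a point of \<open>B2\<close> it stays within
    \<open>3 * r / 2 \<le> R\<close> of the frontier, hence lies in \<open>K2\<close>.\<close>
  define B1 where "B1 = \<Omega> - (\<Union>y\<in>frontier \<Omega>. ball y r)"
  define B2 where "B2 = \<Omega> \<inter> (\<Union>y\<in>frontier \<Omega>. ball y r)"
  define K1 where "K1 = closure \<Omega> - (\<Union>y\<in>frontier \<Omega>. ball y (r / 2))"
  define K2 where "K2 = {y + z |y z. y \<in> frontier \<Omega> \<and> z \<in> cball 0 R}"
  have o: "open (\<Union>y\<in>frontier \<Omega>. ball y s)" for s by (intro open_UN ballI open_ball)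
  have B: "B1 \<in> sets borel" "B2 \<in> sets borel" using \<Omega>s o by (auto simp: B1_def B2_def)
  have K1: "compact K1" unfolding K1_def by (intro compact_diff o) (use bdd in \<open>simp add: compact_closure\<close>)
  have K1\<Omega>: "K1 \<subseteq> \<Omega>"
  proof
    fix x assume x: "x \<in> K1"
    then have "x \<notin> frontier \<Omega>" using \<open>r > 0\<close> by (force simp: K1_def)
    then show "x \<in> \<Omega>" using x interior_subset by (auto simp: K1_def frontier_def)
  qed
  have K2: "compact K2" unfolding K2_def by (rule compact_sums[OF frc compact_cball])
  have K2A: "K2 \<subseteq> A"
  proof
    fix x assume "x \<in> K2"
    then obtain y z where "x = y + z" "y \<in> frontier \<Omega>" "norm z \<le> R" by (auto simp: K2_def)
    then have "x \<in> cball y R" by (simp add: dist_norm)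
    then show "x \<in> A" using R(2) \<open>y \<in> frontier \<Omega>\<close> by blast
  qed

  \<comment> \<open>Chosen so that the factor \<open>4 * k\<close> of \<open>trunc_sq_diff\<close>
    turns it into \<open>(\<eta> / 4)\<^sup>2\<close>.\<close>
  define e1 where "e1 = \<eta>\<^sup>2 / (64 * k)"
  have "e1 > 0" using \<open>0 < \<eta>\<close> \<open>0 < k\<close> by (simp add: e1_def)
  obtain \<delta>\<^sub>0 where \<delta>\<^sub>0: "\<delta>\<^sub>0 > 0" "\<forall>\<rho> \<gamma> \<delta> C. mollifier \<rho> \<gamma> \<delta> C \<and> \<delta> < \<delta>\<^sub>0 \<longrightarrow>
      (\<integral>\<^sup>+x. ennreal (indicator \<Omega> x * \<bar>mollifier.conv \<rho> f x - f x\<bar>) \<partial>lborel) \<le> ennreal e1"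
    using mollify_L1[OF f bdd \<Omega>s(2) \<open>e1 > 0\<close>] by auto
  define \<delta> where "\<delta> = min (\<delta>\<^sub>0 / 2) (r / 2)"
  have del: "0 < \<delta>" "\<delta> < \<delta>\<^sub>0" "\<delta> \<le> r / 2" using \<delta>\<^sub>0(1) \<open>r > 0\<close> by (auto simp: \<delta>_def)
  obtain \<rho> :: "real ^ 'n \<Rightarrow> real" and \<gamma> C where M: "mollifier \<rho> \<gamma> \<delta> C" using mollifier_exists[OF del(1)] by blast
  interpret mollifier \<rho> \<gamma> \<delta> C by (rule M)
  have near1: "cball x \<delta> \<subseteq> K1" if x: "x \<in> B1" for x
  proof -
    have far: "r \<le> dist y x" if "y \<in> frontier \<Omega>" for y using x that by (force simp: B1_def)
    have "cball x \<delta> \<inter> frontier \<Omega> = {}"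
    proof (rule equals0I)
      fix y assume "y \<in> cball x \<delta> \<inter> frontier \<Omega>"
      then show False using far[of y] del \<open>r > 0\<close> by (simp add: dist_commute)
    qed
    then have sub: "cball x \<delta> \<subseteq> \<Omega>"
      using x del by (intro cball_subset_of_frontier_disjoint) (auto simp: B1_def)
    show ?thesis
    proof
      fix z assume z: "z \<in> cball x \<delta>"
      have "r / 2 \<le> dist y z" if "y \<in> frontier \<Omega>" for y
        using far[OF that] dist_triangle[of y x z] z del(3) by (simp add: dist_commute)
      then show "z \<in> K1" using sub z closure_subset by (force simp: K1_def)
    qed
  qed
  have near2: "cball x \<delta> \<subseteq> K2" if x: "x \<in> B2" for x
  proof
    obtain y where y: "y \<in> frontier \<Omega>" "dist y x < r" using x by (auto simp: B2_def)
    fix z assume "z \<in> cball x \<delta>"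
    then have "dist y z \<le> R" using dist_triangle[of y z x] y(2) del(3) \<open>r > 0\<close> by (simp add: r_def)
    then have "z = y + (z - y) \<and> z - y \<in> cball 0 R" by (simp add: dist_norm norm_minus_commute)
    then show "z \<in> K2" unfolding K2_def using y(1) by blast
  qed
  note m1 = grad_conv_le_TV[OF M f B(1) \<Omega> K1 K1\<Omega> near1]
  note m2 = grad_conv_le_TV[OF M f B(2) A(1) K2 K2A near2]
  have split: "indicator \<Omega> x * norm (grad_conv f x) = indicator B1 x * norm (grad_conv f x) + indicator B2 x * norm (grad_conv f x)" for x
    by (auto simp: B1_def B2_def indicator_def)
  have energy: "ennreal (LINT x|lborel. indicator \<Omega> x * norm (grad_conv f x)) \<le> TV \<Omega> w + ennreal \<eta>"
  proof -
    have "ennreal (LINT x|lborel. indicator \<Omega> x * norm (grad_conv f x))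
       = ennreal (LINT x|lborel. indicator B1 x * norm (grad_conv f x)) + ennreal (LINT x|lborel. indicator B2 x * norm (grad_conv f x))"
      unfolding split using m1(1) m2(1)
      by (subst Bochner_Integration.integral_add) (auto intro!: ennreal_plus Bochner_Integration.integral_nonneg)
    also have "\<dots> \<le> TV \<Omega> f + TV A f" using m1(2) m2(2) by (rule add_mono)
    also have "\<dots> \<le> TV \<Omega> w + ennreal \<eta>"
      unfolding TV\<Omega> using order_trans[OF TVA ennreal_leI[of "\<eta> / 2" \<eta>]] \<open>0 < \<eta>\<close> by (intro add_left_mono) simp
    finally show ?thesis .
  qed
  define v where "v x = trunc k (conv f x)" for x
  define g where "g x = (1 / (1 + (conv f x / k)\<^sup>2)) *\<^sub>R grad_conv f x" for x
  have vd: "(v has_derivative (\<lambda>h. g x \<bullet> h)) (at x)" for x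
  proof -
    have "(conv f has_derivative (\<lambda>h. grad_conv f x \<bullet> h)) (at x)"
    proof -
      have "dconv f x = (\<lambda>h. grad_conv f x \<bullet> h)" by (simp add: fun_eq_iff dconv_grad[OF f])
      then show ?thesis using conv_has_derivative[OF f, of x] by simp
    qed
    moreover have "(trunc k has_derivative (*) (1 / (1 + (conv f x / k)\<^sup>2))) (at (conv f x))"
      using trunc_has_derivative[OF \<open>0 < k\<close>, of "conv f x"] unfolding has_field_derivative_def .
    ultimately show ?thesis
      unfolding v_def g_def inner_scaleR_left by (rule has_derivative_compose)
  qed
  have vc: "continuous_on UNIV v" by (rule has_derivative_continuous_on) (rule vd)
  have cc: "continuous_on UNIV (conv f)" by (rule has_derivative_continuous_on) (rule conv_has_derivative[OF f])
  have pos: "0 < 1 + (conv f x / k)\<^sup>2" for x by (simp add: add_pos_nonneg)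
  have gc: "continuous_on UNIV g"
    unfolding g_def using pos \<open>0 < k\<close>
    by (intro continuous_intros cc continuous_grad_conv[OF f]) (auto simp: less_imp_neq[symmetric] dest: less_imp_neq)
  have g_le: "norm (g x) \<le> norm (grad_conv f x)" for x
  proof -
    have "\<bar>1 / (1 + (conv f x / k)\<^sup>2)\<bar> \<le> 1" using pos[of x] by (simp add: divide_le_eq_1_pos)
    then show ?thesis unfolding g_def using mult_right_mono[of "\<bar>1 / (1 + (conv f x / k)\<^sup>2)\<bar>" 1 "norm (grad_conv f x)"] by simp
  qed
  have vm: "v \<in> borel_measurable (lebesgue_on U)" for U
    by (intro measurable_restrict_space1 measurable_completion) (simp add: borel_measurable_continuous_onI[OF vc])
  have vL: "v \<in> L2 \<Omega>"
    unfolding L2_iff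
  proof
    show "integrable (lebesgue_on \<Omega>) (\<lambda>x. (norm (v x))\<^sup>2)"
    proof (rule fin.integrable_const_bound[of _ "(2 * k)\<^sup>2"])
      show "AE x in lebesgue_on \<Omega>. norm ((norm (v x))\<^sup>2) \<le> (2 * k)\<^sup>2"
        using power_mono[OF trunc_bound[OF \<open>0 < k\<close>] abs_ge_zero, of _ 2] by (intro AE_I2) (simp add: v_def)
      show "(\<lambda>x. (norm (v x))\<^sup>2) \<in> borel_measurable (lebesgue_on \<Omega>)" using vm by measurable
    qed
  qed (rule vm)
  have tw: "(\<lambda>x. trunc k (w x)) \<in> L2 \<Omega>"
    unfolding L2_iff
  proof
    show m: "(\<lambda>x. trunc k (w x)) \<in> borel_measurable (lebesgue_on \<Omega>)" unfolding trunc_def using wm by measurable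
    show "integrable (lebesgue_on \<Omega>) (\<lambda>x. (norm (trunc k (w x)))\<^sup>2)"
    proof (rule Bochner_Integration.integrable_bound[OF w2])
      show "AE x in lebesgue_on \<Omega>. norm ((norm (trunc k (w x)))\<^sup>2) \<le> norm ((w x)\<^sup>2)"
        using trunc_abs_le[OF \<open>0 < k\<close>] by (intro AE_I2) (simp add: abs_le_square_iff)
      show "(\<lambda>x. (norm (trunc k (w x)))\<^sup>2) \<in> borel_measurable (lebesgue_on \<Omega>)" using m by measurable
    qed
  qed
  have d1: "norm (cls \<Omega> (\<lambda>x. trunc k (w x)) - cls \<Omega> w) < \<eta> / 2"
  proof -
    have "norm (cls \<Omega> (\<lambda>x. trunc k (w x)) - cls \<Omega> w) = sqrt (LINT x|lebesgue_on \<Omega>. (trunc k (w x) - w x)\<^sup>2)"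
      using norm_cls[OF \<Omega>s(1) L2_diff[OF \<Omega>s(1) tw w]] cls_diff[OF \<Omega>s(1) tw w] by simp
    also have "\<dots> < sqrt ((\<eta> / 2)\<^sup>2)" using n unfolding k_def by (rule real_sqrt_less_mono)
    finally show ?thesis using \<open>0 < \<eta>\<close> by simp
  qed
  have d2: "norm (cls \<Omega> v - cls \<Omega> (\<lambda>x. trunc k (w x))) < \<eta> / 2"
  proof -
    have L: "(\<lambda>x. v x - trunc k (w x)) \<in> L2 \<Omega>" by (rule L2_diff[OF \<Omega>s(1) vL tw])
    then have i: "integrable (lebesgue_on \<Omega>) (\<lambda>x. (v x - trunc k (w x))\<^sup>2)" by (simp add: L2_iff)
    have [measurable]: "f \<in> borel_measurable borel" "conv f \<in> borel_measurable borel"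
      using fm by (simp_all add: borel_measurable_continuous_onI[OF cc])
    have [measurable]: "\<Omega> \<in> sets borel" by (rule \<Omega>s(2))
    have "ennreal (LINT x|lebesgue_on \<Omega>. (v x - trunc k (w x))\<^sup>2) = (\<integral>\<^sup>+x. ennreal ((v x - trunc k (w x))\<^sup>2) \<partial>lebesgue_on \<Omega>)"
      by (rule nn_integral_eq_integral[OF i, symmetric]) simp
    also have "\<dots> \<le> (\<integral>\<^sup>+x. ennreal (4 * k * \<bar>conv f x - f x\<bar>) \<partial>lebesgue_on \<Omega>)"
    proof (rule nn_integral_mono_AE)
      show "AE x in lebesgue_on \<Omega>. ennreal ((v x - trunc k (w x))\<^sup>2) \<le> ennreal (4 * k * \<bar>conv f x - f x\<bar>)"
        using fw
      proof eventually_elim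
        case (elim x)
        then show ?case using trunc_sq_diff[OF \<open>0 < k\<close>, of "conv f x" "w x"] by (simp add: v_def ennreal_leI)
      qed
    qed
    also have "\<dots> = (\<integral>\<^sup>+x. ennreal (4 * k) * ennreal (indicator \<Omega> x * \<bar>conv f x - f x\<bar>) \<partial>lebesgue)"
      using \<Omega>s by (subst nn_integral_restrict_space)
        (auto intro!: nn_integral_cong simp: indicator_def ennreal_mult[symmetric] \<open>0 < k\<close> less_imp_le)
    also have "\<dots> = (\<integral>\<^sup>+x. ennreal (4 * k) * ennreal (indicator \<Omega> x * \<bar>conv f x - f x\<bar>) \<partial>lborel)"
      by (simp add: nn_integral_completion)
    also have "\<dots> = ennreal (4 * k) * (\<integral>\<^sup>+x. ennreal (indicator \<Omega> x * \<bar>conv f x - f x\<bar>) \<partial>lborel)"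
      by (rule nn_integral_cmult) measurable
    also have "\<dots> \<le> ennreal (4 * k) * ennreal e1"
      using \<delta>\<^sub>0(2) M del(2) by (intro mult_left_mono) auto
    also have "\<dots> = ennreal ((\<eta> / 4)\<^sup>2)"
      using \<open>0 < k\<close> \<open>e1 > 0\<close> by (simp add: ennreal_mult[symmetric] e1_def power_divide)
    finally have "(LINT x|lebesgue_on \<Omega>. (v x - trunc k (w x))\<^sup>2) \<le> (\<eta> / 4)\<^sup>2" by simp
    then have "sqrt (LINT x|lebesgue_on \<Omega>. (v x - trunc k (w x))\<^sup>2) \<le> \<eta> / 4"
      using \<open>0 < \<eta>\<close> by (intro real_le_lsqrt) auto
    moreover have "norm (cls \<Omega> v - cls \<Omega> (\<lambda>x. trunc k (w x))) = sqrt (LINT x|lebesgue_on \<Omega>. (v x - trunc k (w x))\<^sup>2)"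
      using norm_cls[OF \<Omega>s(1) L] cls_diff[OF \<Omega>s(1) vL tw] by simp
    ultimately show ?thesis using \<open>0 < \<eta>\<close> by simp
  qed
  have "norm (cls \<Omega> v - cls \<Omega> w) < \<eta>"
    using d1 d2 norm_triangle_ineq[of "cls \<Omega> v - cls \<Omega> (\<lambda>x. trunc k (w x))" "cls \<Omega> (\<lambda>x. trunc k (w x)) - cls \<Omega> w"] by simp
  moreover have "ennreal (LINT x|lborel. indicator \<Omega> x * norm (g x)) \<le> TV \<Omega> w + ennreal \<eta>"
  proof (rule order_trans[OF ennreal_leI energy])
    have gi: "integrable lborel (\<lambda>x. indicator \<Omega> x * norm (grad_conv f x))" unfolding split using m1(1) m2(1) by simp
    have [measurable]: "g \<in> borel_measurable borel" "\<Omega> \<in> sets borel" using borel_measurable_continuous_onI[OF gc] \<Omega>s by simp_all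
    have "integrable lborel (\<lambda>x. indicator \<Omega> x * norm (g x))"
      by (rule Bochner_Integration.integrable_bound[OF gi]) (use g_le in \<open>auto simp: abs_mult intro!: AE_I2 mult_left_mono\<close>)
    then show "(LINT x|lborel. indicator \<Omega> x * norm (g x)) \<le> (LINT x|lborel. indicator \<Omega> x * norm (grad_conv f x))"
      using gi g_le by (intro integral_mono) (auto intro: mult_left_mono)
  qed
  ultimately show ?thesis using vd gc vL by blast
qed

section \<open>Convergence of the flows\<close>

lemma C1c_scale:
  assumes "\<phi> \<in> C1c U"
  shows "(\<lambda>x. c *\<^sub>R \<phi> x) \<in> C1c U" "divergence (\<lambda>x. c *\<^sub>R \<phi> x) x = c * divergence \<phi> x"
proof -
  obtain D K where D: "\<And>x. (\<phi> has_derivative D x) (at x)" "\<And>h. continuous_on UNIV (\<lambda>x. D x h)"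
    and K: "compact K" "K \<subseteq> U" "\<And>x. x \<notin> K \<Longrightarrow> \<phi> x = 0"
    and div: "\<And>x. divergence \<phi> x = (\<Sum>i\<in>UNIV. D x (axis i 1) $ i)"
    using assms by (rule C1cE) blast
  have cD: "((\<lambda>x. c *\<^sub>R \<phi> x) has_derivative (\<lambda>h. c *\<^sub>R D x h)) (at x)" for x
    by (intro has_derivative_scaleR_right D)
  show "(\<lambda>x. c *\<^sub>R \<phi> x) \<in> C1c U"
    by (rule C1cI[OF cD _ K(1,2)]) (use K(3) D(2) in \<open>auto intro!: continuous_intros\<close>)
  show "divergence (\<lambda>x. c *\<^sub>R \<phi> x) x = c * divergence \<phi> x"
  proof -
    have "divergence (\<lambda>x. c *\<^sub>R \<phi> x) x = (\<Sum>i\<in>UNIV. (c *\<^sub>R D x (axis i 1)) $ i)"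
      unfolding divergence_def frechet_derivative_at[OF cD, symmetric] ..
    then show ?thesis by (simp add: div sum_distrib_left)
  qed
qed

text \<open>Boundedness allows a test field to be normalised for \<open>TV\<close>; square
  integrability of the divergence makes the pairing with it continuous on the Hilbert space.\<close>

lemma C1c_bounded:
  assumes "\<phi> \<in> C1c U"
  shows "\<exists>B>0. \<forall>x. norm (\<phi> x) \<le> B" "\<Omega> \<in> sets lebesgue \<Longrightarrow> divergence \<phi> \<in> L2 \<Omega>"
proof -
  obtain D K where D: "\<And>x. (\<phi> has_derivative D x) (at x)" "\<And>h. continuous_on UNIV (\<lambda>x. D x h)"
    and K: "compact K" "K \<subseteq> U" "\<And>x. x \<notin> K \<Longrightarrow> \<phi> x = 0" "\<And>x h. x \<notin> K \<Longrightarrow> D x h = 0"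
    and div: "\<And>x. divergence \<phi> x = (\<Sum>i\<in>UNIV. D x (axis i 1) $ i)"
    using assms by (rule C1cE) blast
  have c: "continuous_on UNIV \<phi>" by (rule has_derivative_continuous_on) (rule D(1))
  have dc: "continuous_on UNIV (divergence \<phi>)" unfolding div[abs_def] by (intro continuous_intros D)
  have "bounded (\<phi> ` K)" by (intro compact_imp_bounded compact_continuous_image K continuous_on_subset[OF c]) auto
  then obtain B where B: "\<And>x. x \<in> K \<Longrightarrow> norm (\<phi> x) \<le> B" unfolding bounded_iff by blast
  have "norm (\<phi> x) \<le> \<bar>B\<bar> + 1" for x using B[of x] K(3)[of x] by (cases "x \<in> K") auto
  then show "\<exists>B>0. \<forall>x. norm (\<phi> x) \<le> B" by (intro exI[of _ "\<bar>B\<bar> + 1"]) auto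
  have m: "divergence \<phi> \<in> borel_measurable borel" by (rule borel_measurable_continuous_onI[OF dc])
  have c2: "continuous_on UNIV (\<lambda>x. (divergence \<phi> x)\<^sup>2)" by (intro continuous_intros dc)
  have "integrable lborel (\<lambda>x. indicator K x *\<^sub>R (divergence \<phi> x)\<^sup>2)"
    by (rule borel_integrable_compact[OF K(1) continuous_on_subset[OF c2 subset_UNIV]])
  moreover have "(\<lambda>x. indicator K x *\<^sub>R (divergence \<phi> x)\<^sup>2) = (\<lambda>x. (divergence \<phi> x)\<^sup>2)"
    using K(4) by (auto simp: fun_eq_iff indicator_def div)
  ultimately have "integrable lborel (\<lambda>x. (divergence \<phi> x)\<^sup>2)" by simp
  then have i: "integrable lebesgue (\<lambda>x. (divergence \<phi> x)\<^sup>2)" using m by (simp add: integrable_completion)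
  show "divergence \<phi> \<in> L2 \<Omega>" if \<Omega>: "\<Omega> \<in> sets lebesgue"
  proof -
    have "integrable (lebesgue_on \<Omega>) (\<lambda>x. (divergence \<phi> x)\<^sup>2)"
      using integrable_mult_indicator[OF \<Omega> i] \<Omega> by (subst integrable_restrict_space) auto
    moreover have "divergence \<phi> \<in> borel_measurable (lebesgue_on \<Omega>)"
      using m by (intro measurable_restrict_space1 measurable_completion) simp
    ultimately show ?thesis by (simp add: L2_iff)
  qed
qed

lemma TV_uminus:
  fixes U :: "(real ^ 'n) set"
  shows "TV U (\<lambda>x. - f x) = TV U f"
proof -
  have le: "TV U (\<lambda>x. - f x) \<le> TV U f" for f :: "real ^ 'n \<Rightarrow> real"
    unfolding TV_def
  proof (rule SUP_least)
    fix \<phi> assume \<phi>: "\<phi> \<in> {\<phi> \<in> C1c U. \<forall>x. norm (\<phi> x) \<le> 1}"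
    then have "(\<lambda>x. - \<phi> x) \<in> {\<phi> \<in> C1c U. \<forall>x. norm (\<phi> x) \<le> 1}"
      using C1c_scale(1)[of \<phi> U "- 1"] by simp
    moreover have "divergence (\<lambda>x. - \<phi> x) x = - divergence \<phi> x" for x
      using C1c_scale(2)[of \<phi> U "- 1"] \<phi> by simp
    then have "(LINT x|lebesgue_on U. - f x * divergence \<phi> x) = (LINT x|lebesgue_on U. f x * divergence (\<lambda>x. - \<phi> x) x)"
      by simp
    ultimately show "ennreal (LINT x|lebesgue_on U. - f x * divergence \<phi> x)
        \<le> (SUP \<phi>\<in>{\<phi> \<in> C1c U. \<forall>x. norm (\<phi> x) \<le> 1}. ennreal (LINT x|lebesgue_on U. f x * divergence \<phi> x))"
      by (intro SUP_upper2) auto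
  qed
  show ?thesis using le[of f] le[of "\<lambda>x. - f x"] by simp
qed

lemma TV_0: "TV U (\<lambda>_. 0) = 0"
  unfolding TV_def by (intro antisym SUP_least) simp_all

section \<open>The energies on a bounded open set\<close>

context
  fixes \<Omega> :: "(real ^ 'n) set"
  assumes \<Omega>: "open \<Omega>" and bdd: "bounded \<Omega>"
begin

lemma Omega_sets: "\<Omega> \<in> sets lebesgue" "\<Omega> \<in> sets borel" using \<Omega> by auto

lemma finite_measure_Omega: "finite_measure (lebesgue_on \<Omega>)"
proof (rule finite_measureI)
  have "emeasure lborel \<Omega> < \<infinity>" using bdd by (rule emeasure_bounded_finite)
  moreover have "space (lebesgue_on \<Omega>) = \<Omega>" by (simp add: space_restrict_space)
  ultimately show "emeasure (lebesgue_on \<Omega>) (space (lebesgue_on \<Omega>)) \<noteq> \<infinity>"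
    using Omega_sets by (simp add: emeasure_restrict_space less_top)
qed

lemma L2_imp_integrable:
  assumes "u \<in> L2 \<Omega>" shows "integrable (lebesgue_on \<Omega>) u"
proof -
  interpret finite_measure "lebesgue_on \<Omega>" by (rule finite_measure_Omega)
  have "integrable (lebesgue_on \<Omega>) (\<lambda>x. u x * 1)"
    by (rule integrable_mult_of_squares) (use assms in \<open>simp_all add: L2_iff\<close>)
  then show ?thesis by simp
qed

text \<open>Scaling removes the restriction to fields of norm at most 1, and changing the sign of
  the field turns the inequality into an equality. This places the kernel of \<open>TV\<close> in
  \<open>H1\<close> with zero gradient, where the approximating energies vanish too.\<close>

lemma TV_zero_imp_weak_gradient:
  assumes u: "u \<in> L2 \<Omega>" and TV0: "TV \<Omega> u = 0"
  shows "weak_gradient \<Omega> u (\<lambda>_. 0)"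
  unfolding weak_gradient_def
proof (intro conjI allI impI ballI)
  fix K assume K: "K \<subseteq> \<Omega>" "compact K"
  have Ks: "K \<in> sets lebesgue" using fmeasurableD[OF lmeasurable_compact[OF K(2)]] .
  have i: "integrable lebesgue (\<lambda>x. indicator \<Omega> x *\<^sub>R u x)"
    using L2_imp_integrable[OF u] Omega_sets by (subst (asm) integrable_restrict_space) auto
  have "integrable lebesgue (\<lambda>x. indicator K x *\<^sub>R (indicator \<Omega> x *\<^sub>R u x))"
    by (rule integrable_mult_indicator[OF Ks i])
  also have "(\<lambda>x. indicator K x *\<^sub>R (indicator \<Omega> x *\<^sub>R u x)) = (\<lambda>x. indicator K x *\<^sub>R u x)"
    using K(1) by (auto simp: indicator_def fun_eq_iff)
  finally show "integrable (lebesgue_on K) u" using Ks by (subst integrable_restrict_space) auto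
  show "integrable (lebesgue_on K) (\<lambda>_. 0 :: real ^ 'n)" by simp
next
  have le: "(LINT x|lebesgue_on \<Omega>. u x * divergence \<phi> x) \<le> 0" if \<phi>: "\<phi> \<in> C1c \<Omega>" for \<phi>
  proof -
    obtain B where B: "B > 0" "\<And>x. norm (\<phi> x) \<le> B" using C1c_bounded(1)[OF \<phi>] by blast
    let ?\<phi> = "\<lambda>x. inverse B *\<^sub>R \<phi> x"
    have "?\<phi> \<in> {\<phi> \<in> C1c \<Omega>. \<forall>x. norm (\<phi> x) \<le> 1}"
      using C1c_scale(1)[OF \<phi>] B by (auto simp: field_simps)
    then have "ennreal (LINT x|lebesgue_on \<Omega>. u x * divergence ?\<phi> x) \<le> TV \<Omega> u"
      unfolding TV_def by (rule SUP_upper)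
    then have "(LINT x|lebesgue_on \<Omega>. u x * divergence ?\<phi> x) \<le> 0"
      unfolding TV0 by (simp add: ennreal_eq_0_iff)
    moreover have "(LINT x|lebesgue_on \<Omega>. u x * divergence ?\<phi> x) = inverse B * (LINT x|lebesgue_on \<Omega>. u x * divergence \<phi> x)"
      unfolding C1c_scale(2)[OF \<phi>] by (simp add: mult.left_commute)
    ultimately show ?thesis using B(1) by (simp add: mult_le_0_iff)
  qed
  fix \<phi> assume \<phi>: "\<phi> \<in> C1c \<Omega>"
  have "(LINT x|lebesgue_on \<Omega>. u x * divergence (\<lambda>x. - 1 *\<^sub>R \<phi> x) x) \<le> 0" by (rule le[OF C1c_scale(1)[OF \<phi>]])
  then have "- (LINT x|lebesgue_on \<Omega>. u x * divergence \<phi> x) \<le> 0"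
    unfolding C1c_scale(2)[OF \<phi>] by simp
  then show "(LINT x|lebesgue_on \<Omega>. u x * divergence \<phi> x) = - (LINT x|lebesgue_on \<Omega>. 0 \<bullet> \<phi> x)"
    using le[OF \<phi>] by simp
qed

lemma wgrad_eq:
  assumes "weak_gradient \<Omega> u g" shows "AE x in lebesgue_on \<Omega>. wgrad \<Omega> u x = g x"
proof -
  have "weak_gradient \<Omega> u (wgrad \<Omega> u)" unfolding wgrad_def by (rule someI[of _ g]) (rule assms)
  then show ?thesis by (rule weak_gradient_unique[OF \<Omega> _ assms])
qed

lemma E_eps_eq:
  assumes "u \<in> L2 \<Omega>" "g \<in> Lp 2 \<Omega>" "weak_gradient \<Omega> u g"
  shows "E_eps \<Omega> \<epsilon> u = (\<integral>\<^sup>+x. ennreal (convexification (phi_eps \<epsilon>) (norm (g x))) \<partial>lebesgue_on \<Omega>)"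
proof -
  have "u \<in> H1 \<Omega>" using assms by (auto simp: W1p_def)
  moreover have "AE x in lebesgue_on \<Omega>. ennreal (convexification (phi_eps \<epsilon>) (norm (wgrad \<Omega> u x)))
      = ennreal (convexification (phi_eps \<epsilon>) (norm (g x)))"
    using wgrad_eq[OF assms(3)] by eventually_elim simp
  ultimately show ?thesis unfolding E_eps_def by (simp add: nn_integral_cong_AE)
qed

lemma E_eps_TV_zero:
  assumes "0 < \<epsilon>" "u \<in> L2 \<Omega>" "TV \<Omega> u = 0"
  shows "E_eps \<Omega> \<epsilon> u = 0"
proof -
  have "(\<lambda>_. 0 :: real ^ 'n) \<in> Lp 2 \<Omega>" by (simp add: L2_iff)
  then have "E_eps \<Omega> \<epsilon> u = (\<integral>\<^sup>+x. ennreal (convexification (phi_eps \<epsilon>) (norm (0 :: real ^ 'n))) \<partial>lebesgue_on \<Omega>)"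
    using E_eps_eq[OF assms(2) _ TV_zero_imp_weak_gradient[OF assms(2,3)]] by blast
  then show ?thesis using convexification_phi_0[OF assms(1)] by simp
qed

text \<open>The affine lower bound on the integrand, integrated; its constant part costs
  \<open>\<eta>\<close> times the measure of \<Omega>.\<close>

lemma TV_le_E_eps:
  assumes lower: "\<And>\<sigma>. (1 - \<eta>) * \<sigma> - \<eta> \<le> convexification (phi_eps \<epsilon>) \<sigma>" and \<eta>: "0 < \<eta>" "\<eta> < 1"
    and fin: "E_eps \<Omega> \<epsilon> u < \<infinity>"
  shows "ennreal (1 - \<eta>) * TV \<Omega> u \<le> E_eps \<Omega> \<epsilon> u + ennreal \<eta> * ennreal (measure lebesgue \<Omega>)"
proof -
  have "u \<in> H1 \<Omega>" using fin by (auto simp: E_eps_def split: if_splits)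
  then obtain g where g: "u \<in> L2 \<Omega>" "g \<in> Lp 2 \<Omega>" "weak_gradient \<Omega> u g" by (auto simp: W1p_def)
  have gm[measurable]: "g \<in> borel_measurable (lebesgue_on \<Omega>)" using g(2) by (simp add: L2_iff)
  have "ennreal (1 - \<eta>) * TV \<Omega> u \<le> ennreal (1 - \<eta>) * (\<integral>\<^sup>+x. ennreal (norm (g x)) \<partial>lebesgue_on \<Omega>)"
    by (intro mult_left_mono TV_le_weak_gradient g) simp
  also have "\<dots> = (\<integral>\<^sup>+x. ennreal ((1 - \<eta>) * norm (g x)) \<partial>lebesgue_on \<Omega>)"
    using \<eta> by (subst nn_integral_cmult[symmetric]) (auto simp: ennreal_mult)
  also have "\<dots> \<le> (\<integral>\<^sup>+x. ennreal ((1 - \<eta>) * norm (g x) - \<eta>) + ennreal \<eta> \<partial>lebesgue_on \<Omega>)"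
  proof (rule nn_integral_mono)
    fix x
    \<comment> \<open>The coercion sends negative values of the affine bound to 0, so the positive
      part is written out.\<close>
    have "ennreal ((1 - \<eta>) * norm (g x)) \<le> ennreal (max 0 ((1 - \<eta>) * norm (g x) - \<eta>) + \<eta>)" by (intro ennreal_leI) auto
    also have "\<dots> = ennreal ((1 - \<eta>) * norm (g x) - \<eta>) + ennreal \<eta>" using \<eta> by (simp add: max_def ennreal_neg)
    finally show "ennreal ((1 - \<eta>) * norm (g x)) \<le> ennreal ((1 - \<eta>) * norm (g x) - \<eta>) + ennreal \<eta>" .
  qed
  also have "\<dots> = (\<integral>\<^sup>+x. ennreal ((1 - \<eta>) * norm (g x) - \<eta>) \<partial>lebesgue_on \<Omega>) + (\<integral>\<^sup>+x. ennreal \<eta> \<partial>lebesgue_on \<Omega>)"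
    by (rule nn_integral_add) measurable
  also have "\<dots> \<le> E_eps \<Omega> \<epsilon> u + ennreal \<eta> * ennreal (measure lebesgue \<Omega>)"
  proof (rule add_mono)
    show "(\<integral>\<^sup>+x. ennreal ((1 - \<eta>) * norm (g x) - \<eta>) \<partial>lebesgue_on \<Omega>) \<le> E_eps \<Omega> \<epsilon> u"
      unfolding E_eps_eq[OF g] by (intro nn_integral_mono ennreal_leI lower)
    have "emeasure lborel \<Omega> < \<infinity>" using bdd by (rule emeasure_bounded_finite)
    then have 1: "emeasure lebesgue \<Omega> = ennreal (measure lebesgue \<Omega>)"
      using Omega_sets by (intro emeasure_eq_ennreal_measure) (simp add: less_top)
    have 2: "emeasure (lebesgue_on \<Omega>) \<Omega> = emeasure lebesgue \<Omega>"
      using Omega_sets(1) by (simp add: emeasure_restrict_space)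
    have 3: "space (lebesgue_on \<Omega>) = \<Omega>" by (simp add: space_restrict_space)
    show "(\<integral>\<^sup>+x. ennreal \<eta> \<partial>lebesgue_on \<Omega>) \<le> ennreal \<eta> * ennreal (measure lebesgue \<Omega>)"
      by (simp only: nn_integral_const 3 2 1 order_refl)
  qed
  finally show ?thesis .
qed

text \<open>The gradient of a continuously differentiable function is bounded on the compact closure
  of \<Omega>, and the upper bound on the integrand is uniform on bounded ranges.\<close>

lemma E_eps_C1_le:
  assumes v: "v \<in> L2 \<Omega>" "\<And>x. (v has_derivative (\<lambda>h. g x \<bullet> h)) (at x)" and g: "continuous_on UNIV g" and "0 < \<eta>"
  shows "\<forall>\<^sub>F \<epsilon> in at_right 0. E_eps \<Omega> \<epsilon> v \<le> ennreal ((1 + \<eta>) * (LINT x|lborel. indicator \<Omega> x * norm (g x)))"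
proof -
  interpret finite_measure "lebesgue_on \<Omega>" by (rule finite_measure_Omega)
  have "bounded (g ` closure \<Omega>)"
    using bdd by (intro compact_imp_bounded compact_continuous_image continuous_on_subset[OF g]) (auto simp: compact_closure)
  then obtain M where M: "\<And>x. x \<in> closure \<Omega> \<Longrightarrow> norm (g x) \<le> M" unfolding bounded_iff by blast
  then have M: "norm (g x) \<le> M" if "x \<in> \<Omega>" for x using that closure_subset by blast
  have gb: "g \<in> borel_measurable borel" by (rule borel_measurable_continuous_onI[OF g])
  have gm[measurable]: "g \<in> borel_measurable (lebesgue_on \<Omega>)"
    using gb by (intro measurable_restrict_space1 measurable_completion) simp
  have gL: "g \<in> Lp 2 \<Omega>"
    unfolding L2_iff
  proof
    show "integrable (lebesgue_on \<Omega>) (\<lambda>x. (norm (g x))\<^sup>2)"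
      by (rule integrable_const_bound[of _ "M\<^sup>2"])
        (use power_mono[OF M norm_ge_zero, of _ 2] in \<open>auto simp: space_restrict_space intro!: AE_I2\<close>)
  qed (rule gm)
  have int: "integrable (lebesgue_on \<Omega>) (\<lambda>x. norm (g x))"
    by (rule integrable_const_bound[of _ M]) (use M in \<open>auto simp: space_restrict_space intro!: AE_I2\<close>)
  have wg: "weak_gradient \<Omega> v g" by (rule weak_gradient_C1[OF \<Omega> v(2) g])
  have eq: "(LINT x|lebesgue_on \<Omega>. norm (g x)) = (LINT x|lborel. indicator \<Omega> x * norm (g x))"
  proof -
    have [measurable]: "(\<lambda>x. indicator \<Omega> x * norm (g x)) \<in> borel_measurable borel"
      using Omega_sets gb by (intro borel_measurable_times borel_measurable_indicator borel_measurable_norm[THEN measurable_compose[rotated]]) auto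
    have "(LINT x|lebesgue_on \<Omega>. norm (g x)) = (LINT x|lebesgue. indicator \<Omega> x *\<^sub>R norm (g x))"
      using Omega_sets by (subst integral_restrict_space) auto
    then show ?thesis by (simp add: integral_completion)
  qed
  have "\<forall>\<^sub>F \<epsilon> in at_right 0. \<forall>\<sigma>. 0 \<le> \<sigma> \<and> \<sigma> \<le> M \<longrightarrow> convexification (phi_eps \<epsilon>) \<sigma> \<le> (1 + \<eta>) * \<sigma>"
    by (rule convexification_phi_upper[OF \<open>0 < \<eta>\<close>])
  then show ?thesis
  proof eventually_elim
    case (elim \<epsilon>)
    have "E_eps \<Omega> \<epsilon> v = (\<integral>\<^sup>+x. ennreal (convexification (phi_eps \<epsilon>) (norm (g x))) \<partial>lebesgue_on \<Omega>)"
      by (rule E_eps_eq[OF v(1) gL wg])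
    also have "\<dots> \<le> (\<integral>\<^sup>+x. ennreal ((1 + \<eta>) * norm (g x)) \<partial>lebesgue_on \<Omega>)"
      using elim M by (intro nn_integral_mono ennreal_leI) (auto simp: space_restrict_space)
    also have "\<dots> = ennreal (LINT x|lebesgue_on \<Omega>. (1 + \<eta>) * norm (g x))"
      using int \<open>0 < \<eta>\<close> by (intro nn_integral_eq_integral) auto
    finally show ?case by (simp add: eq)
  qed
qed

end

lemma tendsto_0_ennrealI:
  fixes f :: "'a \<Rightarrow> ennreal"
  assumes "\<And>e. 0 < e \<Longrightarrow> \<forall>\<^sub>F x in F. f x \<le> ennreal e"
  shows "(f \<longlongrightarrow> 0) F"
proof (rule order_tendstoI)
  fix a :: ennreal assume "0 < a"
  then obtain e where e: "0 < e" "ennreal e < a"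
  proof (cases a)
    case (real r)
    then show ?thesis using that[of "r / 2"] \<open>0 < a\<close> by (simp add: ennreal_less_iff)
  next
    case top
    then show ?thesis using that[of 1] by simp
  qed
  show "\<forall>\<^sub>F x in F. f x < a" using assms[OF e(1)] by eventually_elim (rule le_less_trans[OF _ e(2)])
qed simp

theorem theorem2p2:
  fixes \<Omega> :: "(real ^ 'n) set"
    and u\<^sub>0 :: "real ^ 'n \<Rightarrow> real"
    and u\<^sub>0\<^sub>\<epsilon> :: "real \<Rightarrow> real ^ 'n \<Rightarrow> real"
    and u\<^sub>\<epsilon> :: "real \<Rightarrow> real \<Rightarrow> real ^ 'n \<Rightarrow> real"
    and u :: "real \<Rightarrow> real ^ 'n \<Rightarrow> real"
  assumes "bounded \<Omega>" and "extension_domain \<Omega>"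
    and "u\<^sub>0 \<in> L2 \<Omega>"
    and "\<And>\<epsilon>. \<epsilon> \<in> {0<..<1} \<Longrightarrow> u\<^sub>0\<^sub>\<epsilon> \<epsilon> \<in> L2 \<Omega>"
    and "((\<lambda>\<epsilon>. L2_edist \<Omega> (u\<^sub>0\<^sub>\<epsilon> \<epsilon>) u\<^sub>0) \<longlongrightarrow> 0) (at_right 0)"
    and "\<And>\<epsilon>. \<epsilon> \<in> {0<..<1} \<Longrightarrow> gradient_flow \<Omega> (E_eps \<Omega> \<epsilon>) (u\<^sub>0\<^sub>\<epsilon> \<epsilon>) (u\<^sub>\<epsilon> \<epsilon>)"
    and "gradient_flow \<Omega> (TV \<Omega>) u\<^sub>0 u"
  shows "((\<lambda>\<epsilon>. SUP t\<in>{0..}. L2_edist \<Omega> (u\<^sub>\<epsilon> \<epsilon> t) (u t)) \<longlongrightarrow> 0) (at_right 0)"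
proof (rule tendsto_0_ennrealI)
  fix e :: real assume "0 < e"
  note bdd = assms(1) and ext = assms(2)
  have \<Omega>: "open \<Omega>" using ext by (simp add: extension_domain_def)
  note \<Omega>s = Omega_sets(1)[OF \<Omega> bdd]
  have unit: "\<forall>\<^sub>F \<epsilon> in at_right 0. \<epsilon> \<in> {0<..<1::real}" by (rule eventually_at_right_real) simp
  let ?G = "graph \<Omega> (TV \<Omega>)" and ?G' = "\<lambda>\<epsilon>. graph \<Omega> (E_eps \<Omega> \<epsilon>)"
  obtain D \<psi> N where flow: "grad_flow ?G (\<lambda>t. cls \<Omega> (u t)) D \<psi> N"
    using gradient_flow_imp_grad_flow[OF \<Omega>s assms(7) TV_0] by blast
  have E0: "E_eps \<Omega> \<epsilon> (\<lambda>_. 0) = 0" if "\<epsilon> \<in> {0<..<1}" for \<epsilon>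
    using E_eps_TV_zero[OF \<Omega> bdd _ L2_0[OF \<Omega>s] TV_0] that by simp
  have "\<forall>\<epsilon>. \<exists>D \<psi> N. \<epsilon> \<in> {0<..<1} \<longrightarrow> grad_flow (?G' \<epsilon>) (\<lambda>t. cls \<Omega> (u\<^sub>\<epsilon> \<epsilon> t)) D \<psi> N"
    using gradient_flow_imp_grad_flow[OF \<Omega>s assms(6) E0] by blast
  then obtain D' \<psi>' N' where flow': "\<And>\<epsilon>. \<epsilon> \<in> {0<..<1} \<Longrightarrow>
      grad_flow (?G' \<epsilon>) (\<lambda>t. cls \<Omega> (u\<^sub>\<epsilon> \<epsilon> t)) (D' \<epsilon>) (\<psi>' \<epsilon>) (N' \<epsilon>)"
    by metis
  have uL: "u t \<in> L2 \<Omega>" if "0 \<le> t" for t using assms(7) that by (simp add: gradient_flow_def)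
  have u\<epsilon>L: "u\<^sub>\<epsilon> \<epsilon> t \<in> L2 \<Omega>" if "\<epsilon> \<in> {0<..<1}" "0 \<le> t" for \<epsilon> t
    using assms(6)[OF that(1)] that(2) by (simp add: gradient_flow_def)
  have init: "((\<lambda>\<epsilon>. norm (cls \<Omega> (u\<^sub>\<epsilon> \<epsilon> 0) - cls \<Omega> (u 0))) \<longlongrightarrow> 0) (at_right 0)"
  proof -
    have u0: "cls \<Omega> (u 0) = cls \<Omega> u\<^sub>0"
      using assms(7) uL[of 0] assms(3) by (intro cls_eqI[OF \<Omega>s]) (auto simp: gradient_flow_def)
    have "\<forall>\<^sub>F \<epsilon> in at_right 0. L2_edist \<Omega> (u\<^sub>0\<^sub>\<epsilon> \<epsilon>) u\<^sub>0 = ennreal (norm (cls \<Omega> (u\<^sub>\<epsilon> \<epsilon> 0) - cls \<Omega> (u 0)))"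
      using unit
    proof eventually_elim
      case (elim \<epsilon>)
      have "cls \<Omega> (u\<^sub>\<epsilon> \<epsilon> 0) = cls \<Omega> (u\<^sub>0\<^sub>\<epsilon> \<epsilon>)"
        using assms(6)[OF elim] u\<epsilon>L[OF elim, of 0] assms(4)[OF elim]
        by (intro cls_eqI[OF \<Omega>s]) (auto simp: gradient_flow_def)
      then show ?case using L2_edist_cls[OF \<Omega>s assms(4)[OF elim] assms(3)] u0 by simp
    qed
    then have "((\<lambda>\<epsilon>. ennreal (norm (cls \<Omega> (u\<^sub>\<epsilon> \<epsilon> 0) - cls \<Omega> (u 0)))) \<longlongrightarrow> ennreal 0) (at_right 0)"
      using assms(5) by (simp add: tendsto_cong)
    then show ?thesis by (subst (asm) tendsto_ennreal_iff) auto
  qed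
  have sym: "(- y, b) \<in> ?G" if yb: "(y, b) \<in> ?G" for y b
  proof -
    obtain v where v: "y = cls \<Omega> v" "b = enn2real (TV \<Omega> v)" "v \<in> L2 \<Omega>" "TV \<Omega> v < \<infinity>"
      using yb by (auto simp: graph_def[OF \<Omega>s])
    have "- y = cls \<Omega> (\<lambda>x. - v x)" "(\<lambda>x. - v x) \<in> L2 \<Omega>"
      using cls_scale[OF \<Omega>s v(3), of "- 1"] L2_scale[OF \<Omega>s v(3), of "- 1"] v(1) by simp_all
    then show ?thesis using v TV_uminus[of \<Omega> v] unfolding graph_def[OF \<Omega>s] by (intro CollectI exI[of _ "\<lambda>x. - v x"]) simp
  qed
  have liminf: "\<forall>\<^sub>F \<epsilon> in at_right 0. \<forall>y b. (y, b) \<in> ?G' \<epsilon> \<and> b \<le> K \<longrightarrow> (\<exists>c\<le>b + \<delta>. (y, c) \<in> ?G)"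
    if "0 < \<delta>" for K \<delta>
  proof -
    define m where "m = measure lebesgue \<Omega>"
    \<comment> \<open>From \<open>(1 - \<eta>) * c \<le> b + \<eta> * m\<close> one wants
      \<open>c \<le> b + \<delta>\<close>. Given \<open>\<eta> \<le> 1 / 2\<close> and
      \<open>b \<le> K\<close>, it suffices that
      \<open>\<eta> * (\<bar>K\<bar> + m) \<le> \<delta> / 2\<close>.\<close>
    define \<eta> where "\<eta> = min (1 / 2) (\<delta> / (2 * (\<bar>K\<bar> + m + 1)))"
    have m: "0 \<le> m" by (simp add: m_def)
    have "\<eta> \<le> 1 / 2" unfolding \<eta>_def by (rule min.cobounded1)
    moreover have "0 < \<eta>" using \<open>0 < \<delta>\<close> m by (auto simp: \<eta>_def intro!: divide_pos_pos add_nonneg_pos)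
    ultimately have \<eta>: "0 < \<eta>" "\<eta> < 1" "\<eta> \<le> 1 / 2" by auto
    have "\<eta> \<le> \<delta> / (2 * (\<bar>K\<bar> + m + 1))" by (simp add: \<eta>_def)
    then have "\<eta> * (2 * (\<bar>K\<bar> + m + 1)) \<le> \<delta>" using m by (subst (asm) pos_le_divide_eq) (auto simp: add_nonneg_pos)
    then have \<eta>\<delta>: "2 * (\<eta> * (\<bar>K\<bar> + m)) \<le> \<delta>" using \<eta> by (simp add: algebra_simps)
    show ?thesis
      using convexification_phi_lower[OF \<eta>(1,2)]
    proof eventually_elim
      case (elim \<epsilon>)
      show ?case
      proof (intro allI impI)
        fix y b assume yb: "(y, b) \<in> ?G' \<epsilon> \<and> b \<le> K"
        then obtain v where v: "y = cls \<Omega> v" "b = enn2real (E_eps \<Omega> \<epsilon> v)" "v \<in> L2 \<Omega>" "E_eps \<Omega> \<epsilon> v < \<infinity>"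
          by (auto simp: graph_def[OF \<Omega>s])
        have b: "0 \<le> b" "E_eps \<Omega> \<epsilon> v = ennreal b" using v(2,4) by (auto simp: less_top)
        have "ennreal (1 - \<eta>) * TV \<Omega> v \<le> E_eps \<Omega> \<epsilon> v + ennreal \<eta> * ennreal m"
          unfolding m_def using elim by (intro TV_le_E_eps[OF \<Omega> bdd _ \<eta>(1,2) v(4)]) auto
        also have "\<dots> = ennreal (b + \<eta> * m)" using b m \<eta> by (simp add: ennreal_mult[symmetric] ennreal_plus[symmetric] del: ennreal_plus)
        finally have le: "ennreal (1 - \<eta>) * TV \<Omega> v \<le> ennreal (b + \<eta> * m)" .
        then have fin: "TV \<Omega> v < \<infinity>"
          using \<eta> by (cases "TV \<Omega> v") (auto simp: ennreal_mult_top top_unique)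
        define c where "c = enn2real (TV \<Omega> v)"
        have c: "0 \<le> c" "TV \<Omega> v = ennreal c" using fin by (auto simp: c_def less_top)
        have "ennreal ((1 - \<eta>) * c) \<le> ennreal (b + \<eta> * m)"
          using le \<eta> c by (simp add: ennreal_mult del: ennreal_plus)
        then have "(1 - \<eta>) * c \<le> b + \<eta> * m"
          using b m \<eta> by (subst (asm) ennreal_le_iff) auto
        also have "\<dots> \<le> (1 - \<eta>) * (b + \<delta>)"
        proof -
          have "\<eta> * b \<le> \<eta> * \<bar>K\<bar>" using yb \<eta> by (intro mult_left_mono) auto
          moreover have "(1 / 2) * \<delta> \<le> (1 - \<eta>) * \<delta>" using \<eta> \<open>0 < \<delta>\<close> by (intro mult_right_mono) auto
          ultimately show ?thesis using \<eta>\<delta> by (simp add: algebra_simps)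
        qed
        finally have "c \<le> b + \<delta>" using \<eta> by (simp add: mult_le_cancel_left_pos)
        then show "\<exists>c\<le>b + \<delta>. (y, c) \<in> ?G"
          using v fin by (intro exI[of _ c]) (auto simp: graph_def[OF \<Omega>s] c_def)
      qed
    qed
  qed
  have limsup: "\<exists>v. norm (v - y) < \<delta> \<and> (\<forall>\<^sub>F \<epsilon> in at_right 0. \<exists>c\<le>b + \<delta>. (v, c) \<in> ?G' \<epsilon>)"
    if yb: "(y, b) \<in> ?G" and "0 < \<delta>" for y b \<delta>
  proof -
    obtain w where w: "y = cls \<Omega> w" "b = enn2real (TV \<Omega> w)" "w \<in> L2 \<Omega>" "TV \<Omega> w < \<infinity>"
      using yb by (auto simp: graph_def[OF \<Omega>s])
    have b: "0 \<le> b" "TV \<Omega> w = ennreal b" using w(2,4) by (auto simp: less_top)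
    obtain v g where v: "\<And>x. (v has_derivative (\<lambda>h. g x \<bullet> h)) (at x)" "continuous_on UNIV g" "v \<in> L2 \<Omega>"
      "norm (cls \<Omega> v - cls \<Omega> w) < \<delta> / 2"
      "ennreal (LINT x|lborel. indicator \<Omega> x * norm (g x)) \<le> TV \<Omega> w + ennreal (\<delta> / 2)"
      using recovery[OF bdd ext w(3,4), of "\<delta> / 2"] \<open>0 < \<delta>\<close> by auto
    define I where "I = (LINT x|lborel. indicator \<Omega> x * norm (g x))"
    have "0 \<le> I" unfolding I_def by (intro Bochner_Integration.integral_nonneg) auto
    have I: "I \<le> b + \<delta> / 2"
      using v(5) b \<open>0 < \<delta>\<close> \<open>0 \<le> I\<close> unfolding I_def[symmetric] by (simp add: ennreal_plus[symmetric] del: ennreal_plus)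
    \<comment> \<open>Keeps \<open>\<eta> * I\<close> below \<open>\<delta> / 2\<close>; the other
      half of \<open>\<delta>\<close> is spent by the recovery element.\<close>
    define \<eta> where "\<eta> = \<delta> / (2 * (I + 1))"
    have "0 < \<eta>" using \<open>0 < \<delta>\<close> \<open>0 \<le> I\<close> by (simp add: \<eta>_def)
    have "\<eta> * I \<le> \<eta> * (I + 1)" using \<open>0 < \<eta>\<close> by simp
    also have "\<dots> = \<delta> / 2" using \<open>0 \<le> I\<close> by (simp add: \<eta>_def divide_simps)
    finally have \<eta>I: "(1 + \<eta>) * I \<le> b + \<delta>" using I by (simp add: algebra_simps)
    have "\<forall>\<^sub>F \<epsilon> in at_right 0. \<exists>c\<le>b + \<delta>. (cls \<Omega> v, c) \<in> ?G' \<epsilon>"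
      using E_eps_C1_le[OF \<Omega> bdd v(3,1,2) \<open>0 < \<eta>\<close>]
    proof eventually_elim
      case (elim \<epsilon>)
      have fin: "E_eps \<Omega> \<epsilon> v < \<infinity>" using elim by (rule le_less_trans) simp
      have "enn2real (E_eps \<Omega> \<epsilon> v) \<le> (1 + \<eta>) * I"
        using elim \<open>0 < \<eta>\<close> \<open>0 \<le> I\<close> unfolding I_def[symmetric] by (intro enn2real_leI) auto
      then have "enn2real (E_eps \<Omega> \<epsilon> v) \<le> b + \<delta>" using \<eta>I by simp
      then show ?case using fin v(3) by (intro exI[of _ "enn2real (E_eps \<Omega> \<epsilon> v)"]) (auto simp: graph_def[OF \<Omega>s])
    qed
    then show ?thesis using v(4) w(1) \<open>0 < \<delta>\<close> by (intro exI[of _ "cls \<Omega> v"]) auto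
  qed
  have kernel: "\<exists>z. y \<longlonglongrightarrow> z \<and> (z, 0) \<in> ?G \<and> (\<forall>\<epsilon>\<in>{0<..<1}. (z, 0) \<in> ?G' \<epsilon>)"
    if yb: "\<And>n::nat. (y n, b n) \<in> ?G" and "Cauchy y" "b \<longlonglongrightarrow> 0" for y b
  proof -
    have "\<forall>n. \<exists>v. y n = cls \<Omega> v \<and> b n = enn2real (TV \<Omega> v) \<and> v \<in> L2 \<Omega> \<and> TV \<Omega> v < \<infinity>"
      using yb by (auto simp: graph_def[OF \<Omega>s])
    then obtain f where f: "\<And>n. y n = cls \<Omega> (f n)" "\<And>n. b n = enn2real (TV \<Omega> (f n))" "\<And>n. f n \<in> L2 \<Omega>" "\<And>n. TV \<Omega> (f n) < \<infinity>"
      by metis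
    have yf: "y = (\<lambda>n. cls \<Omega> (f n))" using f(1) by auto
    have "emeasure lebesgue \<Omega> < \<infinity>" using emeasure_bounded_finite[OF bdd] \<Omega> by simp
    then obtain g where g: "g \<in> L2 \<Omega>" "y \<longlonglongrightarrow> cls \<Omega> g"
      using L2_complete[where f = f, OF \<Omega>s _ f(3)] \<open>Cauchy y\<close> unfolding yf by blast
    \<comment> \<open>Lower semicontinuity, one field at a time: the pairing with a fixed divergence
      is continuous, and along the sequence it is bounded by \<open>b n\<close>, which tends to
      0.\<close>
    have "TV \<Omega> g \<le> 0"
      unfolding TV_def
    proof (rule SUP_least)
      fix \<phi> assume \<phi>: "\<phi> \<in> {\<phi> \<in> C1c \<Omega>. \<forall>x. norm (\<phi> x) \<le> 1}"
      then have d: "divergence \<phi> \<in> L2 \<Omega>" using C1c_bounded(2)[OF _ \<Omega>s] by blast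
      have "(\<lambda>n. y n \<bullet> cls \<Omega> (divergence \<phi>)) \<longlonglongrightarrow> cls \<Omega> g \<bullet> cls \<Omega> (divergence \<phi>)"
        by (intro tendsto_intros g)
      moreover have "y n \<bullet> cls \<Omega> (divergence \<phi>) \<le> b n" for n
      proof -
        have "ennreal (LINT x|lebesgue_on \<Omega>. f n x * divergence \<phi> x) \<le> TV \<Omega> (f n)"
          unfolding TV_def using \<phi> by (rule SUP_upper)
        also have "\<dots> = ennreal (b n)" using f(2,4)[of n] by (simp add: less_top)
        finally have "(LINT x|lebesgue_on \<Omega>. f n x * divergence \<phi> x) \<le> b n"
          using f(2)[of n] by (simp add: ennreal_le_iff)
        then show ?thesis unfolding f(1) inner_cls[OF \<Omega>s f(3) d] L2_inner_def .
      qed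
      ultimately have "cls \<Omega> g \<bullet> cls \<Omega> (divergence \<phi>) \<le> 0"
        using \<open>b \<longlonglongrightarrow> 0\<close> by (intro LIMSEQ_le) auto
      then show "ennreal (LINT x|lebesgue_on \<Omega>. g x * divergence \<phi> x) \<le> 0"
        unfolding inner_cls[OF \<Omega>s g(1) d] L2_inner_def by (simp add: ennreal_neg)
    qed
    then have TV0: "TV \<Omega> g = 0" by simp
    then have "(cls \<Omega> g, 0) \<in> ?G" using g(1) by (auto simp: graph_def[OF \<Omega>s] intro!: exI[of _ g])
    moreover have "(cls \<Omega> g, 0) \<in> ?G' \<epsilon>" if "\<epsilon> \<in> {0<..<1}" for \<epsilon>
      using E_eps_TV_zero[OF \<Omega> bdd _ g(1) TV0, of \<epsilon>] that g(1) by (auto simp: graph_def[OF \<Omega>s] intro!: exI[of _ g])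
    ultimately show ?thesis using g(2) by blast
  qed
  have "\<forall>\<^sub>F \<epsilon> in at_right 0. \<forall>t\<ge>0. norm (cls \<Omega> (u\<^sub>\<epsilon> \<epsilon> t) - cls \<Omega> (u t)) \<le> e"
    by (rule flow_convergence[OF flow flow' init sym liminf limsup kernel \<open>0 < e\<close>])
  then show "\<forall>\<^sub>F \<epsilon> in at_right 0. (SUP t\<in>{0..}. L2_edist \<Omega> (u\<^sub>\<epsilon> \<epsilon> t) (u t)) \<le> ennreal e"
    using unit
  proof eventually_elim
    case (elim \<epsilon>)
    show ?case
    proof (rule SUP_least)
      fix t :: real assume "t \<in> {0..}"
      then show "L2_edist \<Omega> (u\<^sub>\<epsilon> \<epsilon> t) (u t) \<le> ennreal e"
        using elim u\<epsilon>L uL by (simp add: L2_edist_cls[OF \<Omega>s] ennreal_leI)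
    qed
  qed
qed

end
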